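(* Let $H:[0,T]\times\mathbb{R}^n\times\mathbb{R}^n\to\mathbb{R}$ satisfy (H1)–(H4) and (HLC), with $c(\cdot)$, each $k_R(\cdot)$ and $t\mapsto H(t,0,0)$ integrable on $[0,T]$, and let $g:\mathbb{R}^n\to\mathbb{R}$ be locally Lipschitz. Then for every $M>0$ there exists $\lambda_M\in L^1([0,T],\mathbb{R})$ such that for all $(t_0,x_0)\in[0,T]\times\bar B_M$ and every minimizer $\bar x(\cdot)$ of $$\Theta[x(\cdot)]=g(x(T))+\int_{t_0}^T H^*(t,x(t),\dot x(t))\,dt\quad\text{over } x(\cdot)\in\mathcal{A}([t_0,T],\mathbb{R}^n),\ x(t_0)=x_0,$$ one has $\big|\big(\dot{\bar x}(t),H^*(t,\bar x(t),\dot{\bar x}(t))\big)\big|\le\lambda_M(t)$ for a.e. $t\in[t_0,T]$. Additionally, if $H$, $k_R(\cdot)$ and $c(\cdot)$ are continuous, then there exists a continuous $\lambda_M$ satisfying this inequality.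
   Context: Hypotheses: (H1) $H(\cdot,x,p)$ Lebesgue measurable; (H2) $H(t,\cdot,\cdot)$ continuous; (H3) $H(t,x,\cdot)$ convex; (H4) there is measurable $c\ge0$ with $|H(t,x,p)-H(t,x,q)|\le c(t)(1+|x|)|p-q|$; (HLC) for each $R>0$ there is measurable $k_R\ge0$ with $|H(t,x,p)-H(t,y,p)|\le k_R(t)(1+|p|)|x-y|$ for $x,y\in\bar B_R$ (closed ball radius $R$ about $0$), all $p$. $H^*(t,x,v)=\sup_p\{\langle v,p\rangle-H(t,x,p)\}$. $\mathcal{A}$ denotes absolutely continuous functions. *)

theory Defs
  imports "HOL-Analysis.Analysis"
begin

definition abs_continuous_on :: "real \<Rightarrow> real \<Rightarrow> (real \<Rightarrow> 'a::real_normed_vector) \<Rightarrow> bool" where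
  "abs_continuous_on a b x \<longleftrightarrow>
     (\<forall>\<epsilon>>0. \<exists>\<delta>>0. \<forall>(n::nat) (s::nat \<Rightarrow> real) (u::nat \<Rightarrow> real).
        (\<forall>i<n. a \<le> s i \<and> s i \<le> u i \<and> u i \<le> b) \<and>
        (\<forall>i<n. \<forall>j<n. i \<noteq> j \<longrightarrow> u i \<le> s j \<or> u j \<le> s i) \<and>
        (\<Sum>i<n. u i - s i) < \<delta>
        \<longrightarrow> (\<Sum>i<n. norm (x (u i) - x (s i))) < \<epsilon>)"

definition Hstar :: "(real \<Rightarrow> 'a::euclidean_space \<Rightarrow> 'a \<Rightarrow> real) \<Rightarrow> real \<Rightarrow> 'a \<Rightarrow> 'a \<Rightarrow> ereal" where
  "Hstar H t x v = (SUP p. ereal (inner v p - H t x p))"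

definition Theta :: "(real \<Rightarrow> 'a::euclidean_space \<Rightarrow> 'a \<Rightarrow> real) \<Rightarrow> ('a \<Rightarrow> real) \<Rightarrow> real \<Rightarrow> real
    \<Rightarrow> (real \<Rightarrow> 'a) \<Rightarrow> ereal" where
  "Theta H g T t0 x =
     (let f = (\<lambda>t. Hstar H t (x t) (vector_derivative x (at t))) in
      if (AE t in lebesgue. t \<in> {t0..T} \<longrightarrow> \<bar>f t\<bar> \<noteq> \<infinity>)
         \<and> (\<lambda>t. real_of_ereal (f t)) absolutely_integrable_on {t0..T}
      then ereal (g (x T) + integral {t0..T} (\<lambda>t. real_of_ereal (f t)))
      else \<infinity>)"

definition is_minimizer where
  "is_minimizer H g T t0 x0 x \<longleftrightarrow>
     abs_continuous_on t0 T x \<and> x t0 = x0 \<and>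
     (\<forall>y. abs_continuous_on t0 T y \<and> y t0 = x0 \<longrightarrow> Theta H g T t0 x \<le> Theta H g T t0 y)"

definition velocity_bound where
  "velocity_bound H T t0 x lam \<longleftrightarrow>
     (AE t in lebesgue. t \<in> {t0..T} \<longrightarrow>
        (\<exists>h. Hstar H t (x t) (vector_derivative x (at t)) = ereal h \<and>
             norm (vector_derivative x (at t), h) \<le> lam t))"

end

theory Submission
  imports Defs
begin

text \<open>
  The bound is obtained by direct comparison, without a maximum principle. Let \<open>R\<close> be the Gronwall
  radius confining all trajectories that start in the ball of radius \<open>M\<close>. Given a minimizer \<open>x\<close>,
  follow its velocity wherever the Lagrangian is below
  \<open>\<mu> t = \<bar>H t 0 0\<bar> + R k\<^sub>R t + 2 B (1 + R) c t\<close>, and elsewhere use a velocity in \<open>\<partial>\<^sub>p H t x 0\<close>,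
  whose Lagrangian is \<open>- H t x 0\<close>. Filippov's theorem turns this velocity field along \<open>x\<close> into a
  genuine competitor whose extra cost is at most \<open>B\<close> times the integral of \<open>2 (1 + R) c\<close> over the
  exceptional set, where \<open>B\<close> depends only on \<open>M\<close>. Optimality of \<open>x\<close> then makes the exceptional set
  negligible. Continuity of \<open>\<mu>\<close> is inherited from that of the data.
\<close>

section \<open>Measurable selections and convex separation\<close>

text \<open>The Lagrangian is extended-valued, and moving the state may take a velocity out of its
  domain, so a velocity field cannot be carried to a nearby curve at its old cost. What varies in a
  Lipschitz way with the state is the epigraph of the Lagrangian: a change of H by e * (1 + norm p)
  moves a pair (velocity, cost bound) by at most e in each entry (\<open>conj_le_perturb\<close>).
  Filippov's iteration therefore runs on such pairs. The coefficient 2 (1 + R) c is a velocity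
  bound: linear growth in p gives every velocity of finite cost norm at most (1 + R) c, so two of
  them differ by at most twice that. B collects what Filippov's theorem charges per unit of velocity
  change: a displaced endpoint, paid through the Lipschitz constant of g, and a running cost raised
  in proportion to \<open>k\<^sub>R\<close>. On the exceptional set the saving is more than \<mu> t
  + H t x 0, hence strictly more than B times the velocity bound at every point; this is why
  comparing integrals yields a pointwise estimate. Since absolute continuity has its
  \<epsilon>-\<delta> form, the representation by the integral of the derivative is proved here
  too.\<close>

lemma borel_measurable_caratheodory:
  fixes f :: "'w \<Rightarrow> 'b::{metric_space, second_countable_topology} \<Rightarrow> 'c::metric_space"
  assumes f: "\<And>x. (\<lambda>w. f w x) \<in> borel_measurable M"
    and cont: "\<And>w. w \<in> space M \<Longrightarrow> continuous_on UNIV (f w)"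
    and y: "y \<in> borel_measurable M"
  shows "(\<lambda>w. f w (y w)) \<in> borel_measurable M"
proof -
  \<comment> \<open>Along a simple function the composition has finitely many branches, each
    measurable; continuity in the second argument carries measurability to the pointwise
    limit.\<close>
  obtain s where s: "\<And>i. simple_function M (s i)" "\<And>w. w \<in> space M \<Longrightarrow> (\<lambda>i. s i w) \<longlonglongrightarrow> y w"
    using borel_measurable_implies_sequence_metric[OF y] by blast
  show ?thesis
  proof (rule borel_measurable_LIMSEQ_metric)
    fix i
    show "(\<lambda>w. f w (s i w)) \<in> borel_measurable M"
    proof (rule measurable_compose_countable'[where I = "s i ` space M"])
      show "s i \<in> measurable M (count_space (s i ` space M))"
        using s(1)[of i] by (auto simp: measurable_count_space_eq2 simple_function_def)
      show "countable (s i ` space M)"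
        using s(1)[of i] by (auto simp: simple_function_def intro: countable_finite)
    qed (use f in auto)
  next
    fix w assume "w \<in> space M"
    then show "(\<lambda>i. f w (s i w)) \<longlonglongrightarrow> f w (y w)"
      using s(2) cont by (intro continuous_on_tendsto_compose[of UNIV "f w"]) auto
  qed
qed

text \<open>A selection theorem of Kuratowski and Ryll-Nardzewski type for the closed solution sets
  of countably many inequalities. Compactness of closed balls reduces proximity to the solution set
  to countably many conditions on a dense sequence. A Cauchy sequence of dense points is chosen by
  least index, with the bound on the distance to the solution set halved each time, and its limit is
  the selection.\<close>

lemma measurable_selection:
  fixes \<Phi> :: "nat \<Rightarrow> 'w \<Rightarrow> 'a::euclidean_space \<Rightarrow> real"
  assumes meas: "\<And>j v. (\<lambda>w. \<Phi> j w v) \<in> borel_measurable M"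
    and cont: "\<And>j w. w \<in> space M \<Longrightarrow> continuous_on UNIV (\<Phi> j w)"
    and ne: "\<And>w. w \<in> space M \<Longrightarrow> \<exists>v. \<forall>j. \<Phi> j w v \<le> 0"
  obtains s where "s \<in> borel_measurable M" "\<And>w j. w \<in> space M \<Longrightarrow> \<Phi> j w (s w) \<le> 0"
proof -
  obtain D :: "'a set" where D: "countable D" "\<And>X. open X \<Longrightarrow> X \<noteq> {} \<Longrightarrow> \<exists>d\<in>D. d \<in> X"
    using countable_dense_setE by blast
  then have "D \<noteq> {}" by (metis UNIV_not_empty empty_iff open_UNIV)
  define d where "d = from_nat_into D"
  have near: "\<exists>i. dist v (d i) < r" if "r > 0" for v :: 'a and r
  proof -
    obtain q where "q \<in> D" "q \<in> ball v r" using D(2)[of "ball v r"] \<open>r > 0\<close> by auto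
    then show ?thesis using from_nat_into_surj[OF D(1)] unfolding d_def by (metis mem_ball)
  qed
  define hits where "hits w q r \<longleftrightarrow> (\<exists>v. dist q v \<le> r \<and> (\<forall>j. \<Phi> j w v \<le> 0))" for w q r
  \<comment> \<open>Each condition is relaxed by 1 / Suc m and only the constraints up to m are
    imposed, so that approximate solutions can be found among the dense points. Conversely, such
    approximate solutions stay in the ball of radius r + 1, and a convergent subsequence yields an
    exact solution.\<close>
  have hits_iff: "hits w q r \<longleftrightarrow>
      (\<forall>m. \<exists>i. dist q (d i) < r + 1 / Suc m \<and> (\<forall>j\<le>m. \<Phi> j w (d i) < 1 / Suc m))" (is "_ \<longleftrightarrow> ?R")
    if w: "w \<in> space M" for w q r
  proof
    assume "hits w q r"
    then obtain v where v: "dist q v \<le> r" "\<And>j. \<Phi> j w v \<le> 0" unfolding hits_def by blast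
    show ?R
    proof
      fix m
      have ev: "\<forall>\<^sub>F x in nhds v. \<Phi> j w x < 1 / Suc m" for j
      proof -
        have "(\<Phi> j w \<longlongrightarrow> \<Phi> j w v) (nhds v)"
          using cont[OF w, of j] by (auto simp: continuous_on_eq_continuous_at isCont_def tendsto_at_iff_tendsto_nhds)
        moreover have "\<Phi> j w v < 1 / Suc m" using v(2)[of j] by (smt (verit) divide_pos_pos of_nat_0_less_iff zero_less_Suc)
        ultimately show ?thesis by (rule order_tendstoD(2))
      qed
      have "\<forall>\<^sub>F x in nhds v. \<forall>j\<in>{..m}. \<Phi> j w x < 1 / Suc m"
        using ev by (intro eventually_ball_finite) auto
      then obtain e where e: "e > 0" "\<And>x. dist x v < e \<Longrightarrow> \<forall>j\<in>{..m}. \<Phi> j w x < 1 / Suc m"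
        unfolding eventually_nhds_metric by blast
      obtain i where i: "dist v (d i) < min e (1 / Suc m)" using near[of "min e (1 / Suc m)" v] e(1) by auto
      have "dist q (d i) < r + 1 / Suc m"
        using dist_triangle[of q "d i" v] v(1) i by linarith
      then show "\<exists>i. dist q (d i) < r + 1 / Suc m \<and> (\<forall>j\<le>m. \<Phi> j w (d i) < 1 / Suc m)"
        using e(2)[of "d i"] i by (auto simp: dist_commute)
    qed
  next
    assume ?R
    then obtain i where i: "\<And>m. dist q (d (i m)) < r + 1 / Suc m"
      "\<And>m j. j \<le> m \<Longrightarrow> \<Phi> j w (d (i m)) < 1 / Suc m" by metis
    have "dist q (d (i m)) < r + 1" for m
    proof -
      have "1 / real (Suc m) \<le> 1" by simp
      then show ?thesis using i(1)[of m] by linarith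
    qed
    then have "\<forall>m. d (i m) \<in> cball q (r + 1)" by (auto intro: less_imp_le)
    then obtain v \<sigma> where \<sigma>: "strict_mono \<sigma>" "((\<lambda>m. d (i m)) \<circ> \<sigma>) \<longlonglongrightarrow> v"
      using compact_cball[of q "r + 1"] unfolding compact_def by meson
    have lim0: "(\<lambda>m. 1 / real (Suc (\<sigma> m))) \<longlonglongrightarrow> 0"
      using LIMSEQ_subseq_LIMSEQ[OF LIMSEQ_inverse_real_of_nat \<sigma>(1)] by (simp add: o_def inverse_eq_divide)
    have "dist q v \<le> r + 0"
    proof (rule LIMSEQ_le)
      show "(\<lambda>m. dist q (d (i (\<sigma> m)))) \<longlonglongrightarrow> dist q v"
        using \<sigma>(2) by (intro tendsto_intros) (simp add: o_def)
      show "(\<lambda>m. r + 1 / real (Suc (\<sigma> m))) \<longlonglongrightarrow> r + 0" by (intro tendsto_intros lim0)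
      show "\<exists>N. \<forall>n\<ge>N. dist q (d (i (\<sigma> n))) \<le> r + 1 / real (Suc (\<sigma> n))" using i(1) less_imp_le by blast
    qed
    moreover have "\<Phi> j w v \<le> 0" for j
    proof (rule LIMSEQ_le[OF _ lim0])
      show "(\<lambda>m. \<Phi> j w (d (i (\<sigma> m)))) \<longlonglongrightarrow> \<Phi> j w v"
        using \<sigma>(2) cont[OF w, of j] by (intro continuous_on_tendsto_compose[of UNIV "\<Phi> j w"]) (auto simp: o_def)
      have "\<Phi> j w (d (i (\<sigma> n))) \<le> 1 / real (Suc (\<sigma> n))" if "n \<ge> j" for n
        using i(2)[of j "\<sigma> n"] seq_suble[OF \<sigma>(1), of n] that by force
      then show "\<exists>N. \<forall>n\<ge>N. \<Phi> j w (d (i (\<sigma> n))) \<le> 1 / real (Suc (\<sigma> n))" by blast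
    qed
    ultimately show "hits w q r" unfolding hits_def by auto
  qed
  have hits_meas [measurable]: "Measurable.pred M (\<lambda>w. hits w q r)" for q r
    using meas by (subst measurable_cong[OF hits_iff]) measurable
  \<comment> \<open>Some solution lies within (1/2)^n of the old centre and some dense point within
    (1/2)^Suc n of that solution, so a new centre exists at distance at most 2 * (1/2)^n. Taking the
    least index keeps the choice measurable.\<close>
  define step where "step n k w = (LEAST i. dist (d k) (d i) \<le> 2 * (1/2)^n \<and> hits w (d i) ((1/2)^Suc n))" for n k w
  define start where "start w = (LEAST i. hits w (d i) 1)" for w
  define \<nu> where "\<nu> = rec_nat start (\<lambda>n f w. step n (f w) w)"
  have \<nu>0: "\<nu> 0 = start" and \<nu>S: "\<nu> (Suc n) w = step n (\<nu> n w) w" for n w by (simp_all add: \<nu>_def)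
  have \<nu>_meas: "\<nu> n \<in> measurable M (count_space UNIV)" for n
  proof (induction n)
    case 0
    show ?case unfolding \<nu>0 start_def[abs_def] by measurable
  next
    case (Suc n)
    have "(\<lambda>w. step n (\<nu> n w) w) \<in> measurable M (count_space UNIV)"
    proof (rule measurable_compose_countable[OF _ Suc])
      show "(\<lambda>w. step n k w) \<in> measurable M (count_space UNIV)" for k
        unfolding step_def by measurable
    qed
    then show ?case by (simp add: \<nu>S[abs_def])
  qed
  have hit: "hits w (d (\<nu> n w)) ((1/2)^n)" if w: "w \<in> space M" for n w
  proof (induction n)
    case 0
    obtain v where v: "\<And>j. \<Phi> j w v \<le> 0" using ne[OF w] by blast
    obtain i where "dist v (d i) < 1" using near[of 1 v] by auto
    then have "hits w (d i) 1" unfolding hits_def using v by (auto intro!: exI[of _ v] simp: dist_commute)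
    then have "hits w (d (start w)) 1" unfolding start_def by (rule LeastI)
    then show ?case by (simp add: \<nu>0)
  next
    case (Suc n)
    then obtain v where v: "dist (d (\<nu> n w)) v \<le> (1/2)^n" "\<And>j. \<Phi> j w v \<le> 0" unfolding hits_def by blast
    obtain i where i: "dist v (d i) < (1/2)^Suc n" using near[of "(1/2)^Suc n" v] by auto
    have "hits w (d i) ((1/2)^Suc n)"
      unfolding hits_def using v(2) i by (auto intro!: exI[of _ v] simp: dist_commute)
    moreover have "(1/2::real)^Suc n \<le> (1/2)^n" by simp
    then have "dist (d (\<nu> n w)) (d i) \<le> 2 * (1/2)^n"
      using dist_triangle[of "d (\<nu> n w)" "d i" v] v(1) i by linarith
    ultimately have "hits w (d (step n (\<nu> n w) w)) ((1/2)^Suc n)"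
      unfolding step_def by (intro LeastI2_ex[where Q = "\<lambda>x. hits w (d x) ((1/2)^Suc n)"]) blast+
    then show ?case by (simp add: \<nu>S)
  qed
  have dist_step: "dist (d (\<nu> n w)) (d (\<nu> (Suc n) w)) \<le> 2 * (1/2)^n" if w: "w \<in> space M" for n w
  proof -
    obtain v where v: "dist (d (\<nu> n w)) v \<le> (1/2)^n" "\<And>j. \<Phi> j w v \<le> 0" using hit[OF w] unfolding hits_def by blast
    obtain i where i: "dist v (d i) < (1/2)^Suc n" using near[of "(1/2)^Suc n" v] by auto
    have "hits w (d i) ((1/2)^Suc n)"
      unfolding hits_def using v(2) i by (auto intro!: exI[of _ v] simp: dist_commute)
    moreover have "(1/2::real)^Suc n \<le> (1/2)^n" by simp
    then have "dist (d (\<nu> n w)) (d i) \<le> 2 * (1/2)^n"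
      using dist_triangle[of "d (\<nu> n w)" "d i" v] v(1) i by linarith
    ultimately show ?thesis
      unfolding \<nu>S step_def by (intro LeastI2_ex[where Q = "\<lambda>x. dist (d (\<nu> n w)) (d x) \<le> 2 * (1/2)^n"]) blast+
  qed
  have conv: "convergent (\<lambda>n. d (\<nu> n w))" if w: "w \<in> space M" for w
  proof -
    have "summable (\<lambda>n. d (\<nu> (Suc n) w) - d (\<nu> n w))"
    proof (rule summable_comparison_test')
      show "summable (\<lambda>n. 2 * (1/2::real)^n)" by (intro summable_mult summable_geometric) auto
      show "norm (d (\<nu> (Suc n) w) - d (\<nu> n w)) \<le> 2 * (1/2)^n" for n
        using dist_step[OF w, of n] by (simp add: dist_norm norm_minus_commute)
    qed
    then have "convergent (\<lambda>n. \<Sum>i<n. d (\<nu> (Suc i) w) - d (\<nu> i w))"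
      by (simp add: summable_iff_convergent)
    then have "convergent (\<lambda>n. d (\<nu> n w) - d (\<nu> 0 w))"
      using sum_lessThan_telescope[of "\<lambda>n. d (\<nu> n w)"] by simp
    then have "convergent (\<lambda>n. (d (\<nu> n w) - d (\<nu> 0 w)) + d (\<nu> 0 w))" by (intro convergent_add convergent_const)
    then show ?thesis by simp
  qed
  define s where "s w = lim (\<lambda>n. d (\<nu> n w))" for w
  have s: "(\<lambda>n. d (\<nu> n w)) \<longlonglongrightarrow> s w" if "w \<in> space M" for w
    using conv[OF that] by (simp add: s_def convergent_LIMSEQ_iff)
  show ?thesis
  proof
    show "s \<in> borel_measurable M"
    proof (rule borel_measurable_LIMSEQ_metric)
      show "(\<lambda>w. d (\<nu> n w)) \<in> borel_measurable M" for n
        by (rule measurable_compose[OF \<nu>_meas]) simp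
    qed (rule s)
    fix w j assume w: "w \<in> space M"
    have "\<forall>n. \<exists>v. dist (d (\<nu> n w)) v \<le> (1/2)^n \<and> \<Phi> j w v \<le> 0" using hit[OF w] unfolding hits_def by blast
    then obtain u where u: "\<And>n. dist (d (\<nu> n w)) (u n) \<le> (1/2)^n" "\<And>n. \<Phi> j w (u n) \<le> 0" by metis
    have "(\<lambda>n. u n - d (\<nu> n w)) \<longlonglongrightarrow> 0"
    proof (rule Lim_null_comparison)
      show "\<forall>\<^sub>F n in sequentially. norm (u n - d (\<nu> n w)) \<le> (1/2)^n"
        using u(1) by (auto simp: dist_norm norm_minus_commute)
      show "(\<lambda>n. (1/2::real)^n) \<longlonglongrightarrow> 0" by (intro LIMSEQ_power_zero) auto
    qed
    from tendsto_add[OF this s[OF w]] have "u \<longlonglongrightarrow> s w" by simp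
    then have "(\<lambda>n. \<Phi> j w (u n)) \<longlonglongrightarrow> \<Phi> j w (s w)"
      using cont[OF w, of j] by (intro continuous_on_tendsto_compose[of UNIV "\<Phi> j w"]) auto
    then show "\<Phi> j w (s w) \<le> 0" by (rule LIMSEQ_le_const2) (use u(2) in auto)
  qed
qed

text \<open>A hyperplane separating the hypograph of \<psi> from the epigraph of \<phi> is the graph
  of the affine function. Subgradients (\<open>conj_le_subgradient\<close>) and nearby admissible
  velocities (\<open>conj_le_perturb\<close>) both arise as its slope.\<close>

lemma convex_sandwich:
  fixes \<phi> \<psi> :: "'a::euclidean_space \<Rightarrow> real"
  assumes \<phi>: "convex_on UNIV \<phi>" and \<psi>: "convex_on UNIV (\<lambda>p. - \<psi> p)" and le: "\<And>p. \<psi> p \<le> \<phi> p"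
  obtains v \<alpha> where "\<And>p. \<psi> p \<le> inner v p + \<alpha>" "\<And>p. inner v p + \<alpha> \<le> \<phi> p"
proof -
  \<comment> \<open>The hypograph is taken strict so that the two sets are disjoint even where
    \<psi> and \<phi> agree; the boundary is recovered in \<open>S''\<close>.\<close>
  let ?S = "{(p, r). r < \<psi> p}" and ?T = "{(p, r). \<phi> p \<le> r}"
  have S: "convex ?S"
  proof (rule convexI)
    fix x y and u w :: real assume "x \<in> ?S" "y \<in> ?S" "0 \<le> u" "0 \<le> w" "u + w = 1"
    then obtain p r q s where [simp]: "x = (p, r)" "y = (q, s)" and *: "r < \<psi> p" "s < \<psi> q" by auto
    have "- \<psi> (u *\<^sub>R p + w *\<^sub>R q) \<le> u * - \<psi> p + w * - \<psi> q"
      using \<psi> \<open>0 \<le> u\<close> \<open>0 \<le> w\<close> \<open>u + w = 1\<close> unfolding convex_on_def by blast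
    moreover have "u * r + w * s < u * \<psi> p + w * \<psi> q"
    proof (cases "u = 0")
      case False
      then have "u * r < u * \<psi> p" using * \<open>0 \<le> u\<close> by simp
      moreover have "w * s \<le> w * \<psi> q" using * \<open>0 \<le> w\<close> by (simp add: mult_left_mono)
      ultimately show ?thesis by linarith
    qed (use * \<open>u + w = 1\<close> in auto)
    ultimately show "u *\<^sub>R x + w *\<^sub>R y \<in> ?S" by auto
  qed
  have T: "convex ?T"
  proof (rule convexI)
    fix x y and u w :: real assume "x \<in> ?T" "y \<in> ?T" "0 \<le> u" "0 \<le> w" "u + w = 1"
    then obtain p r q s where [simp]: "x = (p, r)" "y = (q, s)" and *: "\<phi> p \<le> r" "\<phi> q \<le> s" by auto
    have "\<phi> (u *\<^sub>R p + w *\<^sub>R q) \<le> u * \<phi> p + w * \<phi> q"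
      using \<phi> \<open>0 \<le> u\<close> \<open>0 \<le> w\<close> \<open>u + w = 1\<close> unfolding convex_on_def by blast
    also have "\<dots> \<le> u * r + w * s"
      using * \<open>0 \<le> u\<close> \<open>0 \<le> w\<close> by (intro add_mono mult_left_mono) auto
    finally show "u *\<^sub>R x + w *\<^sub>R y \<in> ?T" by auto
  qed
  have "(0, \<psi> 0 - 1) \<in> ?S" "(0, \<phi> 0) \<in> ?T" by auto
  then have "?S \<noteq> {}" "?T \<noteq> {}" by blast+
  moreover have "?S \<inter> ?T = {}" by (auto simp: disjoint_iff not_le intro: less_le_trans[OF _ le])
  ultimately obtain a b where ab: "a \<noteq> 0" "\<And>x. x \<in> ?S \<Longrightarrow> inner a x \<le> b" "\<And>x. x \<in> ?T \<Longrightarrow> b \<le> inner a x"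
    using separating_hyperplane_sets[OF S T] by metis
  obtain a1 a2 where a: "a = (a1, a2)" by fastforce
  have S': "inner a1 p + a2 * r \<le> b" if "r < \<psi> p" for p r using ab(2)[of "(p, r)"] that by (simp add: a)
  have T': "b \<le> inner a1 p + a2 * r" if "\<phi> p \<le> r" for p r using ab(3)[of "(p, r)"] that by (simp add: a)
  have S'': "inner a1 p + a2 * \<psi> p \<le> b" for p
  proof (rule ccontr)
    assume "\<not> ?thesis"
    then have pos: "0 < inner a1 p + a2 * \<psi> p - b" (is "0 < ?e") by simp
    define \<delta> where "\<delta> = ?e / (2 * (\<bar>a2\<bar> + 1))"
    have "\<delta> > 0" using pos by (simp add: \<delta>_def)
    have "inner a1 p + a2 * (\<psi> p - \<delta>) \<le> b" using S'[of "\<psi> p - \<delta>" p] \<open>\<delta> > 0\<close> by simp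
    moreover have "a2 * \<delta> \<le> (\<bar>a2\<bar> + 1) * \<delta>" using \<open>\<delta> > 0\<close> by (intro mult_right_mono) auto
    moreover have "(\<bar>a2\<bar> + 1) * \<delta> = ?e / 2" by (simp add: \<delta>_def field_simps)
    ultimately show False using pos by (simp add: algebra_simps)
  qed
  have "a2 \<ge> 0"
  proof (rule ccontr)
    assume "\<not> a2 \<ge> 0"
    then have "a2 * (\<phi> 0 - (\<psi> 0 - 1)) < 0" using le[of 0] by (intro mult_neg_pos) auto
    then show False using S'[of "\<psi> 0 - 1" 0] T'[of 0 "\<phi> 0"] by (simp add: algebra_simps)
  qed
  \<comment> \<open>A vertical hyperplane is impossible because both functions are finite
    everywhere: the linear form given by \<open>a1\<close> would be constant, hence zero.\<close>
  moreover have "a2 \<noteq> 0"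
  proof
    assume "a2 = 0"
    then have "inner a1 p = b" for p using S''[of p] T'[of p "\<phi> p"] by simp
    then have "inner a1 a1 = inner a1 0" by metis
    then show False using ab(1) \<open>a2 = 0\<close> by (simp add: a zero_prod_def)
  qed
  ultimately have a2: "a2 > 0" by simp
  show ?thesis
  proof (rule that[of "- a1 /\<^sub>R a2" "b / a2"])
    show "\<psi> p \<le> inner (- a1 /\<^sub>R a2) p + b / a2" for p using S''[of p] a2 by (simp add: field_simps)
    show "inner (- a1 /\<^sub>R a2) p + b / a2 \<le> \<phi> p" for p using T'[of p "\<phi> p"] a2 by (simp add: field_simps)
  qed
qed

section \<open>Absolutely continuous functions\<close>

definition nonoverlapping :: "'i set \<Rightarrow> ('i \<Rightarrow> real) \<Rightarrow> ('i \<Rightarrow> real) \<Rightarrow> real \<Rightarrow> real \<Rightarrow> bool" where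
  "nonoverlapping I s u a b \<longleftrightarrow> finite I \<and> (\<forall>i\<in>I. a \<le> s i \<and> s i \<le> u i \<and> u i \<le> b) \<and>
     (\<forall>i\<in>I. \<forall>j\<in>I. i \<noteq> j \<longrightarrow> u i \<le> s j \<or> u j \<le> s i)"

lemma nonoverlapping_reindex:
  assumes "nonoverlapping I s u a b" "bij_betw h J I" "finite J"
  shows "nonoverlapping J (s \<circ> h) (u \<circ> h) a b"
proof -
  have "h i \<in> I" if "i \<in> J" for i using assms(2) that by (auto simp: bij_betw_def)
  moreover have "h i \<noteq> h j" if "i \<in> J" "j \<in> J" "i \<noteq> j" for i j
    using assms(2) that by (auto simp: bij_betw_def inj_on_def)
  ultimately show ?thesis using assms(1,3) unfolding nonoverlapping_def by simp
qed

lemma abs_continuous_on_nonoverlapping: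
  fixes x :: "real \<Rightarrow> 'a::real_normed_vector"
  assumes ac: "abs_continuous_on a b x" and "\<epsilon> > 0"
  shows "\<exists>\<delta>>0. \<forall>(I::'i set) s u. nonoverlapping I s u a b \<longrightarrow> (\<Sum>i\<in>I. u i - s i) < \<delta> \<longrightarrow>
       (\<Sum>i\<in>I. norm (x (u i) - x (s i))) < \<epsilon>"
proof -
  obtain \<delta> where "\<delta> > 0" and \<delta>: "\<forall>(n::nat) (s::nat \<Rightarrow> real) (u::nat \<Rightarrow> real).
        (\<forall>i<n. a \<le> s i \<and> s i \<le> u i \<and> u i \<le> b) \<and>
        (\<forall>i<n. \<forall>j<n. i \<noteq> j \<longrightarrow> u i \<le> s j \<or> u j \<le> s i) \<and>
        (\<Sum>i<n. u i - s i) < \<delta>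
        \<longrightarrow> (\<Sum>i<n. norm (x (u i) - x (s i))) < \<epsilon>"
    using ac[unfolded abs_continuous_on_def, rule_format, OF \<open>\<epsilon> > 0\<close>] by blast
  show ?thesis
  proof (intro exI[of _ \<delta>] conjI allI impI \<open>\<delta> > 0\<close>)
    fix I :: "'i set" and s u
    assume no: "nonoverlapping I s u a b" and len: "(\<Sum>i\<in>I. u i - s i) < \<delta>"
    then have "finite I" by (simp add: nonoverlapping_def)
    then obtain h where h: "bij_betw h {..<card I} I"
      using ex_bij_betw_nat_finite[of I] by (auto simp: lessThan_atLeast0)
    have "nonoverlapping {..<card I} (s \<circ> h) (u \<circ> h) a b"
      by (rule nonoverlapping_reindex[OF no h]) simp
    moreover have "(\<Sum>i<card I. (u \<circ> h) i - (s \<circ> h) i) < \<delta>"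
      using len sum.reindex_bij_betw[OF h, of "\<lambda>i. u i - s i"] by simp
    ultimately have "(\<Sum>i<card I. norm (x ((u \<circ> h) i) - x ((s \<circ> h) i))) < \<epsilon>"
      by (intro \<delta>[rule_format] conjI) (auto simp: nonoverlapping_def)
    then show "(\<Sum>i\<in>I. norm (x (u i) - x (s i))) < \<epsilon>"
      using sum.reindex_bij_betw[OF h, of "\<lambda>i. norm (x (u i) - x (s i))"] by simp
  qed
qed

text \<open>Without its rightmost interval the family lies to the left of that interval, so
  induction and monotonicity apply. Degenerate intervals are dropped beforehand: that all other
  intervals end before the largest left endpoint relies on the interval there having positive
  length.\<close>

lemma nonoverlapping_sum_le:
  fixes F :: "real \<Rightarrow> real"
  assumes "nonoverlapping I s u a b" "a \<le> b" "mono_on {a..b} F"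
  shows "(\<Sum>i\<in>I. F (u i) - F (s i)) \<le> F b - F a"
  using assms
proof (induction "card I" arbitrary: I b)
  case 0
  then have "I = {}" by (auto simp: nonoverlapping_def)
  then show ?case using 0 by (auto simp: mono_on_def)
next
  case (Suc n)
  have fin: "finite I" and I: "\<And>i. i \<in> I \<Longrightarrow> a \<le> s i \<and> s i \<le> u i \<and> u i \<le> b"
    and dis: "\<And>i j. i \<in> I \<Longrightarrow> j \<in> I \<Longrightarrow> i \<noteq> j \<Longrightarrow> u i \<le> s j \<or> u j \<le> s i"
    using Suc.prems(1) by (auto simp: nonoverlapping_def)
  show ?case
  proof (cases "\<exists>i\<in>I. s i = u i")
    case True
    then obtain i where i: "i \<in> I" "s i = u i" by blast
    have "(\<Sum>j\<in>I - {i}. F (u j) - F (s j)) \<le> F b - F a"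
      using Suc.prems Suc.hyps(2) fin i by (intro Suc.hyps(1)) (auto simp: nonoverlapping_def)
    then show ?thesis using i by (simp add: sum.remove[OF fin i(1)])
  next
    case False
    have "I \<noteq> {}" using Suc.hyps(2) by auto
    then have "Max (s ` I) \<in> s ` I" using fin by (intro Max_in) auto
    then obtain i where i: "i \<in> I" "\<And>j. j \<in> I \<Longrightarrow> s j \<le> s i" using fin
      by (metis (no_types, lifting) Max_ge finite_imageI imageE imageI)
    have le: "u j \<le> s i" if "j \<in> I" "j \<noteq> i" for j
      using dis[OF i(1) that(1)] that i(2)[OF that(1)] I[OF i(1)] False i(1) by force
    have "(\<Sum>j\<in>I - {i}. F (u j) - F (s j)) \<le> F (s i) - F a"
    proof (rule Suc.hyps(1))
      show "n = card (I - {i})" using Suc.hyps(2) fin i(1) by simp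
      show "nonoverlapping (I - {i}) s u a (s i)"
        using fin I dis le by (auto simp: nonoverlapping_def)
      show "mono_on {a..s i} F"
        using Suc.prems(3) by (rule mono_on_subset) (use I[OF i(1)] in auto)
    qed (use I[OF i(1)] in auto)
    moreover have "F (u i) \<le> F b" using Suc.prems(2,3) I[OF i(1)] by (auto simp: mono_on_def)
    ultimately show ?thesis by (simp add: sum.remove[OF fin i(1)])
  qed
qed

text \<open>With \<pi> a minimum or maximum against a fixed point, this cuts a family at that point
  while keeping its index set: intervals on the far side collapse to points.\<close>

lemma nonoverlapping_clamp:
  assumes "nonoverlapping I s u a b" "\<And>x y. x \<le> y \<Longrightarrow> \<pi> x \<le> \<pi> y"
    "\<And>x. a \<le> x \<Longrightarrow> x \<le> b \<Longrightarrow> c \<le> \<pi> x \<and> \<pi> x \<le> d"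
  shows "nonoverlapping I (\<lambda>i. \<pi> (s i)) (\<lambda>i. \<pi> (u i)) c d"
proof -
  have I: "a \<le> s i \<and> s i \<le> u i \<and> u i \<le> b" if "i \<in> I" for i using assms(1) that by (simp add: nonoverlapping_def)
  have "c \<le> \<pi> (s i) \<and> \<pi> (s i) \<le> \<pi> (u i) \<and> \<pi> (u i) \<le> d" if "i \<in> I" for i
    using I[OF that] assms(2)[of "s i" "u i"] assms(3)[of "s i"] assms(3)[of "u i"] by auto
  moreover have "\<pi> (u i) \<le> \<pi> (s j) \<or> \<pi> (u j) \<le> \<pi> (s i)" if "i \<in> I" "j \<in> I" "i \<noteq> j" for i j
  proof -
    have "u i \<le> s j \<or> u j \<le> s i" using assms(1) that by (simp add: nonoverlapping_def)
    then show ?thesis using assms(2) by blast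
  qed
  ultimately show ?thesis using assms(1) by (simp add: nonoverlapping_def)
qed

section \<open>Total variation of absolutely continuous functions\<close>

definition variation :: "(real \<Rightarrow> 'a::real_normed_vector) \<Rightarrow> real \<Rightarrow> real \<Rightarrow> real" where
  "variation x a b = (SUP (I::nat set, s, u)\<in>{(I, s, u). nonoverlapping I s u a b}. \<Sum>i\<in>I. norm (x (u i) - x (s i)))"

lemma variation_least:
  assumes "\<And>(I::nat set) s u. nonoverlapping I s u a b \<Longrightarrow> (\<Sum>i\<in>I. norm (x (u i) - x (s i))) \<le> B"
  shows "variation x a b \<le> B"
  unfolding variation_def
proof (rule cSUP_least)
  have "({}, s, u) \<in> {(I::nat set, s, u). nonoverlapping I s u a b}" for s u by (simp add: nonoverlapping_def)
  then show "{(I::nat set, s, u). nonoverlapping I s u a b} \<noteq> {}" by blast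
qed (use assms in auto)

text \<open>The interval is covered by k steps of length \<eta> < \<delta>, where \<delta> belongs
  to the tolerance 1. Cutting a family at the end of each step, every step adds less than 1 to its
  sum.\<close>

lemma abs_continuous_bounded_variation:
  assumes ac: "abs_continuous_on a b x" and "a \<le> b"
  obtains B where "\<And>(I::nat set) s u. nonoverlapping I s u a b \<Longrightarrow> (\<Sum>i\<in>I. norm (x (u i) - x (s i))) \<le> B"
proof -
  obtain \<delta> where \<delta>: "\<delta> > 0"
    "\<forall>(I::nat set) s u. nonoverlapping I s u a b \<longrightarrow> (\<Sum>i\<in>I. u i - s i) < \<delta> \<longrightarrow>
       (\<Sum>i\<in>I. norm (x (u i) - x (s i))) < 1"
    using abs_continuous_on_nonoverlapping[OF ac zero_less_one] by blast
  define \<eta> where "\<eta> = \<delta> / 2"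
  have "\<eta> > 0" "\<eta> < \<delta>" using \<delta>(1) by (auto simp: \<eta>_def)
  have *: "(\<Sum>i\<in>I. norm (x (u i) - x (s i))) \<le> real k + 1"
    if "nonoverlapping I s u a (min b (a + k * \<eta>))" for k and I :: "nat set" and s u
    using that
  proof (induction k arbitrary: s u)
    case 0
    have "x (u i) - x (s i) = 0" if "i \<in> I" for i
    proof -
      have "a \<le> s i" "s i \<le> u i" "u i \<le> a" using 0 that \<open>a \<le> b\<close> by (auto simp: nonoverlapping_def)
      then have "u i = s i" by linarith
      then show ?thesis by simp
    qed
    then show ?case by simp
  next
    case (Suc k)
    define \<tau> where "\<tau> = min b (a + k * \<eta>)"
    have \<tau>: "a \<le> \<tau>" "\<tau> \<le> b" using \<open>a \<le> b\<close> \<open>\<eta> > 0\<close> by (auto simp: \<tau>_def)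
    define e where "e = min b (a + Suc k * \<eta>)"
    have e: "\<tau> \<le> e" "e \<le> b" "e - \<tau> \<le> \<eta>" using \<open>\<eta> > 0\<close> by (auto simp: \<tau>_def e_def algebra_simps)
    have no: "nonoverlapping I s u a e" using Suc.prems by (simp add: e_def)
    have lo: "nonoverlapping I (\<lambda>i. min (s i) \<tau>) (\<lambda>i. min (u i) \<tau>) a \<tau>"
      by (rule nonoverlapping_clamp[OF no]) (use \<tau> in auto)
    have hi: "nonoverlapping I (\<lambda>i. max (s i) \<tau>) (\<lambda>i. max (u i) \<tau>) \<tau> e"
      by (rule nonoverlapping_clamp[OF no]) (use e in auto)
    then have hi': "nonoverlapping I (\<lambda>i. max (s i) \<tau>) (\<lambda>i. max (u i) \<tau>) a b"
      using \<tau> e by (force simp: nonoverlapping_def)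
    have "(\<Sum>i\<in>I. norm (x (min (u i) \<tau>) - x (min (s i) \<tau>))) \<le> real k + 1"
      using Suc.IH lo by (simp add: \<tau>_def)
    moreover have "(\<Sum>i\<in>I. norm (x (max (u i) \<tau>) - x (max (s i) \<tau>))) < 1"
    proof (rule \<delta>(2)[rule_format, OF hi'])
      have "(\<Sum>i\<in>I. max (u i) \<tau> - max (s i) \<tau>) \<le> e - \<tau>"
        using nonoverlapping_sum_le[OF hi e(1), of "\<lambda>t. t"] by (simp add: mono_on_def)
      then show "(\<Sum>i\<in>I. max (u i) \<tau> - max (s i) \<tau>) < \<delta>" using e \<open>\<eta> < \<delta>\<close> by linarith
    qed
    moreover have "(\<Sum>i\<in>I. norm (x (u i) - x (s i))) \<le>
        (\<Sum>i\<in>I. norm (x (min (u i) \<tau>) - x (min (s i) \<tau>))) + (\<Sum>i\<in>I. norm (x (max (u i) \<tau>) - x (max (s i) \<tau>)))"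
      unfolding sum.distrib[symmetric]
    proof (rule sum_mono)
      fix i assume "i \<in> I"
      then have "s i \<le> u i" using no by (auto simp: nonoverlapping_def)
      then consider "u i \<le> \<tau>" | "\<tau> \<le> s i" | "s i \<le> \<tau>" "\<tau> \<le> u i" by linarith
      then show "norm (x (u i) - x (s i)) \<le> norm (x (min (u i) \<tau>) - x (min (s i) \<tau>)) + norm (x (max (u i) \<tau>) - x (max (s i) \<tau>))"
      proof cases
        case 3
        have "norm (x (u i) - x (s i)) \<le> norm (x \<tau> - x (s i)) + norm (x (u i) - x \<tau>)"
          using norm_triangle_ineq[of "x \<tau> - x (s i)" "x (u i) - x \<tau>"] by simp
        then show ?thesis using 3 by (simp add: min_def max_def)
      qed (use \<open>s i \<le> u i\<close> in \<open>auto simp: min_def max_def\<close>)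
    qed
    ultimately show ?case by simp
  qed
  obtain k :: nat where "b - a < k * \<eta>" using reals_Archimedean3[OF \<open>\<eta> > 0\<close>] by blast
  then have "min b (a + k * \<eta>) = b" by simp
  then show ?thesis using that[of "real k + 1"] *[of _ _ _ k] by simp
qed

lemma variation_upper:
  assumes ac: "abs_continuous_on a b x" and "a \<le> c" "d \<le> b"
    and no: "nonoverlapping (I::nat set) s u c d"
  shows "(\<Sum>i\<in>I. norm (x (u i) - x (s i))) \<le> variation x c d"
proof (cases "a \<le> b")
  case True
  obtain B where B: "\<And>(I::nat set) s u. nonoverlapping I s u a b \<Longrightarrow> (\<Sum>i\<in>I. norm (x (u i) - x (s i))) \<le> B"
    using abs_continuous_bounded_variation[OF ac True] by metis
  have "nonoverlapping I s u c d \<Longrightarrow> nonoverlapping I s u a b" for I :: "nat set" and s u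
    using assms(2,3) by (force simp: nonoverlapping_def)
  then have "bdd_above ((\<lambda>(I, s, u). \<Sum>i\<in>I. norm (x (u i) - x (s i))) ` {(I::nat set, s, u). nonoverlapping I s u c d})"
    using B by (intro bdd_aboveI[of _ B]) auto
  from cSUP_upper[OF _ this, of "(I, s, u)"] no show ?thesis
    by (simp add: variation_def)
next
  case False
  then have "I = {}" using no assms(2,3) by (force simp: nonoverlapping_def)
  have "({}, s, u) \<in> {(I::nat set, s, u). nonoverlapping I s u c d}" for s u by (simp add: nonoverlapping_def)
  moreover have "I = {}" if "nonoverlapping I s u c d" for I :: "nat set" and s u
    using that False assms(2,3) by (force simp: nonoverlapping_def)
  ultimately have "(\<lambda>(I, s, u). \<Sum>i\<in>I. norm (x (u i) - x (s i))) ` {(I::nat set, s, u). nonoverlapping I s u c d} = {0}"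
    by force
  then show ?thesis using \<open>I = {}\<close> by (simp add: variation_def)
qed

text \<open>Any family in [a, s] can be extended by the interval [s, t] under a fresh index. The
  inequality makes the variation function increasing and lets it dominate the increments of x, as
  the Jordan decomposition requires.\<close>

lemma variation_step:
  assumes ac: "abs_continuous_on a b x" and "a \<le> s" "s \<le> t" "t \<le> b"
  shows "norm (x t - x s) + variation x a s \<le> variation x a t"
proof -
  have "variation x a s \<le> variation x a t - norm (x t - x s)"
  proof (rule variation_least)
    fix I :: "nat set" and p q assume no: "nonoverlapping I p q a s"
    then have "finite I" by (simp add: nonoverlapping_def)
    then obtain i where i: "i \<notin> I" using ex_new_if_finite infinite_UNIV_nat by metis
    have "nonoverlapping (insert i I) (p(i := s)) (q(i := t)) a t"
      using no i assms(2,3) by (fastforce simp: nonoverlapping_def)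
    from variation_upper[OF ac _ _ this]
    have "(\<Sum>j\<in>insert i I. norm (x ((q(i := t)) j) - x ((p(i := s)) j))) \<le> variation x a t"
      using \<open>t \<le> b\<close> by simp
    moreover have "(\<Sum>j\<in>I. norm (x ((q(i := t)) j) - x ((p(i := s)) j))) = (\<Sum>j\<in>I. norm (x (q j) - x (p j)))"
      using i by (intro sum.cong) auto
    ultimately show "(\<Sum>j\<in>I. norm (x (q j) - x (p j))) \<le> variation x a t - norm (x t - x s)"
      using \<open>finite I\<close> i by simp
  qed
  then show ?thesis by simp
qed

lemma variation_split:
  assumes ac: "abs_continuous_on a b x" and "a \<le> s" "s \<le> t" "t \<le> b"
  shows "variation x a t \<le> variation x a s + variation x s t"
proof (rule variation_least)
  fix I :: "nat set" and p q assume no: "nonoverlapping I p q a t"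
  have "nonoverlapping I (\<lambda>i. min (p i) s) (\<lambda>i. min (q i) s) a s"
    by (rule nonoverlapping_clamp[OF no]) (use assms in auto)
  from variation_upper[OF ac _ _ this] assms
  have "(\<Sum>i\<in>I. norm (x (min (q i) s) - x (min (p i) s))) \<le> variation x a s" by simp
  moreover have "nonoverlapping I (\<lambda>i. max (p i) s) (\<lambda>i. max (q i) s) s t"
    by (rule nonoverlapping_clamp[OF no]) (use assms in auto)
  from variation_upper[OF ac _ _ this] assms
  have "(\<Sum>i\<in>I. norm (x (max (q i) s) - x (max (p i) s))) \<le> variation x s t" by simp
  moreover have "(\<Sum>i\<in>I. norm (x (q i) - x (p i))) \<le>
      (\<Sum>i\<in>I. norm (x (min (q i) s) - x (min (p i) s))) + (\<Sum>i\<in>I. norm (x (max (q i) s) - x (max (p i) s)))"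
    unfolding sum.distrib[symmetric]
  proof (rule sum_mono)
    fix i assume "i \<in> I"
    then have "p i \<le> q i" using no by (auto simp: nonoverlapping_def)
    then consider "q i \<le> s" | "s \<le> p i" | "p i \<le> s" "s \<le> q i" by linarith
    then show "norm (x (q i) - x (p i)) \<le> norm (x (min (q i) s) - x (min (p i) s)) + norm (x (max (q i) s) - x (max (p i) s))"
    proof cases
      case 3
      have "norm (x (q i) - x (p i)) \<le> norm (x s - x (p i)) + norm (x (q i) - x s)"
        using norm_triangle_ineq[of "x s - x (p i)" "x (q i) - x s"] by simp
      then show ?thesis using 3 by (simp add: min_def max_def)
    qed (use \<open>p i \<le> q i\<close> in \<open>auto simp: min_def max_def\<close>)
  qed
  ultimately show "(\<Sum>i\<in>I. norm (x (q i) - x (p i))) \<le> variation x a s + variation x s t" by linarith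
qed

text \<open>Each increment of the variation function is at most the variation over that interval,
  and the latter is nearly attained by a finite family inside it. Together these families form a
  single one of total length below \<delta>, to which absolute continuity of x applies.\<close>

lemma abs_continuous_on_variation:
  fixes x :: "real \<Rightarrow> 'a::real_normed_vector"
  assumes ac: "abs_continuous_on a b x"
  shows "abs_continuous_on a b (variation x a)"
  unfolding abs_continuous_on_def
proof (intro allI impI)
  fix \<epsilon> :: real assume "\<epsilon> > 0"
  obtain \<delta> where \<delta>: "\<delta> > 0"
    "\<forall>(I::(nat \<times> nat) set) s u. nonoverlapping I s u a b \<longrightarrow> (\<Sum>i\<in>I. u i - s i) < \<delta> \<longrightarrow>
       (\<Sum>i\<in>I. norm (x (u i) - x (s i))) < \<epsilon> / 2"
    using abs_continuous_on_nonoverlapping[OF ac half_gt_zero[OF \<open>\<epsilon> > 0\<close>]] by blast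
  show "\<exists>\<delta>>0. \<forall>(n::nat) s u. (\<forall>i<n. a \<le> s i \<and> s i \<le> u i \<and> u i \<le> b) \<and>
          (\<forall>i<n. \<forall>j<n. i \<noteq> j \<longrightarrow> u i \<le> s j \<or> u j \<le> s i) \<and> (\<Sum>i<n. u i - s i) < \<delta> \<longrightarrow>
          (\<Sum>i<n. norm (variation x a (u i) - variation x a (s i))) < \<epsilon>"
  proof (intro exI[of _ \<delta>] conjI allI impI \<delta>(1))
    fix n :: nat and s u :: "nat \<Rightarrow> real"
    assume "(\<forall>i<n. a \<le> s i \<and> s i \<le> u i \<and> u i \<le> b) \<and>
          (\<forall>i<n. \<forall>j<n. i \<noteq> j \<longrightarrow> u i \<le> s j \<or> u j \<le> s i) \<and> (\<Sum>i<n. u i - s i) < \<delta>"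
    then have su: "\<And>i. i < n \<Longrightarrow> a \<le> s i \<and> s i \<le> u i \<and> u i \<le> b"
      and dis: "\<And>i j. i < n \<Longrightarrow> j < n \<Longrightarrow> i \<noteq> j \<Longrightarrow> u i \<le> s j \<or> u j \<le> s i" and len: "(\<Sum>i<n. u i - s i) < \<delta>" by auto
    \<comment> \<open>The slack \<eta> per interval pays for suprema that may not be attained; it
      tends to zero afterwards with n fixed.\<close>
    have W: "(\<Sum>i<n. variation x (s i) (u i)) \<le> \<epsilon> / 2 + real n * \<eta>" if "\<eta> > 0" for \<eta>
    proof -
      have "\<exists>(I::nat set) p q. nonoverlapping I p q (s i) (u i) \<and> variation x (s i) (u i) - \<eta> < (\<Sum>k\<in>I. norm (x (q k) - x (p k)))" for i
      proof (rule ccontr)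
        assume no: "\<not> ?thesis"
        have "variation x (s i) (u i) \<le> variation x (s i) (u i) - \<eta>"
        proof (rule variation_least)
          fix I :: "nat set" and p q assume "nonoverlapping I p q (s i) (u i)"
          with no have "\<not> variation x (s i) (u i) - \<eta> < (\<Sum>k\<in>I. norm (x (q k) - x (p k)))" by blast
          then show "(\<Sum>k\<in>I. norm (x (q k) - x (p k))) \<le> variation x (s i) (u i) - \<eta>" by simp
        qed
        then show False using \<open>\<eta> > 0\<close> by simp
      qed
      then obtain I :: "nat \<Rightarrow> nat set" and p q where
        no: "\<And>i. nonoverlapping (I i) (p i) (q i) (s i) (u i)"
        and close: "\<And>i. variation x (s i) (u i) - \<eta> < (\<Sum>k\<in>I i. norm (x (q i k) - x (p i k)))"
        by metis
      have fin: "finite (I i)" for i using no by (simp add: nonoverlapping_def)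
      let ?J = "Sigma {..<n} I" and ?p = "\<lambda>(i, k). p i k" and ?q = "\<lambda>(i, k). q i k"
      have "nonoverlapping ?J ?p ?q a b"
        unfolding nonoverlapping_def
      proof (intro conjI ballI impI)
        fix ik jl assume *: "ik \<in> ?J" "jl \<in> ?J" "ik \<noteq> jl"
        obtain i k j l where [simp]: "ik = (i, k)" "jl = (j, l)" by fastforce
        show "?q ik \<le> ?p jl \<or> ?q jl \<le> ?p ik"
        proof (cases "i = j")
          case True
          then show ?thesis using * no[of i] by (auto simp: nonoverlapping_def)
        next
          case False
          then show ?thesis using * dis[of i j] no[of i] no[of j] by (force simp: nonoverlapping_def)
        qed
      qed (use fin no su in \<open>force simp: nonoverlapping_def\<close>)+
      moreover have "(\<Sum>ik\<in>?J. ?q ik - ?p ik) < \<delta>"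
      proof -
        have "(\<Sum>ik\<in>?J. ?q ik - ?p ik) = (\<Sum>i<n. \<Sum>k\<in>I i. q i k - p i k)"
          using fin by (subst sum.Sigma) (auto intro!: sum.cong)
        also have "\<dots> \<le> (\<Sum>i<n. u i - s i)"
          using su by (intro sum_mono nonoverlapping_sum_le[OF no, of _ "\<lambda>t. t"]) (auto simp: mono_on_def)
        finally show ?thesis using len by linarith
      qed
      ultimately have "(\<Sum>ik\<in>?J. norm (x (?q ik) - x (?p ik))) < \<epsilon> / 2" by (rule \<delta>(2)[rule_format])
      moreover have "(\<Sum>ik\<in>?J. norm (x (?q ik) - x (?p ik))) = (\<Sum>i<n. \<Sum>k\<in>I i. norm (x (q i k) - x (p i k)))"
        using fin by (subst sum.Sigma) (auto intro!: sum.cong)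
      moreover have "(\<Sum>i<n. variation x (s i) (u i)) \<le> (\<Sum>i<n. (\<Sum>k\<in>I i. norm (x (q i k) - x (p i k))) + \<eta>)"
        using close by (intro sum_mono) (smt (verit))
      ultimately show ?thesis by (simp add: sum.distrib)
    qed
    have "(\<Sum>i<n. variation x (s i) (u i)) \<le> \<epsilon> / 2"
    proof (rule field_le_epsilon)
      fix e :: real assume "e > 0"
      have "real n * (e / (real n + 1)) \<le> e" using \<open>e > 0\<close> by (simp add: field_simps)
      then show "(\<Sum>i<n. variation x (s i) (u i)) \<le> \<epsilon> / 2 + e" using W[of "e / (real n + 1)"] \<open>e > 0\<close> by simp
    qed
    moreover have "(\<Sum>i<n. norm (variation x a (u i) - variation x a (s i))) \<le> (\<Sum>i<n. variation x (s i) (u i))"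
    proof (rule sum_mono)
      fix i assume "i \<in> {..<n}"
      then have *: "a \<le> s i" "s i \<le> u i" "u i \<le> b" using su by auto
      have "0 \<le> variation x a (u i) - variation x a (s i)"
        using variation_step[OF ac *] norm_ge_zero[of "x (u i) - x (s i)"] by linarith
      then show "norm (variation x a (u i) - variation x a (s i)) \<le> variation x (s i) (u i)"
        using variation_split[OF ac *] by simp
    qed
    ultimately show "(\<Sum>i<n. norm (variation x a (u i) - variation x a (s i))) < \<epsilon>" using \<open>\<epsilon> > 0\<close> by linarith
  qed
qed

lemma abs_continuous_on_imp_continuous_on:
  fixes x :: "real \<Rightarrow> 'a::real_normed_vector"
  assumes "abs_continuous_on a b x"
  shows "continuous_on {a..b} x"
  unfolding continuous_on_iff
proof (intro ballI allI impI)
  fix t \<epsilon> :: real assume t: "t \<in> {a..b}" and "\<epsilon> > 0"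
  obtain \<delta> where \<delta>: "\<delta> > 0"
    "\<forall>(I::nat set) s u. nonoverlapping I s u a b \<longrightarrow> (\<Sum>i\<in>I. u i - s i) < \<delta> \<longrightarrow>
       (\<Sum>i\<in>I. norm (x (u i) - x (s i))) < \<epsilon>"
    using abs_continuous_on_nonoverlapping[OF assms \<open>\<epsilon> > 0\<close>] by blast
  have *: "norm (x u - x s) < \<epsilon>" if "a \<le> s" "s \<le> u" "u \<le> b" "u - s < \<delta>" for s u
    using \<delta>(2)[rule_format, of "{0}" "\<lambda>_. s" "\<lambda>_. u"] that by (simp add: nonoverlapping_def)
  show "\<exists>d>0. \<forall>t'\<in>{a..b}. dist t' t < d \<longrightarrow> dist (x t') (x t) < \<epsilon>"
  proof (intro exI[of _ \<delta>] conjI ballI impI \<delta>(1))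
    fix t' assume "t' \<in> {a..b}" "dist t' t < \<delta>"
    then show "dist (x t') (x t) < \<epsilon>"
      using *[of t t'] *[of t' t] t by (cases "t \<le> t'") (auto simp: dist_norm norm_minus_commute)
  qed
qed

lemma abs_continuous_on_bound:
  assumes f: "abs_continuous_on a b f" and g: "abs_continuous_on a b g"
    and le: "\<And>s t. a \<le> s \<Longrightarrow> s \<le> t \<Longrightarrow> t \<le> b \<Longrightarrow> norm (h t - h s) \<le> C * (norm (f t - f s) + norm (g t - g s))"
  shows "abs_continuous_on a b h"
  unfolding abs_continuous_on_def
proof (intro allI impI)
  fix \<epsilon> :: real assume "\<epsilon> > 0"
  \<comment> \<open>Dividing by \<bar>C\<bar> + 1 covers constants C that are zero or
    negative.\<close>
  define \<epsilon>' where "\<epsilon>' = \<epsilon> / (2 * (\<bar>C\<bar> + 1))"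
  have "\<epsilon>' > 0" using \<open>\<epsilon> > 0\<close> by (simp add: \<epsilon>'_def)
  obtain \<delta> where \<delta>: "\<delta> > 0"
    "\<forall>(I::nat set) s u. nonoverlapping I s u a b \<longrightarrow> (\<Sum>i\<in>I. u i - s i) < \<delta> \<longrightarrow>
       (\<Sum>i\<in>I. norm (f (u i) - f (s i))) < \<epsilon>'"
    using abs_continuous_on_nonoverlapping[OF f \<open>\<epsilon>' > 0\<close>] by blast
  obtain \<delta>' where \<delta>': "\<delta>' > 0"
    "\<forall>(I::nat set) s u. nonoverlapping I s u a b \<longrightarrow> (\<Sum>i\<in>I. u i - s i) < \<delta>' \<longrightarrow>
       (\<Sum>i\<in>I. norm (g (u i) - g (s i))) < \<epsilon>'"
    using abs_continuous_on_nonoverlapping[OF g \<open>\<epsilon>' > 0\<close>] by blast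
  show "\<exists>\<delta>>0. \<forall>(n::nat) s u. (\<forall>i<n. a \<le> s i \<and> s i \<le> u i \<and> u i \<le> b) \<and>
          (\<forall>i<n. \<forall>j<n. i \<noteq> j \<longrightarrow> u i \<le> s j \<or> u j \<le> s i) \<and> (\<Sum>i<n. u i - s i) < \<delta> \<longrightarrow>
          (\<Sum>i<n. norm (h (u i) - h (s i))) < \<epsilon>"
  proof (intro exI[of _ "min \<delta> \<delta>'"] conjI allI impI)
    fix n :: nat and s u :: "nat \<Rightarrow> real"
    assume *: "(\<forall>i<n. a \<le> s i \<and> s i \<le> u i \<and> u i \<le> b) \<and>
          (\<forall>i<n. \<forall>j<n. i \<noteq> j \<longrightarrow> u i \<le> s j \<or> u j \<le> s i) \<and> (\<Sum>i<n. u i - s i) < min \<delta> \<delta>'"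
    then have no: "nonoverlapping {..<n} s u a b" by (simp add: nonoverlapping_def)
    have F: "(\<Sum>i<n. norm (f (u i) - f (s i))) < \<epsilon>'" by (rule \<delta>(2)[rule_format, OF no]) (use * in auto)
    have G: "(\<Sum>i<n. norm (g (u i) - g (s i))) < \<epsilon>'" by (rule \<delta>'(2)[rule_format, OF no]) (use * in auto)
    have "(\<Sum>i<n. norm (h (u i) - h (s i))) \<le> (\<Sum>i<n. (\<bar>C\<bar> + 1) * (norm (f (u i) - f (s i)) + norm (g (u i) - g (s i))))"
    proof (rule sum_mono)
      fix i assume "i \<in> {..<n}"
      then have "norm (h (u i) - h (s i)) \<le> C * (norm (f (u i) - f (s i)) + norm (g (u i) - g (s i)))"
        using * by (intro le) auto
      also have "\<dots> \<le> (\<bar>C\<bar> + 1) * (norm (f (u i) - f (s i)) + norm (g (u i) - g (s i)))"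
        by (intro mult_right_mono) auto
      finally show "norm (h (u i) - h (s i)) \<le> (\<bar>C\<bar> + 1) * (norm (f (u i) - f (s i)) + norm (g (u i) - g (s i)))" .
    qed
    also have "\<dots> = (\<bar>C\<bar> + 1) * ((\<Sum>i<n. norm (f (u i) - f (s i))) + (\<Sum>i<n. norm (g (u i) - g (s i))))"
      by (simp only: sum_distrib_left[symmetric] sum.distrib)
    also have "\<dots> < (\<bar>C\<bar> + 1) * (\<epsilon>' + \<epsilon>')"
      using F G by (intro mult_strict_left_mono add_strict_mono) auto
    also have "\<dots> = (2 * (\<bar>C\<bar> + 1)) * \<epsilon>'" by (simp add: algebra_simps)
    also have "\<dots> = \<epsilon>"
      unfolding \<epsilon>'_def times_divide_eq_right
      by (rule nonzero_mult_div_cancel_left) (use abs_ge_zero[of C] in auto)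
    finally show "(\<Sum>i<n. norm (h (u i) - h (s i))) < \<epsilon>" .
  qed (use \<delta> \<delta>' in auto)
qed

section \<open>Indefinite integrals and their derivatives\<close>

lemma integral_diff_subinterval:
  fixes v :: "real \<Rightarrow> 'a::euclidean_space"
  assumes "v integrable_on {a..b}" "a \<le> s" "s \<le> t" "t \<le> b"
  shows "integral {a..t} v - integral {a..s} v = integral {s..t} v"
proof -
  have "v integrable_on {a..t}" by (rule integrable_on_subinterval[OF assms(1)]) (use assms in auto)
  from Henstock_Kurzweil_Integration.integral_combine[OF assms(2,3) this] show ?thesis by (simp add: algebra_simps)
qed

text \<open>Truncation at height n: norm v is at most n plus the excess \<open>q n\<close>, whose
  integral tends to zero by dominated convergence. The bounded part contributes n times the total
  length, and the excess at most its integral over [a, b].\<close>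

lemma abs_continuous_on_integral:
  fixes v :: "real \<Rightarrow> 'a::euclidean_space"
  assumes v: "v absolutely_integrable_on {a..b}"
  shows "abs_continuous_on a b (\<lambda>t. x0 + integral {a..t} v)"
  unfolding abs_continuous_on_def
proof (intro allI impI)
  fix \<epsilon> :: real assume "\<epsilon> > 0"
  define q where "q n t = max 0 (norm (v t) - real n)" for n t
  have vi: "v integrable_on {a..b}" "(\<lambda>t. norm (v t)) integrable_on {a..b}"
    using v by (auto simp: absolutely_integrable_on_def)
  have qi: "q n integrable_on {a..b}" for n
  proof (rule measurable_bounded_by_integrable_imp_integrable[OF _ vi(2)])
    have [measurable]: "v \<in> borel_measurable (lebesgue_on {a..b})"
      using v by (intro absolutely_integrable_imp_borel_measurable) auto
    show "q n \<in> borel_measurable (lebesgue_on {a..b})" unfolding q_def by measurable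
  qed (auto simp: q_def)
  have "(\<lambda>n. integral {a..b} (q n)) \<longlonglongrightarrow> integral {a..b} (\<lambda>t. 0)"
  proof (rule dominated_convergence(2)[OF qi vi(2)])
    fix t
    obtain N :: nat where N: "norm (v t) \<le> N" using real_arch_simple by blast
    have "q n t = 0" if "n \<ge> N" for n
    proof -
      have "real N \<le> real n" using that by simp
      then show ?thesis using N by (simp add: q_def)
    qed
    then show "(\<lambda>n. q n t) \<longlonglongrightarrow> 0" by (intro tendsto_eventually) (auto simp: eventually_sequentially)
  qed (auto simp: q_def)
  then have "(\<lambda>n. integral {a..b} (q n)) \<longlonglongrightarrow> 0" by simp
  then have "\<forall>\<^sub>F n in sequentially. integral {a..b} (q n) < \<epsilon> / 2"
    using \<open>\<epsilon> > 0\<close> by (intro order_tendstoD) auto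
  then obtain n where n: "integral {a..b} (q n) < \<epsilon> / 2" by (auto simp: eventually_sequentially)
  define \<delta> where "\<delta> = \<epsilon> / (2 * (real n + 1))"
  have step: "norm (integral {a..t} v - integral {a..s} v) \<le> real n * (t - s) + (integral {a..t} (q n) - integral {a..s} (q n))"
    if "a \<le> s" "s \<le> t" "t \<le> b" for s t
  proof -
    have sub: "{s..t} \<subseteq> {a..b}" using that by auto
    have "norm (integral {s..t} v) \<le> integral {s..t} (\<lambda>\<tau>. real n + q n \<tau>)"
    proof (rule integral_norm_bound_integral)
      show "v integrable_on {s..t}" by (rule integrable_on_subinterval[OF vi(1) sub])
      show "(\<lambda>\<tau>. real n + q n \<tau>) integrable_on {s..t}"
        by (intro integrable_add integrable_on_subinterval[OF qi sub]) auto
    qed (auto simp: q_def)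
    also have "\<dots> = real n * (t - s) + integral {s..t} (q n)"
      using that by (subst Henstock_Kurzweil_Integration.integral_add) (auto intro!: integrable_on_subinterval[OF qi sub])
    finally show ?thesis using that by (simp add: integral_diff_subinterval[OF vi(1)] integral_diff_subinterval[OF qi])
  qed
  have mono: "mono_on {a..b} (\<lambda>t. integral {a..t} (q n))"
  proof (rule mono_onI)
    fix s t assume "s \<in> {a..b}" "t \<in> {a..b}" "s \<le> t"
    then have "integral {a..t} (q n) - integral {a..s} (q n) = integral {s..t} (q n)"
      by (intro integral_diff_subinterval[OF qi]) auto
    moreover have "0 \<le> integral {s..t} (q n)"
      by (rule integral_nonneg) (use \<open>s \<in> _\<close> \<open>t \<in> _\<close> in \<open>auto simp: q_def intro: integrable_on_subinterval[OF qi]\<close>)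
    ultimately show "integral {a..s} (q n) \<le> integral {a..t} (q n)" by linarith
  qed
  show "\<exists>\<delta>>0. \<forall>(n::nat) s u. (\<forall>i<n. a \<le> s i \<and> s i \<le> u i \<and> u i \<le> b) \<and>
          (\<forall>i<n. \<forall>j<n. i \<noteq> j \<longrightarrow> u i \<le> s j \<or> u j \<le> s i) \<and> (\<Sum>i<n. u i - s i) < \<delta> \<longrightarrow>
          (\<Sum>i<n. norm ((x0 + integral {a..u i} v) - (x0 + integral {a..s i} v))) < \<epsilon>"
  proof (intro exI[of _ \<delta>] conjI allI impI)
    show "\<delta> > 0" using \<open>\<epsilon> > 0\<close> by (simp add: \<delta>_def)
    fix m :: nat and s u :: "nat \<Rightarrow> real"
    assume *: "(\<forall>i<m. a \<le> s i \<and> s i \<le> u i \<and> u i \<le> b) \<and>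
          (\<forall>i<m. \<forall>j<m. i \<noteq> j \<longrightarrow> u i \<le> s j \<or> u j \<le> s i) \<and> (\<Sum>i<m. u i - s i) < \<delta>"
    then have no: "nonoverlapping {..<m} s u a b" by (simp add: nonoverlapping_def)
    show "(\<Sum>i<m. norm ((x0 + integral {a..u i} v) - (x0 + integral {a..s i} v))) < \<epsilon>"
    proof (cases "a \<le> b")
      case True
      have "(\<Sum>i<m. norm ((x0 + integral {a..u i} v) - (x0 + integral {a..s i} v)))
          \<le> (\<Sum>i<m. real n * (u i - s i) + (integral {a..u i} (q n) - integral {a..s i} (q n)))"
        using * step by (intro sum_mono) auto
      also have "\<dots> = real n * (\<Sum>i<m. u i - s i) + (\<Sum>i<m. integral {a..u i} (q n) - integral {a..s i} (q n))"
        by (simp add: sum.distrib sum_distrib_left)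
      also have "\<dots> \<le> real n * \<delta> + integral {a..b} (q n)"
        using nonoverlapping_sum_le[OF no True mono] * by (intro add_mono mult_left_mono) auto
      also have "real n * \<delta> \<le> \<epsilon> / 2" using \<open>\<epsilon> > 0\<close> by (simp add: \<delta>_def field_simps)
      finally show ?thesis using n by linarith
    next
      case False
      then have "m = 0" using * by fastforce
      then show ?thesis using \<open>\<epsilon> > 0\<close> by simp
    qed
  qed
qed

text \<open>Lebesgue differentiation enters through averages over [t, t + h]. Left-hand averages are
  obtained by applying it to the reflected function, whose exceptional set is reflected
  back.\<close>

lemma integral_has_vector_derivative_ae:
  fixes v :: "real \<Rightarrow> 'a::euclidean_space"
  assumes v: "v absolutely_integrable_on {a..b}"
  obtains N where "negligible N"
    "\<And>t. a < t \<Longrightarrow> t < b \<Longrightarrow> t \<notin> N \<Longrightarrow> ((\<lambda>t. x0 + integral {a..t} v) has_vector_derivative v t) (at t)"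
proof -
  \<comment> \<open>Extension by zero makes f integrable over every interval, so that averages
    reaching beyond [a, b] are defined.\<close>
  define f where "f t = (if t \<in> {a..b} then v t else 0)" for t
  have vi: "v integrable_on {a..b}" using v by (simp add: absolutely_integrable_on_def)
  then have "f integrable_on UNIV" unfolding f_def by (simp only: integrable_restrict_UNIV)
  then have fi: "f integrable_on cbox c d" for c d by (rule integrable_on_subcbox) auto
  have fi': "(\<lambda>t. f (- t)) integrable_on cbox c d" for c d
  proof -
    have "f integrable_on {-d..-c}" using fi[of "-d" "-c"] by simp
    then have "(\<lambda>x. f (- x)) integrable_on {- (- c)..- (- d)}" by (rule iffD2[OF Henstock_Kurzweil_Integration.integrable_reflect_real])
    then show ?thesis by simp
  qed
  obtain N1 where N1: "negligible N1"
    "\<And>x e. x \<notin> N1 \<Longrightarrow> 0 < e \<Longrightarrow> \<exists>d>0. \<forall>h. 0 < h \<and> h < d \<longrightarrow>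
       norm (integral (cbox x (x + h *\<^sub>R One)) f /\<^sub>R h ^ DIM(real) - f x) < e"
    using integrable_ccontinuous_explicit[OF fi] by blast
  obtain N2 where N2: "negligible N2"
    "\<And>x e. x \<notin> N2 \<Longrightarrow> 0 < e \<Longrightarrow> \<exists>d>0. \<forall>h. 0 < h \<and> h < d \<longrightarrow>
       norm (integral (cbox x (x + h *\<^sub>R One)) (\<lambda>t. f (- t)) /\<^sub>R h ^ DIM(real) - f (- x)) < e"
    using integrable_ccontinuous_explicit[OF fi'] by blast
  show ?thesis
  proof (rule that[of "N1 \<union> uminus ` N2"])
    have "negligible ((\<lambda>x. (-1) *\<^sub>R x) ` N2)"
      by (rule negligible_differentiable_image_negligible[OF order_refl N2(1)]) (auto intro!: derivative_intros)
    then show "negligible (N1 \<union> uminus ` N2)" using N1(1) by simp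
    fix t assume t: "a < t" "t < b" "t \<notin> N1 \<union> uminus ` N2"
    have ft: "f t = v t" using t by (simp add: f_def)
    show "((\<lambda>t. x0 + integral {a..t} v) has_vector_derivative v t) (at t)"
      unfolding has_vector_derivative_def has_derivative_at_alt
    proof (intro conjI allI impI)
      fix e :: real assume "e > 0"
      obtain d1 where d1: "d1 > 0" "\<And>h. 0 < h \<Longrightarrow> h < d1 \<Longrightarrow> norm (integral {t..t + h} f /\<^sub>R h - f t) < e"
        using N1(2)[of t e] t \<open>e > 0\<close> by auto
      have "- t \<notin> N2" using t(3) by (auto simp: image_iff)
      then obtain d2 where d2: "d2 > 0" "\<And>h. 0 < h \<Longrightarrow> h < d2 \<Longrightarrow> norm (integral {-t..-t + h} (\<lambda>t. f (- t)) /\<^sub>R h - f t) < e"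
        using N2(2)[of "-t" e] \<open>e > 0\<close> by auto
      define d where "d = Min {d1, d2, t - a, b - t}"
      have d: "d > 0" "d \<le> d1" "d \<le> d2" "d \<le> t - a" "d \<le> b - t" using d1(1) d2(1) t by (auto simp: d_def)
      have feq: "integral {p..q} f = integral {p..q} v" if "a \<le> p" "q \<le> b" for p q
        using that by (intro integral_cong) (auto simp: f_def)
      have key: "norm (w - h *\<^sub>R v t) \<le> e * h" if "norm (w /\<^sub>R h - f t) < e" "h > 0" for w :: 'a and h
      proof -
        have "w - h *\<^sub>R v t = h *\<^sub>R (w /\<^sub>R h - f t)" using \<open>h > 0\<close> by (simp add: ft scaleR_diff_right)
        then have "norm (w - h *\<^sub>R v t) = h * norm (w /\<^sub>R h - f t)" using \<open>h > 0\<close> by simp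
        also have "\<dots> \<le> h * e" using that by (intro mult_left_mono) auto
        finally show ?thesis by (simp add: mult.commute)
      qed
      show "\<exists>d>0. \<forall>y. norm (y - t) < d \<longrightarrow>
          norm (x0 + integral {a..y} v - (x0 + integral {a..t} v) - (y - t) *\<^sub>R v t) \<le> e * norm (y - t)"
      proof (intro exI[of _ d] conjI allI impI d(1))
        fix y assume y: "norm (y - t) < d"
        consider "y = t" | "y > t" | "y < t" by linarith
        then show "norm (x0 + integral {a..y} v - (x0 + integral {a..t} v) - (y - t) *\<^sub>R v t) \<le> e * norm (y - t)"
        proof cases
          case 2
          have "integral {a..y} v - integral {a..t} v = integral {t..t + (y - t)} f"
            using y d t 2 by (subst integral_diff_subinterval[OF vi]) (auto simp: feq)
          moreover have "norm (integral {t..t + (y - t)} f - (y - t) *\<^sub>R v t) \<le> e * (y - t)"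
            using y d 2 by (intro key d1) auto
          ultimately show ?thesis using 2 by simp
        next
          case 3
          have "integral {a..t} v - integral {a..y} v = integral {y..t} f"
            using y d t 3 by (subst integral_diff_subinterval[OF vi]) (auto simp: feq)
          also have "\<dots> = integral {-t..-t + (t - y)} (\<lambda>t. f (- t))"
            using Henstock_Kurzweil_Integration.integral_reflect_real[of t y f] by simp
          finally have "integral {a..t} v - integral {a..y} v = integral {-t..-t + (t - y)} (\<lambda>t. f (- t))" .
          moreover have "norm (integral {-t..-t + (t - y)} (\<lambda>t. f (- t)) - (t - y) *\<^sub>R v t) \<le> e * (t - y)"
            using y d 3 by (intro key d2) auto
          moreover have "x0 + integral {a..y} v - (x0 + integral {a..t} v) - (y - t) *\<^sub>R v t =
              - (integral {a..t} v - integral {a..y} v - (t - y) *\<^sub>R v t)" by (simp add: algebra_simps)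
          ultimately have "norm (x0 + integral {a..y} v - (x0 + integral {a..t} v) - (y - t) *\<^sub>R v t) \<le> e * (t - y)"
            by (simp only: norm_minus_cancel)
          moreover have "t - y = norm (y - t)" using 3 by simp
          ultimately show ?thesis by (simp only:)
        qed simp
      qed
    qed (rule bounded_linear_scaleR_left)
  qed
qed

section \<open>Absolutely continuous functions as integrals of their derivatives\<close>

lemma interval_measure_absolutely_continuous:
  fixes F :: "real \<Rightarrow> real"
  assumes mono: "\<And>s t. s \<le> t \<Longrightarrow> F s \<le> F t" and cont: "continuous_on UNIV F"
    and ac: "\<And>c d. abs_continuous_on c d F"
  shows "absolutely_continuous lborel (interval_measure F)"
unfolding absolutely_continuous_def
proof
  fix A :: "real set" assume A: "A \<in> null_sets lborel"
  let ?N = "interval_measure F"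
  have [measurable]: "A \<in> sets borel" using A by (simp add: null_sets_def)
  \<comment> \<open>A bounded null set is covered by countably many nonoverlapping closed intervals
    of total length below \<delta>. By absolute continuity every finite subfamily has Stieltjes
    measure at most \<epsilon>, and continuity from below extends this to the whole cover.\<close>
  have "emeasure ?N (A \<inter> {-c..c}) \<le> ennreal \<epsilon>" if "\<epsilon> > 0" "c > 0" for c \<epsilon> :: real
  proof -
    obtain \<delta> where \<delta>: "\<delta> > 0"
      "\<forall>(I::real set set) s u. nonoverlapping I s u (-c) c \<longrightarrow> (\<Sum>i\<in>I. u i - s i) < \<delta> \<longrightarrow>
         (\<Sum>i\<in>I. norm (F (u i) - F (s i))) < \<epsilon>"
      using abs_continuous_on_nonoverlapping[OF ac \<open>\<epsilon> > 0\<close>] by blast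
    have "negligible (A \<inter> {-c..c})"
    proof (rule negligible_subset)
      show "negligible A" using A by (simp add: negligible_iff_null_sets null_sets_completionI)
    qed auto
    then have meas0: "A \<inter> {-c..c} \<in> lmeasurable" "measure lebesgue (A \<inter> {-c..c}) = 0"
      by (simp_all add: negligible_iff_measure)
    obtain \<D> where \<D>: "countable \<D>"
        "\<And>K. K \<in> \<D> \<Longrightarrow> K \<subseteq> cbox (-c) c \<and> K \<noteq> {} \<and> (\<exists>p q. K = cbox p q)"
        "pairwise (\<lambda>A B. interior A \<inter> interior B = {}) \<D>"
        "\<And>K. \<lbrakk>K \<in> \<D>; box (-c) c \<noteq> {}\<rbrakk> \<Longrightarrow> interior K \<noteq> {}"
        "A \<inter> {-c..c} \<subseteq> \<Union>\<D>" "\<Union>\<D> \<in> lmeasurable" "measure lebesgue (\<Union>\<D>) \<le> measure lebesgue (A \<inter> {-c..c}) + \<delta> / 2"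
      by (rule measurable_outer_intervals_bounded[OF meas0(1), of "-c" c "\<delta> / 2"]) (use \<delta>(1) in auto)
    have K: "{Inf K..Sup K} = K \<and> Inf K < Sup K \<and> -c \<le> Inf K \<and> Sup K \<le> c" if KD: "K \<in> \<D>" for K
    proof -
      obtain p q where pq: "K = {p..q}" using \<D>(2)[OF KD] by auto
      have "interior K \<noteq> {}" using \<D>(4)[OF KD] \<open>c > 0\<close> by simp
      then have "p < q" by (simp add: pq)
      moreover have "{p..q} \<subseteq> {-c..c}" using \<D>(2)[OF KD] pq by simp
      ultimately show ?thesis by (simp add: pq)
    qed
    have meas [measurable]: "K \<in> sets borel" if "K \<in> \<D>" for K using \<D>(2)[OF that] by auto
    have fin: "emeasure ?N (\<Union>\<D>') \<le> ennreal \<epsilon>" if \<D>': "finite \<D>'" "\<D>' \<subseteq> \<D>" for \<D>'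
    proof -
      \<comment> \<open>The intervals serve as their own indices, with \<open>Inf\<close> and
        \<open>Sup\<close> as endpoint functions.\<close>
      have no: "nonoverlapping \<D>' Inf Sup (-c) c"
        unfolding nonoverlapping_def
      proof (intro conjI ballI impI)
        fix K L assume KL: "K \<in> \<D>'" "L \<in> \<D>'" "K \<noteq> L"
        show "Sup K \<le> Inf L \<or> Sup L \<le> Inf K"
        proof (rule ccontr)
          assume "\<not> ?thesis"
          moreover have "interior K \<inter> interior L = {}" using \<D>(3) KL \<D>'(2) by (auto simp: pairwise_def)
          then have "{Inf K<..<Sup K} \<inter> {Inf L<..<Sup L} = {}"
            using K[of K] K[of L] KL \<D>'(2) by (metis interior_atLeastAtMost_real subsetD)
          moreover have "Inf K < Sup K" "Inf L < Sup L" using K KL \<D>'(2) by blast+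
          ultimately show False by (auto simp: disjoint_iff)
        qed
      qed (use K \<D>' in \<open>auto intro: less_imp_le\<close>)
      have "(\<Sum>K\<in>\<D>'. Sup K - Inf K) = (\<Sum>K\<in>\<D>'. measure lebesgue K)"
      proof (rule sum.cong)
        fix K assume "K \<in> \<D>'"
        then have "{Inf K..Sup K} = K" "Inf K < Sup K" using K \<D>'(2) by blast+
        then show "Sup K - Inf K = measure lebesgue K"
          by (metis content_real less_imp_le measure_completion fmeasurableD lmeasurable_interval(1) sets_lborel borel_closed closed_atLeastAtMost)
      qed simp
      also have "\<dots> = measure lebesgue (\<Union>\<D>')"
      proof (rule measure_negligible_finite_Union[symmetric])
        show "pairwise (\<lambda>S T. negligible (S \<inter> T)) \<D>'"
        proof (rule pairwiseI)
          fix K L assume KL: "K \<in> \<D>'" "L \<in> \<D>'" "K \<noteq> L"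
          then have *: "{Inf K..Sup K} = K" "{Inf L..Sup L} = L" "Sup K \<le> Inf L \<or> Sup L \<le> Inf K"
            using K \<D>'(2) no by (blast, blast, simp add: nonoverlapping_def)
          then have "K \<inter> L \<subseteq> {Inf K, Inf L}" by (smt (verit, best) IntE atLeastAtMost_iff insertCI subsetI)
          then show "negligible (K \<inter> L)" by (rule negligible_subset[rotated]) (simp add: negligible_finite)
        qed
      qed (use \<D>' \<D>(2) in auto)
      also have "\<dots> \<le> measure lebesgue (\<Union>\<D>)"
      proof (rule measure_mono_fmeasurable)
        have "\<D>' \<subseteq> sets borel"
        proof
          fix K assume "K \<in> \<D>'"
          with \<D>'(2) have "K \<in> \<D>" by (rule subsetD)
          then show "K \<in> sets borel" by (rule meas)
        qed
        then have "\<Union>\<D>' \<in> sets borel" by (rule sets.finite_Union[OF \<D>'(1)])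
        then show "\<Union>\<D>' \<in> sets lebesgue" by simp
        show "\<Union>\<D>' \<subseteq> \<Union>\<D>" using \<D>'(2) by (rule Union_mono)
      qed (rule \<D>(6))
      also have "\<dots> < \<delta>" using \<D>(7) meas0(2) \<delta>(1) by linarith
      finally have lt: "(\<Sum>K\<in>\<D>'. norm (F (Sup K) - F (Inf K))) < \<epsilon>" by (rule \<delta>(2)[rule_format, OF no])
      have "emeasure ?N (\<Union>K\<in>\<D>'. K) \<le> (\<Sum>K\<in>\<D>'. emeasure ?N K)"
        using \<D>' meas by (intro emeasure_subadditive_finite) auto
      also have "\<dots> = (\<Sum>K\<in>\<D>'. ennreal (norm (F (Sup K) - F (Inf K))))"
      proof (rule sum.cong)
        fix K assume "K \<in> \<D>'"
        then have "K \<in> \<D>" using \<D>'(2) by blast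
        then have *: "{Inf K..Sup K} = K" "Inf K \<le> Sup K" using K[of K] by auto
        have "emeasure ?N {Inf K..Sup K} = F (Sup K) - F (Inf K)"
          by (rule emeasure_interval_measure_Icc) (use mono cont *(2) in auto)
        then show "emeasure ?N K = ennreal (norm (F (Sup K) - F (Inf K)))"
          using * mono[of "Inf K" "Sup K"] by simp
      qed simp
      also have "\<dots> = ennreal (\<Sum>K\<in>\<D>'. norm (F (Sup K) - F (Inf K)))" by (intro sum_ennreal) auto
      also have "\<dots> \<le> ennreal \<epsilon>" using lt by (intro ennreal_leI) simp
      finally show ?thesis by simp
    qed
    show ?thesis
    proof (cases "\<D> = {}")
      case True
      then show ?thesis using \<D>(5) by simp
    next
      case False
      define U where "U n = \<Union> (from_nat_into \<D> ` {..n})" for n :: nat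
      have sub: "from_nat_into \<D> ` {..n} \<subseteq> \<D>" for n using from_nat_into[OF False] by auto
      have "(\<Union>n. U n) = \<Union>\<D>"
      proof -
        have "\<Union>\<D> = \<Union> (range (from_nat_into \<D>))" using range_from_nat_into[OF False \<D>(1)] by simp
        then show ?thesis by (auto simp: U_def)
      qed
      have "emeasure ?N (\<Union>n. U n) = (SUP n. emeasure ?N (U n))"
      proof (rule SUP_emeasure_incseq[symmetric])
        show "range U \<subseteq> sets ?N" unfolding U_def using meas from_nat_into[OF False] by (auto intro!: sets.finite_UN)
        show "incseq U" by (force simp: U_def incseq_def)
      qed
      also have "\<dots> \<le> ennreal \<epsilon>" unfolding U_def by (intro SUP_least fin sub) auto
      finally have "emeasure ?N (\<Union>\<D>) \<le> ennreal \<epsilon>" by (simp only: \<open>(\<Union>n. U n) = \<Union>\<D>\<close>)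
      moreover have "\<Union>\<D> \<in> sets ?N" using \<D>(1) meas by (auto intro!: sets.countable_Union)
      ultimately show ?thesis using emeasure_mono[OF \<D>(5), of ?N] by (meson order_trans)
    qed
  qed
  then have zero: "emeasure ?N (A \<inter> {-c..c}) = 0" if "c > 0" for c
    using that by (metis ennreal_le_epsilon add.left_neutral le_zero_eq ennreal_0 zero_le)
  have "A = (\<Union>n. A \<inter> {- real (Suc n)..real (Suc n)})"
  proof (intro equalityI subsetI)
    fix x assume "x \<in> A"
    obtain n :: nat where "\<bar>x\<bar> \<le> n" using real_arch_simple by blast
    then have "x \<in> {- real (Suc n)..real (Suc n)}" by auto
    then show "x \<in> (\<Union>n. A \<inter> {- real (Suc n)..real (Suc n)})" using \<open>x \<in> A\<close> by blast
  qed auto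
  moreover have "(\<Union>n. A \<inter> {- real (Suc n)..real (Suc n)}) \<in> null_sets ?N"
  proof (rule null_sets_UN')
    show "A \<inter> {- real (Suc n)..real (Suc n)} \<in> null_sets ?N" for n
      using zero[of "real (Suc n)"] by (simp add: null_sets_def)
  qed simp
  ultimately show "A \<in> null_sets ?N" by simp
qed

text \<open>Constant extension beyond [a, b] produces a function on the whole line, from which a
  Stieltjes measure can be formed.\<close>

lemma abs_continuous_on_clamp:
  fixes F :: "real \<Rightarrow> 'a::real_normed_vector"
  assumes "abs_continuous_on a b F" "a \<le> b"
  shows "abs_continuous_on c d (\<lambda>t. F (max a (min b t)))"
  unfolding abs_continuous_on_def
proof (intro allI impI)
  fix \<epsilon> :: real assume "\<epsilon> > 0"
  obtain \<delta> where \<delta>: "\<delta> > 0"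
    "\<forall>(I::nat set) s u. nonoverlapping I s u a b \<longrightarrow> (\<Sum>i\<in>I. u i - s i) < \<delta> \<longrightarrow>
       (\<Sum>i\<in>I. norm (F (u i) - F (s i))) < \<epsilon>"
    using abs_continuous_on_nonoverlapping[OF assms(1) \<open>\<epsilon> > 0\<close>] by blast
  show "\<exists>\<delta>>0. \<forall>(n::nat) s u. (\<forall>i<n. c \<le> s i \<and> s i \<le> u i \<and> u i \<le> d) \<and>
          (\<forall>i<n. \<forall>j<n. i \<noteq> j \<longrightarrow> u i \<le> s j \<or> u j \<le> s i) \<and> (\<Sum>i<n. u i - s i) < \<delta> \<longrightarrow>
          (\<Sum>i<n. norm (F (max a (min b (u i))) - F (max a (min b (s i))))) < \<epsilon>"
  proof (intro exI[of _ \<delta>] conjI allI impI \<delta>(1))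
    fix n :: nat and s u :: "nat \<Rightarrow> real"
    assume *: "(\<forall>i<n. c \<le> s i \<and> s i \<le> u i \<and> u i \<le> d) \<and>
          (\<forall>i<n. \<forall>j<n. i \<noteq> j \<longrightarrow> u i \<le> s j \<or> u j \<le> s i) \<and> (\<Sum>i<n. u i - s i) < \<delta>"
    then have "nonoverlapping {..<n} s u c d" by (simp add: nonoverlapping_def)
    then have no: "nonoverlapping {..<n} (\<lambda>i. max a (min b (s i))) (\<lambda>i. max a (min b (u i))) a b"
      by (rule nonoverlapping_clamp) (use \<open>a \<le> b\<close> in auto)
    have "(\<Sum>i<n. max a (min b (u i)) - max a (min b (s i))) \<le> (\<Sum>i<n. u i - s i)"
    proof (rule sum_mono)
      fix i assume "i \<in> {..<n}"
      then have "s i \<le> u i" using * by auto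
      then show "max a (min b (u i)) - max a (min b (s i)) \<le> u i - s i" by (auto simp: max_def min_def)
    qed
    then show "(\<Sum>i<n. norm (F (max a (min b (u i))) - F (max a (min b (s i))))) < \<epsilon>"
      using * by (intro \<delta>(2)[rule_format, OF no]) linarith
  qed
qed

text \<open>The density is the Radon-Nikodym derivative of the Stieltjes measure of the extended F
  with respect to Lebesgue measure.\<close>

lemma mono_abs_continuous_density:
  fixes F :: "real \<Rightarrow> real"
  assumes mono: "mono_on {a..b} F" and ac: "abs_continuous_on a b F" and "a \<le> b"
  obtains h where "h absolutely_integrable_on {a..b}" "\<And>t. a \<le> t \<Longrightarrow> t \<le> b \<Longrightarrow> integral {a..t} h = F t - F a"
proof -
  define G where "G t = F (max a (min b t))" for t
  have Gmono: "G s \<le> G t" if "s \<le> t" for s t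
    unfolding G_def using that \<open>a \<le> b\<close> by (intro mono_onD[OF mono]) auto
  have Gcont: "continuous_on UNIV G"
    unfolding G_def
    by (rule continuous_on_compose2[OF abs_continuous_on_imp_continuous_on[OF ac]])
       (use \<open>a \<le> b\<close> in \<open>auto intro!: continuous_intros\<close>)
  let ?N = "interval_measure G"
  have "absolutely_continuous lborel ?N"
    using Gmono Gcont abs_continuous_on_clamp[OF ac \<open>a \<le> b\<close>]
    by (intro interval_measure_absolutely_continuous) (auto simp: G_def[abs_def])
  from sigma_finite_measure.Radon_Nikodym[OF sigma_finite_lborel this] obtain f where f: "f \<in> borel_measurable lborel" "density lborel f = ?N" by auto
  have [measurable]: "f \<in> borel_measurable borel" using f(1) by simp
  have nn: "(\<integral>\<^sup>+x. f x * indicator {a..t} x \<partial>lborel) = ennreal (F t - F a)" if "a \<le> t" "t \<le> b" for t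
  proof -
    have "(\<integral>\<^sup>+x. f x * indicator {a..t} x \<partial>lborel) = emeasure (density lborel f) {a..t}"
      by (subst emeasure_density) auto
    also have "\<dots> = ennreal (G t - G a)"
      unfolding f(2) by (rule emeasure_interval_measure_Icc) (use that Gmono Gcont in auto)
    finally show ?thesis using that by (simp add: G_def)
  qed
  \<comment> \<open>The Radon-Nikodym derivative is \<open>ennreal\<close>-valued. Its integral over
    [a, b] is finite, so this real version agrees with it almost everywhere there.\<close>
  define h where "h x = enn2real (f x)" for x
  have [measurable]: "h \<in> borel_measurable borel" unfolding h_def by measurable
  have "AE x in lborel. f x * indicator {a..b} x \<noteq> \<infinity>"
    by (rule nn_integral_noteq_infinite) (use nn[of b] \<open>a \<le> b\<close> in auto)
  then have ae: "AE x in lborel. x \<in> {a..b} \<longrightarrow> ennreal (h x) = f x"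
    by eventually_elim (auto simp: h_def indicator_def less_top[symmetric] split: if_splits)
  have nn': "(\<integral>\<^sup>+x\<in>{a..t}. ennreal (h x) \<partial>lborel) = ennreal (F t - F a)" if "a \<le> t" "t \<le> b" for t
    unfolding nn[OF that, symmetric]
    by (rule nn_integral_cong_AE) (use ae in eventually_elim, use that in \<open>auto simp: indicator_def\<close>)
  have "(\<lambda>x. if x \<in> {a..b} then h x else 0) integrable_on UNIV"
  proof (rule nn_integral_integrable_on)
    have "(\<integral>\<^sup>+x. ennreal (if x \<in> {a..b} then h x else 0) \<partial>lborel) = (\<integral>\<^sup>+x\<in>{a..b}. ennreal (h x) \<partial>lborel)"
      by (intro nn_integral_cong) (auto simp: indicator_def)
    then show "(\<integral>\<^sup>+x. ennreal (if x \<in> {a..b} then h x else 0) \<partial>lborel) < \<infinity>"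
      using nn'[of b] \<open>a \<le> b\<close> by simp
  qed (auto simp: h_def)
  then have "h integrable_on {a..b}" by (simp only: integrable_restrict_UNIV)
  then have abs: "h absolutely_integrable_on {a..b}"
    by (rule nonnegative_absolutely_integrable_1) (simp add: h_def)
  show ?thesis
  proof (rule that[OF abs])
    fix t assume t: "a \<le> t" "t \<le> b"
    have "(\<integral>\<^sup>+x\<in>{a..t}. ennreal (h x) \<partial>lborel) = ennreal (integral {a..t} h)"
    proof (rule set_nn_integral_lborel_eq_integral)
      show "set_borel_measurable borel {a..t} h" unfolding set_borel_measurable_def by measurable
      show "(\<integral>\<^sup>+x\<in>{a..t}. ennreal (h x) \<partial>lborel) < \<infinity>" using nn'[OF t] by simp
    qed (simp add: h_def)
    then have "ennreal (integral {a..t} h) = ennreal (F t - F a)" using nn'[OF t] by simp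
    moreover have "0 \<le> integral {a..t} h" 
    proof (rule integral_nonneg)
      show "h integrable_on {a..t}" by (rule integrable_on_subinterval[OF \<open>h integrable_on {a..b}\<close>]) (use t in auto)
    qed (simp add: h_def)
    moreover have "0 \<le> F t - F a" using mono t by (auto simp: mono_on_def)
    ultimately show "integral {a..t} h = F t - F a" by simp
  qed
qed

text \<open>Jordan decomposition of each component: with V the variation of x from a, both V and V +
  x \<bullet> i are increasing and absolutely continuous, hence have densities, and the difference
  of the densities represents x \<bullet> i.\<close>

lemma abs_continuous_on_eq_integral:
  fixes x :: "real \<Rightarrow> 'a::euclidean_space"
  assumes ac: "abs_continuous_on a b x" and "a \<le> b"
  obtains v where "v absolutely_integrable_on {a..b}" "\<And>t. a \<le> t \<Longrightarrow> t \<le> b \<Longrightarrow> x t = x a + integral {a..t} v"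
proof -
  let ?V = "variation x a"
  have Vac: "abs_continuous_on a b ?V" by (rule abs_continuous_on_variation[OF ac])
  have step: "norm (x t - x s) \<le> ?V t - ?V s" if "a \<le> s" "s \<le> t" "t \<le> b" for s t
    using variation_step[OF ac that] by simp
  have Vmono: "mono_on {a..b} ?V"
  proof (rule mono_onI)
    fix s t assume "s \<in> {a..b}" "t \<in> {a..b}" "s \<le> t"
    then have "norm (x t - x s) \<le> ?V t - ?V s" by (intro step) auto
    then show "?V s \<le> ?V t" using norm_ge_zero[of "x t - x s"] by linarith
  qed
  obtain h where h: "h absolutely_integrable_on {a..b}" "\<And>t. a \<le> t \<Longrightarrow> t \<le> b \<Longrightarrow> integral {a..t} h = ?V t - ?V a"
    by (rule mono_abs_continuous_density[OF Vmono Vac \<open>a \<le> b\<close>]) (rule that)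
  have "\<exists>g. g absolutely_integrable_on {a..b} \<and>
      (\<forall>t. a \<le> t \<longrightarrow> t \<le> b \<longrightarrow> integral {a..t} g = (?V t + x t \<bullet> i) - (?V a + x a \<bullet> i))" if i: "i \<in> Basis" for i
  proof -
    have comp: "\<bar>x t \<bullet> i - x s \<bullet> i\<bar> \<le> norm (x t - x s)" for s t
      using Basis_le_norm[OF i, of "x t - x s"] by (simp add: inner_diff_left)
    have "mono_on {a..b} (\<lambda>t. ?V t + x t \<bullet> i)"
    proof (rule mono_onI)
      fix s t assume "s \<in> {a..b}" "t \<in> {a..b}" "s \<le> t"
      then show "?V s + x s \<bullet> i \<le> ?V t + x t \<bullet> i" using step[of s t] comp[of t s] by auto
    qed
    moreover have "abs_continuous_on a b (\<lambda>t. ?V t + x t \<bullet> i)"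
    proof (rule abs_continuous_on_bound[OF Vac ac, where C = 1])
      fix s t
      show "norm (?V t + x t \<bullet> i - (?V s + x s \<bullet> i)) \<le> 1 * (norm (?V t - ?V s) + norm (x t - x s))"
        using comp[of t s] by simp
    qed
    ultimately obtain g where g: "g absolutely_integrable_on {a..b}"
        "\<And>t. a \<le> t \<Longrightarrow> t \<le> b \<Longrightarrow> integral {a..t} g = (?V t + x t \<bullet> i) - (?V a + x a \<bullet> i)"
      by (rule mono_abs_continuous_density[OF _ _ \<open>a \<le> b\<close>]) (rule that)
    show ?thesis
    proof (rule exI[of _ g], rule conjI)
      show "\<forall>t. a \<le> t \<longrightarrow> t \<le> b \<longrightarrow> integral {a..t} g = (?V t + x t \<bullet> i) - (?V a + x a \<bullet> i)"
        using g(2) by simp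
    qed (rule g(1))
  qed
  then have "\<forall>i\<in>Basis. \<exists>g. g absolutely_integrable_on {a..b} \<and>
      (\<forall>t. a \<le> t \<longrightarrow> t \<le> b \<longrightarrow> integral {a..t} g = (?V t + x t \<bullet> i) - (?V a + x a \<bullet> i))" by blast
  from bchoice[OF this] obtain g where g: "\<And>i. i \<in> Basis \<Longrightarrow> g i absolutely_integrable_on {a..b}"
    "\<And>i t. i \<in> Basis \<Longrightarrow> a \<le> t \<Longrightarrow> t \<le> b \<Longrightarrow> integral {a..t} (g i) = (?V t + x t \<bullet> i) - (?V a + x a \<bullet> i)"
    by blast
  define v where "v t = (\<Sum>i\<in>Basis. (g i t - h t) *\<^sub>R i)" for t
  have vi: "v absolutely_integrable_on {a..b}"
    unfolding v_def
    by (intro absolutely_integrable_sum finite_Basis absolutely_integrable_scaleR_right set_integral_diff(1) g(1) h(1))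
  show ?thesis
  proof (rule that[OF vi])
    fix t assume t: "a \<le> t" "t \<le> b"
    have sub: "f integrable_on {a..t}" if "f absolutely_integrable_on {a..b}" for f :: "real \<Rightarrow> 'b::euclidean_space"
      by (rule integrable_on_subinterval[of _ "{a..b}"]) (use that t in \<open>auto simp: absolutely_integrable_on_def\<close>)
    have "x t - x a = integral {a..t} v"
    proof (rule euclidean_eqI)
      fix i :: 'a assume i: "i \<in> Basis"
      have "integral {a..t} v \<bullet> i = integral {a..t} (\<lambda>t. v t \<bullet> i)"
        using sub[OF vi] by (rule integral_component_eq[symmetric])
      also have "(\<lambda>t. v t \<bullet> i) = (\<lambda>t. g i t - h t)"
        by (simp add: v_def i inner_sum_left inner_Basis if_distrib cong: if_cong)
      also have "integral {a..t} (\<lambda>t. g i t - h t) = integral {a..t} (g i) - integral {a..t} h"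
        by (intro Henstock_Kurzweil_Integration.integral_diff sub g(1) h(1) i)
      also have "\<dots> = (x t - x a) \<bullet> i" using g(2)[OF i t] h(2)[OF t] by (simp add: inner_diff_left)
      finally show "(x t - x a) \<bullet> i = integral {a..t} v \<bullet> i" by simp
    qed
    then show "x t = x a + integral {a..t} v" by (simp add: algebra_simps)
  qed
qed

text \<open>This links \<open>Theta\<close>, which reads the velocity through
  \<open>vector_derivative\<close>, to curves built by integration. The endpoints join the null set
  because the derivative is two-sided.\<close>

lemma vector_derivative_integral_ae:
  fixes v :: "real \<Rightarrow> 'a::euclidean_space"
  assumes v: "v absolutely_integrable_on {a..b}"
    and x: "\<And>t. a \<le> t \<Longrightarrow> t \<le> b \<Longrightarrow> x t = x0 + integral {a..t} v"
  obtains N where "negligible N" "\<And>t. t \<in> {a..b} - N \<Longrightarrow> (x has_vector_derivative v t) (at t)"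
    "\<And>t. t \<in> {a..b} - N \<Longrightarrow> vector_derivative x (at t) = v t"
proof -
  obtain N where N: "negligible N"
    "\<And>t. a < t \<Longrightarrow> t < b \<Longrightarrow> t \<notin> N \<Longrightarrow> ((\<lambda>t. x0 + integral {a..t} v) has_vector_derivative v t) (at t)"
    using integral_has_vector_derivative_ae[OF v] by blast
  have "(x has_vector_derivative v t) (at t)" if "t \<in> {a..b} - (N \<union> {a, b})" for t
  proof -
    have t: "a < t" "t < b" "t \<notin> N" using that by auto
    show ?thesis
      by (rule has_vector_derivative_transform_within_open[OF N(2)[OF t], of "{a<..<b}"]) (use t x in auto)
  qed
  then show ?thesis using N(1) by (intro that[of "N \<union> {a, b}"]) (auto intro: vector_derivative_at)
qed

lemma abs_continuous_on_vector_derivative: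
  fixes x :: "real \<Rightarrow> 'a::euclidean_space"
  assumes ac: "abs_continuous_on a b x" and "a \<le> b"
  shows "(\<lambda>t. vector_derivative x (at t)) absolutely_integrable_on {a..b}"
    and "\<And>t. a \<le> t \<Longrightarrow> t \<le> b \<Longrightarrow> x t = x a + integral {a..t} (\<lambda>t. vector_derivative x (at t))"
proof -
  obtain v where v: "v absolutely_integrable_on {a..b}" "\<And>t. a \<le> t \<Longrightarrow> t \<le> b \<Longrightarrow> x t = x a + integral {a..t} v"
    by (rule abs_continuous_on_eq_integral[OF assms]) (rule that)
  obtain N where N: "negligible N" "\<And>t. t \<in> {a..b} - N \<Longrightarrow> (x has_vector_derivative v t) (at t)"
      "\<And>t. t \<in> {a..b} - N \<Longrightarrow> vector_derivative x (at t) = v t"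
    by (rule vector_derivative_integral_ae[OF v(1)]) (rule v(2), assumption+, rule that)
  show "(\<lambda>t. vector_derivative x (at t)) absolutely_integrable_on {a..b}"
    by (rule absolutely_integrable_spike[OF v(1) N(1,3)])
  show "x t = x a + integral {a..t} (\<lambda>t. vector_derivative x (at t))" if "a \<le> t" "t \<le> b" for t
  proof -
    have "integral {a..t} (\<lambda>t. vector_derivative x (at t)) = integral {a..t} v"
      by (rule integral_spike[OF N(1)]) (use N(3) that in auto)
    then show ?thesis using v(2)[OF that] by simp
  qed
qed

text \<open>\<phi> plays the role of a Bielecki weight: in the norm \<open>sup \<bar>u t\<bar> / \<phi> t\<close> the map
  \<open>u \<mapsto> (\<lambda>t. \<integral>\<^sub>a\<^sup>t k u)\<close> is a contraction with constant 1/2.\<close>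
lemma exponential_weight:
  fixes k :: "real \<Rightarrow> real"
  assumes k: "k absolutely_integrable_on {a..b}" and k0: "\<And>t. a \<le> t \<Longrightarrow> t \<le> b \<Longrightarrow> 0 \<le> k t" and "a \<le> b"
  obtains \<phi> where "continuous_on {a..b} \<phi>"
    "\<And>t. a \<le> t \<Longrightarrow> t \<le> b \<Longrightarrow> 1 \<le> \<phi> t \<and> \<phi> t \<le> exp (2 * integral {a..b} k)"
    "(\<lambda>t. k t * \<phi> t) absolutely_integrable_on {a..b}"
    "\<And>t. a \<le> t \<Longrightarrow> t \<le> b \<Longrightarrow> integral {a..t} (\<lambda>t. k t * \<phi> t) \<le> \<phi> t / 2"
proof -
  have ki: "k integrable_on {a..b}" using k by (simp add: absolutely_integrable_on_def)
  define m where "m t = integral {a..t} k" for t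
  have m_mono: "m s \<le> m t" if "a \<le> s" "s \<le> t" "t \<le> b" for s t
  proof -
    have "m t - m s = integral {s..t} k" unfolding m_def by (rule integral_diff_subinterval[OF ki that])
    moreover have "0 \<le> integral {s..t} k"
      by (rule integral_nonneg) (use that k0 in \<open>auto intro: integrable_on_subinterval[OF ki]\<close>)
    ultimately show ?thesis by linarith
  qed
  have "m a = 0" by (simp add: m_def)
  have m_ac: "abs_continuous_on a b m"
    using abs_continuous_on_integral[OF k, of 0] by (simp add: m_def[abs_def])
  \<comment> \<open>Since \<phi>' = 2 k \<phi> almost everywhere and \<phi> a = 1, the integral of k
    \<phi> over [a, t] equals (\<phi> t - 1) / 2; the 2 in the exponent thus becomes the contraction
    constant 1/2.\<close>
  define \<phi> where "\<phi> t = exp (2 * m t)" for t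
  have bounds: "1 \<le> \<phi> t \<and> \<phi> t \<le> exp (2 * integral {a..b} k)" if "a \<le> t" "t \<le> b" for t
    using m_mono[of a t] m_mono[of t b] that \<open>m a = 0\<close> by (simp add: \<phi>_def m_def)
  have \<phi>_ac: "abs_continuous_on a b \<phi>"
  proof (rule abs_continuous_on_bound[OF m_ac m_ac, where C = "exp (2 * integral {a..b} k)"])
    fix s t assume st: "a \<le> s" "s \<le> t" "t \<le> b"
    \<comment> \<open>The tangent-line inequality for exp bounds the increments of \<phi> by those
      of m. So \<phi> is absolutely continuous and is recovered from its derivative.\<close>
    have "1 + (2 * m s - 2 * m t) \<le> exp (2 * m s - 2 * m t)" by (rule exp_ge_add_one_self)
    then have "\<phi> t * (1 + (2 * m s - 2 * m t)) \<le> \<phi> t * exp (2 * m s - 2 * m t)"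
      by (intro mult_left_mono) (auto simp: \<phi>_def)
    also have "\<dots> = \<phi> s" by (simp add: \<phi>_def exp_add[symmetric])
    finally have "\<phi> t - \<phi> s \<le> \<phi> t * (2 * (m t - m s))" by (simp add: algebra_simps)
    also have "\<dots> \<le> exp (2 * integral {a..b} k) * (2 * (m t - m s))"
      using bounds[of t] m_mono[OF st] st by (intro mult_right_mono) auto
    finally have "\<phi> t - \<phi> s \<le> exp (2 * integral {a..b} k) * (2 * (m t - m s))" .
    moreover have "\<phi> s \<le> \<phi> t" using m_mono[OF st] by (simp add: \<phi>_def)
    ultimately show "norm (\<phi> t - \<phi> s) \<le> exp (2 * integral {a..b} k) * (norm (m t - m s) + norm (m t - m s))"
      using m_mono[OF st] by simp
  qed
  obtain N where N: "negligible N" "\<And>t. t \<in> {a..b} - N \<Longrightarrow> (m has_vector_derivative k t) (at t)"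
  proof -
    have "m t = 0 + integral {a..t} k" for t by (simp add: m_def)
    then show ?thesis by (rule vector_derivative_integral_ae[OF k]) (rule that)
  qed
  have der: "vector_derivative \<phi> (at t) = 2 * (k t * \<phi> t)" if "t \<in> {a..b} - N" for t
  proof (rule vector_derivative_at)
    have "(m has_real_derivative k t) (at t)"
      using N(2)[OF that] by (simp add: has_real_derivative_iff_has_vector_derivative)
    then have "(\<phi> has_real_derivative 2 * (k t * \<phi> t)) (at t)"
      unfolding \<phi>_def by (auto intro!: derivative_eq_intros)
    then show "(\<phi> has_vector_derivative 2 * (k t * \<phi> t)) (at t)"
      by (simp add: has_real_derivative_iff_has_vector_derivative)
  qed
  have two: "(\<lambda>t. 2 * (k t * \<phi> t)) absolutely_integrable_on {a..b}"
    by (rule absolutely_integrable_spike[OF abs_continuous_on_vector_derivative(1)[OF \<phi>_ac \<open>a \<le> b\<close>] N(1)]) (simp add: der)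
  then have k\<phi>: "(\<lambda>t. k t * \<phi> t) absolutely_integrable_on {a..b}"
    using absolutely_integrable_scaleR_left[OF two, of "1/2"] by simp
  show ?thesis
  proof (rule that[OF _ bounds k\<phi>])
    show "continuous_on {a..b} \<phi>" by (rule abs_continuous_on_imp_continuous_on[OF \<phi>_ac])
    fix t assume t: "a \<le> t" "t \<le> b"
    have "\<phi> t = \<phi> a + integral {a..t} (\<lambda>t. vector_derivative \<phi> (at t))"
      by (rule abs_continuous_on_vector_derivative(2)[OF \<phi>_ac \<open>a \<le> b\<close> t])
    also have "integral {a..t} (\<lambda>t. vector_derivative \<phi> (at t)) = integral {a..t} (\<lambda>t. 2 * (k t * \<phi> t))"
      by (rule integral_spike[OF N(1)]) (use der t in auto)
    also have "\<dots> = 2 * integral {a..t} (\<lambda>t. k t * \<phi> t)" by simp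
    finally show "integral {a..t} (\<lambda>t. k t * \<phi> t) \<le> \<phi> t / 2" using bounds[of a] \<open>a \<le> b\<close> by simp
  qed
qed

section \<open>Hamiltonians and their conjugates\<close>

text \<open>Membership of (v, r) in the epigraph of the convex conjugate of h. As a family of closed
  real inequalities it passes to limits and suits measurable selection, with no extended-real
  arithmetic.\<close>

definition conj_le :: "('a::real_inner \<Rightarrow> real) \<Rightarrow> 'a \<Rightarrow> real \<Rightarrow> bool" where
  "conj_le h v r \<longleftrightarrow> (\<forall>p. inner v p - h p \<le> r)"

lemma conj_le_mono: "conj_le h v r \<Longrightarrow> r \<le> s \<Longrightarrow> conj_le h v s"
  by (auto simp: conj_le_def intro: order_trans)

lemma conj_le_lower: "conj_le h v r \<Longrightarrow> - h 0 \<le> r"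
  by (auto simp: conj_le_def dest: spec[of _ 0])

lemma convex_on_norm_affine:
  "convex_on UNIV (\<lambda>p::'a::real_inner. C * norm p + inner v p + d)" if "0 \<le> C"
proof (rule convex_onI)
  fix t :: real and x y :: 'a assume t: "0 < t" "t < 1"
  have "norm ((1 - t) *\<^sub>R x + t *\<^sub>R y) \<le> (1 - t) * norm x + t * norm y"
    using norm_triangle_ineq[of "(1 - t) *\<^sub>R x" "t *\<^sub>R y"] t by simp
  then have "C * norm ((1 - t) *\<^sub>R x + t *\<^sub>R y) \<le> C * ((1 - t) * norm x + t * norm y)"
    using that by (rule mult_left_mono)
  then show "C * norm ((1 - t) *\<^sub>R x + t *\<^sub>R y) + inner v ((1 - t) *\<^sub>R x + t *\<^sub>R y) + d
      \<le> (1 - t) * (C * norm x + inner v x + d) + t * (C * norm y + inner v y + d)"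
    by (simp add: inner_add_right algebra_simps)
qed simp

text \<open>The concave cone h 0 - C * norm p and h agree at the origin, so an affine function
  between them touches h there and its slope is a subgradient at 0. The conjugate takes its least
  possible value at such a slope, by \<open>conj_le_lower\<close>.\<close>

lemma conj_le_subgradient:
  fixes h :: "'a::euclidean_space \<Rightarrow> real"
  assumes h: "convex_on UNIV h" and "0 \<le> C" and le: "\<And>p. h 0 \<le> h p + C * norm p"
  obtains v where "conj_le h v (- h 0)"
proof -
  have conc: "convex_on UNIV (\<lambda>p::'a. - (h 0 - C * norm p))"
    using convex_on_norm_affine[OF \<open>0 \<le> C\<close>, of 0 "- h 0"] by simp
  have "h 0 - C * norm p \<le> h p" for p using le[of p] by simp
  then obtain v \<alpha> where v: "\<And>p. h 0 - C * norm p \<le> inner v p + \<alpha>" "\<And>p. inner v p + \<alpha> \<le> h p"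
    using convex_sandwich[OF h conc] by metis
  have "inner v p - h p \<le> - h 0" for p using v(1)[of 0] v(2)[of p] by simp
  then show ?thesis by (intro that[of v]) (simp add: conj_le_def)
qed

text \<open>Tested at a large multiple of u, the inequality would fail if norm u exceeded C, since
  the linear growth then outweighs the constant d.\<close>

lemma norm_le_if_inner_le:
  fixes u :: "'a::real_inner"
  assumes "\<And>p. inner u p \<le> C * norm p + d" and "0 \<le> C"
  shows "norm u \<le> C"
proof (rule ccontr)
  assume "\<not> ?thesis"
  then have pos: "norm u * (norm u - C) > 0" using \<open>0 \<le> C\<close> by (intro mult_pos_pos) auto
  define s where "s = (\<bar>d\<bar> + 1) / (norm u * (norm u - C))"
  have "s > 0" using pos by (simp add: s_def)
  have "inner u (s *\<^sub>R u) \<le> C * norm (s *\<^sub>R u) + d" by (rule assms(1))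
  then have "s * (norm u * (norm u - C)) \<le> d"
    using \<open>s > 0\<close> by (simp add: dot_square_norm power2_eq_square algebra_simps)
  moreover have "s * (norm u * (norm u - C)) = \<bar>d\<bar> + 1" using pos
    unfolding s_def by (intro nonzero_eq_divide_eq[THEN iffD1]) auto
  ultimately show False by linarith
qed

text \<open>The bound is independent of r: growth of h alone confines every velocity at which the
  conjugate is finite. This is the origin of the velocity bound c * (1 + norm x).\<close>

lemma conj_le_norm:
  assumes "conj_le h v r" "\<And>p. h p \<le> h 0 + C * norm p" "0 \<le> C"
  shows "norm v \<le> C"
proof (rule norm_le_if_inner_le[OF _ assms(3)])
  show "inner v p \<le> C * norm p + (h 0 + r)" for p
    using assms(1)[unfolded conj_le_def, rule_format, of p] assms(2)[of p] by linarith
qed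

text \<open>The part e * norm p of the error is absorbed by moving the velocity, the constant part e
  by raising the cost. The slope of an affine function between inner w p - e * norm p and h' p + (r
  + e) achieves both.\<close>

lemma conj_le_perturb:
  fixes h h' :: "'a::euclidean_space \<Rightarrow> real"
  assumes h': "convex_on UNIV h'" and w: "conj_le h w r" and "0 \<le> e"
    and le: "\<And>p. h p \<le> h' p + e * (1 + norm p)"
  obtains v where "norm (v - w) \<le> e" "conj_le h' v (r + e)"
proof -
  have conv: "convex_on UNIV (\<lambda>p. h' p + (r + e))" 
    by (intro convex_on_add h') (use convex_on_norm_affine[of 0 0] in auto)
  have conc: "convex_on UNIV (\<lambda>p::'a. - (inner w p - e * norm p))"
    using convex_on_norm_affine[OF \<open>0 \<le> e\<close>, of "- w" 0] by simp
  have "inner w p - e * norm p \<le> h' p + (r + e)" for p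
    using w[unfolded conj_le_def, rule_format, of p] le[of p] by (simp add: algebra_simps)
  then obtain v \<alpha> where v: "\<And>p. inner w p - e * norm p \<le> inner v p + \<alpha>" "\<And>p. inner v p + \<alpha> \<le> h' p + (r + e)"
    using convex_sandwich[OF conv conc] by metis
  have "norm (w - v) \<le> e"
  proof (rule norm_le_if_inner_le[OF _ \<open>0 \<le> e\<close>])
    show "inner (w - v) p \<le> e * norm p + \<alpha>" for p using v(1)[of p] by (simp add: inner_diff_left)
  qed
  moreover have "conj_le h' v (r + e)"
    unfolding conj_le_def
  proof
    fix p show "inner v p - h' p \<le> r + e" using v(1)[of 0] v(2)[of p] by simp
  qed
  ultimately show ?thesis by (intro that) (auto simp: norm_minus_commute)
qed

section \<open>Measurable selection of admissible velocities\<close>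

lemma conj_le_dense:
  fixes h :: "'a::euclidean_space \<Rightarrow> real"
  assumes h: "continuous_on UNIV h" and d: "\<And>X. open X \<Longrightarrow> X \<noteq> {} \<Longrightarrow> \<exists>j::nat. d j \<in> X"
    and le: "\<And>j. inner v (d j) - h (d j) \<le> r"
  shows "conj_le h v r"
  unfolding conj_le_def
proof
  fix p
  have "open {p. r < inner v p - h p}"
    by (intro open_Collect_less continuous_intros h)
  then have "{p. r < inner v p - h p} = {}" using d le by (metis (mono_tags, lifting) linorder_not_less mem_Collect_eq)
  then show "inner v p - h p \<le> r" by (metis (mono_tags, lifting) empty_iff linorder_not_less mem_Collect_eq)
qed

lemma countable_dense_sequence:
  obtains d :: "nat \<Rightarrow> 'a::{second_countable_topology, t1_space}"
  where "\<And>X. open X \<Longrightarrow> X \<noteq> {} \<Longrightarrow> \<exists>j. d j \<in> X"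
proof -
  obtain D :: "'a set" where D: "countable D" "\<And>X. open X \<Longrightarrow> X \<noteq> {} \<Longrightarrow> \<exists>d\<in>D. d \<in> X"
    using countable_dense_setE by blast
  show ?thesis
  proof (rule that[of "from_nat_into D"])
    fix X :: "'a set" assume "open X" "X \<noteq> {}"
    then obtain q where "q \<in> D" "q \<in> X" using D(2) by blast
    then show "\<exists>j. from_nat_into D j \<in> X" using from_nat_into_surj[OF D(1)] by metis
  qed
qed

lemma continuous_on_snd_section:
  assumes "continuous_on UNIV (\<lambda>(x, p). f x p)" shows "continuous_on UNIV (f x)"
proof -
  have "continuous_on UNIV ((\<lambda>(x, p). f x p) \<circ> (\<lambda>p. (x, p)))"
    by (rule continuous_on_compose) (auto intro!: continuous_intros continuous_on_subset[OF assms])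
  then show ?thesis by (simp add: o_def)
qed

lemma continuous_on_fst_section:
  assumes "continuous_on UNIV (\<lambda>(x, p). f x p)" shows "continuous_on UNIV (\<lambda>x. f x p)"
proof -
  have "continuous_on UNIV ((\<lambda>(x, p). f x p) \<circ> (\<lambda>x. (x, p)))"
    by (rule continuous_on_compose) (auto intro!: continuous_intros continuous_on_subset[OF assms])
  then show ?thesis by (simp add: o_def)
qed

lemma conj_le_selection:
  fixes h :: "'w \<Rightarrow> 'a::euclidean_space \<Rightarrow> 'a \<Rightarrow> real"
  assumes h_meas: "\<And>x p. (\<lambda>t. h t x p) \<in> borel_measurable M"
    and h_cont: "\<And>t. t \<in> space M \<Longrightarrow> continuous_on UNIV (\<lambda>(x, p). h t x p)"
    and [measurable]: "z \<in> borel_measurable M" "w \<in> borel_measurable M" "\<eta> \<in> borel_measurable M" "e \<in> borel_measurable M"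
    and ex: "\<And>t. t \<in> space M \<Longrightarrow> \<exists>v. norm (v - w t) \<le> e t \<and> conj_le (h t (z t)) v (\<eta> t)"
  obtains v where "v \<in> borel_measurable M"
    "\<And>t. t \<in> space M \<Longrightarrow> norm (v t - w t) \<le> e t \<and> conj_le (h t (z t)) (v t) (\<eta> t)"
proof -
  obtain d :: "nat \<Rightarrow> 'a" where d: "\<And>X. open X \<Longrightarrow> X \<noteq> {} \<Longrightarrow> \<exists>j. d j \<in> X"
    using countable_dense_sequence by blast
  \<comment> \<open>Index 0 carries the distance constraint; the other indices test the conjugate
    inequality on a dense sequence of momenta, which suffices by continuity.\<close>
  define \<Phi> where "\<Phi> j t v = (case j of 0 \<Rightarrow> norm (v - w t) - e t
    | Suc j \<Rightarrow> inner v (d j) - h t (z t) (d j) - \<eta> t)" for j t v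
  have hz [measurable]: "(\<lambda>t. h t (z t) p) \<in> borel_measurable M" for p
    by (rule borel_measurable_caratheodory[OF h_meas]) (auto intro: continuous_on_fst_section[OF h_cont])
  have m: "(\<lambda>t. \<Phi> j t v) \<in> borel_measurable M" for j v
    by (cases j) (simp_all add: \<Phi>_def)
  have c: "continuous_on UNIV (\<Phi> j t)" if "t \<in> space M" for j t
    by (cases j) (auto simp: \<Phi>_def[abs_def] intro!: continuous_intros)
  have n: "\<exists>v. \<forall>j. \<Phi> j t v \<le> 0" if "t \<in> space M" for t
  proof -
    obtain v where v: "norm (v - w t) \<le> e t" "conj_le (h t (z t)) v (\<eta> t)" using ex[OF \<open>t \<in> space M\<close>] by blast
    have "\<Phi> j t v \<le> 0" for j
      using v by (cases j) (auto simp: \<Phi>_def conj_le_def dest: spec)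
    then show ?thesis by blast
  qed
  obtain v where v: "v \<in> borel_measurable M" "\<And>t j. t \<in> space M \<Longrightarrow> \<Phi> j t (v t) \<le> 0"
    using measurable_selection[of \<Phi> M, OF m c n] by metis
  show ?thesis
  proof (rule that[OF v(1)])
    fix t assume t: "t \<in> space M"
    have "norm (v t - w t) \<le> e t" using v(2)[OF t, of 0] by (simp add: \<Phi>_def)
    moreover have "conj_le (h t (z t)) (v t) (\<eta> t)"
    proof (rule conj_le_dense[OF continuous_on_snd_section[OF h_cont[OF t]] d])
      show "inner (v t) (d j) - h t (z t) (d j) \<le> \<eta> t" for j
        using v(2)[OF t, of "Suc j"] by (simp add: \<Phi>_def)
    qed
    ultimately show "norm (v t - w t) \<le> e t \<and> conj_le (h t (z t)) (v t) (\<eta> t)" ..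
  qed
qed

section \<open>Filippov's theorem for Lipschitz Hamiltonians\<close>

text \<open>Successive approximation: the current velocity is integrated to a new curve, and then
  corrected so as to be admissible along it, at the price of k times the displacement both in
  velocity and in cost (\<open>conj_le_perturb\<close>). In the weighted norm the defect halves at
  each round. With W the bound on the weight, the total displacement is at most 2 W \<Gamma> and the
  cost rises by at most k times that.\<close>

theorem filippov:
  fixes h :: "real \<Rightarrow> 'a::euclidean_space \<Rightarrow> 'a \<Rightarrow> real"
  assumes "a \<le> b"
    and h_meas: "\<And>x p. (\<lambda>t. h t x p) \<in> borel_measurable (lebesgue_on {a..b})"
    and h_cont: "\<And>t. t \<in> {a..b} \<Longrightarrow> continuous_on UNIV (\<lambda>(x, p). h t x p)"
    and h_conv: "\<And>t x. t \<in> {a..b} \<Longrightarrow> convex_on UNIV (h t x)"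
    and h_lip: "\<And>t x y p. t \<in> {a..b} \<Longrightarrow> \<bar>h t x p - h t y p\<bar> \<le> k t * (1 + norm p) * norm (x - y)"
    and k: "k absolutely_integrable_on {a..b}" and k0: "\<And>t. t \<in> {a..b} \<Longrightarrow> 0 \<le> k t"
    and z_cont: "continuous_on {a..b} z" and z: "\<And>t. t \<in> {a..b} \<Longrightarrow> z t = x0 + integral {a..t} \<zeta>"
    and \<zeta>: "\<zeta> absolutely_integrable_on {a..b}" and w: "w absolutely_integrable_on {a..b}"
    and \<eta>: "\<eta> \<in> borel_measurable (lebesgue_on {a..b})"
    and adm: "\<And>t. t \<in> {a..b} \<Longrightarrow> conj_le (h t (z t)) (w t) (\<eta> t)"
    and \<Gamma>: "integral {a..b} (\<lambda>t. norm (w t - \<zeta> t)) \<le> \<Gamma>"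
    and K: "2 * exp (2 * integral {a..b} k) \<le> K"
  obtains v where "v absolutely_integrable_on {a..b}"
    "\<And>t. t \<in> {a..b} \<Longrightarrow> conj_le (h t (x0 + integral {a..t} v)) (v t) (\<eta> t + k t * (K * \<Gamma>))"
    "\<And>t. t \<in> {a..b} \<Longrightarrow> norm (x0 + integral {a..t} v - z t) \<le> K * \<Gamma>"
proof -
  let ?M = "lebesgue_on {a..b}"
  have space: "space ?M = {a..b}" by (simp add: space_restrict_space)
  obtain \<phi> where \<phi>: "continuous_on {a..b} \<phi>"
    "\<And>t. a \<le> t \<Longrightarrow> t \<le> b \<Longrightarrow> 1 \<le> \<phi> t \<and> \<phi> t \<le> exp (2 * integral {a..b} k)"
    "(\<lambda>t. k t * \<phi> t) absolutely_integrable_on {a..b}"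
    "\<And>t. a \<le> t \<Longrightarrow> t \<le> b \<Longrightarrow> integral {a..t} (\<lambda>t. k t * \<phi> t) \<le> \<phi> t / 2"
    by (rule exponential_weight[OF k _ \<open>a \<le> b\<close>]) (use k0 in \<open>auto intro: that\<close>)
  define W where "W = exp (2 * integral {a..b} k)"
  have "W \<ge> 1" unfolding W_def using \<phi>(2)[of a] \<open>a \<le> b\<close> by linarith
  have abs_int: "f integrable_on {a..t}" "(\<lambda>t. norm (f t)) integrable_on {a..t}"
    if "f absolutely_integrable_on {a..b}" "t \<le> b" for f :: "real \<Rightarrow> 'b::euclidean_space" and t
    using that(2) absolutely_integrable_on_subinterval[OF that(1), of a t]
    by (auto simp: absolutely_integrable_on_def)
  have meas_abs: "f \<in> borel_measurable ?M" if "f absolutely_integrable_on {a..b}" for f :: "real \<Rightarrow> 'b::euclidean_space"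
    using that by (intro absolutely_integrable_imp_borel_measurable) auto
  note [measurable] = \<eta> meas_abs[OF k] meas_abs[OF \<zeta>] meas_abs[OF w]
  have w\<zeta>: "(\<lambda>t. w t - \<zeta> t) absolutely_integrable_on {a..b}" by (intro set_integral_diff(1) w \<zeta>)
  have "0 \<le> integral {a..b} (\<lambda>t. norm (w t - \<zeta> t))"
    by (intro integral_nonneg abs_int(2)[OF w\<zeta>]) auto
  then have "\<Gamma> \<ge> 0" using \<Gamma> by linarith
  \<comment> \<open>The sum of W * \<Gamma> * (1/2)^j over j < i. It bounds the displacement after i
    rounds and, multiplied by k, the rise of the cost.\<close>
  define r where "r i = 2 * W * \<Gamma> * (1 - (1/2)^i)" for i :: nat
  have r_Suc: "r (Suc i) = r i + W * \<Gamma> * (1/2)^i" for i by (simp add: r_def algebra_simps)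
  have r_le: "r i \<le> K * \<Gamma>" for i
  proof -
    have "r i \<le> 2 * W * \<Gamma>" using \<open>W \<ge> 1\<close> \<open>\<Gamma> \<ge> 0\<close> by (simp add: r_def algebra_simps)
    also have "\<dots> \<le> K * \<Gamma>" using K \<open>\<Gamma> \<ge> 0\<close> unfolding W_def by (rule mult_right_mono)
    finally show ?thesis .
  qed
  \<comment> \<open>In a state (y, v), the velocity v is admissible along y but integrates to a
    slightly different curve; the third clause measures that defect in the weighted norm.\<close>
  define P where "P i s \<longleftrightarrow> (case s of (y, v) \<Rightarrow>
      y \<in> borel_measurable ?M \<and> v absolutely_integrable_on {a..b} \<and>
      (\<forall>t\<in>{a..b}. norm (x0 + integral {a..t} v - y t) \<le> \<Gamma> * (1/2)^i * \<phi> t) \<and>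
      (\<forall>t\<in>{a..b}. conj_le (h t (y t)) (v t) (\<eta> t + k t * r i)))"
    for i and s :: "(real \<Rightarrow> 'a) \<times> (real \<Rightarrow> 'a)"
  define Q where "Q i s s' \<longleftrightarrow> fst s' = (\<lambda>t. x0 + integral {a..t} (snd s)) \<and>
      (\<forall>t\<in>{a..b}. norm (snd s' t - snd s t) \<le> k t * (W * \<Gamma>) * (1/2)^i)"
    for i :: nat and s s' :: "(real \<Rightarrow> 'a) \<times> (real \<Rightarrow> 'a)"
  have base: "P 0 (z, w)"
    unfolding P_def prod.case
  proof (intro conjI ballI)
    show "z \<in> borel_measurable ?M" by (rule continuous_imp_measurable_on_sets_lebesgue[OF z_cont]) simp
    fix t assume t: "t \<in> {a..b}"
    show "conj_le (h t (z t)) (w t) (\<eta> t + k t * r 0)" using adm[OF t] by (simp add: r_def)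
    have "x0 + integral {a..t} w - z t = integral {a..t} (\<lambda>t. w t - \<zeta> t)"
      using t z[OF t] by (simp add: Henstock_Kurzweil_Integration.integral_diff abs_int(1)[OF w] abs_int(1)[OF \<zeta>])
    also have "norm \<dots> \<le> integral {a..t} (\<lambda>t. norm (w t - \<zeta> t))"
      using t by (intro integral_norm_bound_integral abs_int[OF w\<zeta>]) auto
    also have "\<dots> \<le> integral {a..b} (\<lambda>t. norm (w t - \<zeta> t))"
      using t by (intro integral_subset_le abs_int(2)[OF w\<zeta>]) auto
    also have "\<dots> \<le> \<Gamma>" by (rule \<Gamma>)
    also have "\<dots> \<le> \<Gamma> * (1/2)^0 * \<phi> t"
      using \<phi>(2)[of t] t mult_left_mono[of 1 "\<phi> t" \<Gamma>] \<open>\<Gamma> \<ge> 0\<close> by simp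
    finally show "norm (x0 + integral {a..t} w - z t) \<le> \<Gamma> * (1/2)^0 * \<phi> t" .
  qed (rule w)
  have step: "\<exists>s'. P (Suc i) s' \<and> Q i s s'" if Ps: "P i s" for i s
  proof -
    obtain y v where s: "s = (y, v)" by fastforce
    have y [measurable]: "y \<in> borel_measurable ?M" and v: "v absolutely_integrable_on {a..b}"
      and close: "\<And>t. t \<in> {a..b} \<Longrightarrow> norm (x0 + integral {a..t} v - y t) \<le> \<Gamma> * (1/2)^i * \<phi> t"
      and cle: "\<And>t. t \<in> {a..b} \<Longrightarrow> conj_le (h t (y t)) (v t) (\<eta> t + k t * r i)"
      using Ps by (auto simp: P_def s)
    note [measurable] = meas_abs[OF v]
    define y' where "y' t = x0 + integral {a..t} v" for t
    have y'_cont: "continuous_on {a..b} y'"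
      unfolding y'_def[abs_def] by (intro continuous_intros indefinite_integral_continuous_1 abs_int(1)[OF v]) simp
    then have [measurable]: "y' \<in> borel_measurable ?M"
      by (rule continuous_imp_measurable_on_sets_lebesgue) simp
    define e where "e t = k t * norm (y t - y' t)" for t
    have e_le: "e t \<le> \<Gamma> * (1/2)^i * (k t * \<phi> t)" if "t \<in> {a..b}" for t
      using mult_left_mono[OF close[OF that] k0[OF that]]
      by (simp add: e_def y'_def norm_minus_commute algebra_simps)
    have e_le': "e t \<le> k t * (W * \<Gamma>) * (1/2)^i" if "t \<in> {a..b}" for t
    proof -
      have "k t * \<phi> t \<le> k t * W" using \<phi>(2)[of t] that k0[OF that] by (intro mult_left_mono) (auto simp: W_def)
      then have "\<Gamma> * (1/2)^i * (k t * \<phi> t) \<le> \<Gamma> * (1/2)^i * (k t * W)"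
        by (rule mult_left_mono) (use \<open>\<Gamma> \<ge> 0\<close> in simp)
      then show ?thesis using e_le[OF that] by (simp add: algebra_simps)
    qed
    have ex: "\<exists>u. norm (u - v t) \<le> e t \<and> conj_le (h t (y' t)) u (\<eta> t + k t * r i + e t)" if "t \<in> space ?M" for t
    proof -
      have t: "t \<in> {a..b}" using that by (simp add: space)
      have "h t (y t) p \<le> h t (y' t) p + e t * (1 + norm p)" for p
        using h_lip[OF t, of "y t" p "y' t"] by (simp add: e_def algebra_simps)
      moreover have "0 \<le> e t" using k0[OF t] by (simp add: e_def)
      ultimately show ?thesis using conj_le_perturb[OF h_conv[OF t] cle[OF t]] by metis
    qed
    have e_meas [measurable]: "e \<in> borel_measurable ?M" unfolding e_def by measurable
    have s_meas: "(\<lambda>t. \<eta> t + k t * r i + e t) \<in> borel_measurable ?M" by measurable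
    obtain v' where v' [measurable]: "v' \<in> borel_measurable ?M"
      and v'_prop: "\<And>t. t \<in> space ?M \<Longrightarrow> norm (v' t - v t) \<le> e t \<and> conj_le (h t (y' t)) (v' t) (\<eta> t + k t * r i + e t)"
      by (rule conj_le_selection[OF h_meas _ \<open>y' \<in> borel_measurable ?M\<close> meas_abs[OF v] s_meas e_meas ex])
        (simp add: space h_cont, assumption, rule that)
    have v'_near: "norm (v' t - v t) \<le> e t" and v'_cle: "conj_le (h t (y' t)) (v' t) (\<eta> t + k t * r i + e t)"
      if "t \<in> {a..b}" for t using v'_prop[of t] that by (auto simp: space)
    have k\<phi>: "(\<lambda>t. \<Gamma> * (1/2)^i * (k t * \<phi> t)) integrable_on {a..t}" if "t \<le> b" for t
      using abs_int(1)[OF \<phi>(3) that] by (rule integrable_on_mult_right)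
    have diff: "(\<lambda>t. v' t - v t) absolutely_integrable_on {a..b}"
      by (rule measurable_bounded_by_integrable_imp_absolutely_integrable[OF _ _ k\<phi>[OF order_refl]])
        (use v'_near e_le in \<open>auto intro: order_trans\<close>)
    from set_integral_add(1)[OF diff v] have v'_abs: "v' absolutely_integrable_on {a..b}" by simp
    have "P (Suc i) (y', v')"
      unfolding P_def prod.case
    proof (intro conjI ballI)
      fix t assume t: "t \<in> {a..b}"
      have "\<eta> t + k t * r i + e t \<le> \<eta> t + k t * r (Suc i)" using e_le'[OF t] by (simp add: r_Suc algebra_simps)
      then show "conj_le (h t (y' t)) (v' t) (\<eta> t + k t * r (Suc i))" by (rule conj_le_mono[OF v'_cle[OF t]])
      have "x0 + integral {a..t} v' - y' t = integral {a..t} (\<lambda>t. v' t - v t)"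
        using t by (simp add: y'_def Henstock_Kurzweil_Integration.integral_diff abs_int(1)[OF v'_abs] abs_int(1)[OF v])
      also have "norm \<dots> \<le> integral {a..t} (\<lambda>t. \<Gamma> * (1/2)^i * (k t * \<phi> t))"
        using t v'_near e_le by (intro integral_norm_bound_integral abs_int(1)[OF diff] k\<phi>) (auto intro: order_trans)
      also have "\<dots> = \<Gamma> * (1/2)^i * integral {a..t} (\<lambda>t. k t * \<phi> t)" by simp
      also have "\<dots> \<le> \<Gamma> * (1/2)^i * (\<phi> t / 2)"
        using t \<phi>(4)[of t] \<open>\<Gamma> \<ge> 0\<close> by (intro mult_left_mono) auto
      finally show "norm (x0 + integral {a..t} v' - y' t) \<le> \<Gamma> * (1/2)^Suc i * \<phi> t" by simp
    qed (use v'_abs in auto)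
    moreover have "Q i s (y', v')"
      using order_trans[OF v'_near e_le'] by (auto simp: Q_def s y'_def)
    ultimately show ?thesis by blast
  qed
  \<comment> \<open>Dependent choice, since each correction is selected from the preceding state;
    the implication at n = 0 fixes the initial state.\<close>
  obtain S where S0: "S 0 = (z, w)" and S: "\<And>i. P i (S i)" "\<And>i. Q i (S i) (S (Suc i))"
  proof -
    have "\<exists>f. \<forall>n. (P n (f n) \<and> (n = 0 \<longrightarrow> f n = (z, w))) \<and> Q n (f n) (f (Suc n))"
      by (rule dependent_nat_choice) (use base step in auto)
    then show ?thesis using that by metis
  qed
  define y v where "y i = fst (S i)" and "v i = snd (S i)" for i
  have v_abs: "v i absolutely_integrable_on {a..b}"
    and v_cle: "\<And>t. t \<in> {a..b} \<Longrightarrow> conj_le (h t (y i t)) (v i t) (\<eta> t + k t * r i)"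
    and y_close: "\<And>t. t \<in> {a..b} \<Longrightarrow> norm (x0 + integral {a..t} (v i) - y i t) \<le> \<Gamma> * (1/2)^i * \<phi> t" for i
    using S(1)[of i] by (auto simp: P_def y_def v_def split: prod.splits)
  have y_Suc: "y (Suc i) t = x0 + integral {a..t} (v i)"
    and v_step: "\<And>t. t \<in> {a..b} \<Longrightarrow> norm (v (Suc i) t - v i t) \<le> k t * (W * \<Gamma>) * (1/2)^i" for i t
    using S(2)[of i] by (auto simp: Q_def y_def v_def)
  have y0: "y 0 = z" and v0: "v 0 = w" by (simp_all add: y_def v_def S0)
  have v_conv: "\<exists>l. (\<lambda>i. v i t) \<longlonglongrightarrow> l" if t: "t \<in> {a..b}" for t
  proof -
    have "summable (\<lambda>i. v (Suc i) t - v i t)"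
    proof (rule summable_comparison_test')
      show "summable (\<lambda>i. k t * (W * \<Gamma>) * (1/2::real)^i)" by (intro summable_mult summable_geometric) auto
      show "norm (v (Suc i) t - v i t) \<le> k t * (W * \<Gamma>) * (1/2)^i" for i by (rule v_step[OF t])
    qed
    then have "convergent (\<lambda>n. \<Sum>i<n. v (Suc i) t - v i t)" by (simp add: summable_iff_convergent)
    then have "convergent (\<lambda>n. v n t - v 0 t)" using sum_lessThan_telescope[of "\<lambda>i. v i t"] by simp
    then have "convergent (\<lambda>n. (v n t - v 0 t) + v 0 t)" by (intro convergent_add convergent_const)
    then show ?thesis by (simp add: convergent_def)
  qed
  define vl where "vl t = lim (\<lambda>i. v i t)" for t
  have v_lim: "(\<lambda>i. v i t) \<longlonglongrightarrow> vl t" if "t \<in> {a..b}" for t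
    using v_conv[OF that] by (auto simp: vl_def limI)
  have v_bound: "norm (v i t) \<le> norm (w t) + k t * r i" if t: "t \<in> {a..b}" for i t
  proof (induction i)
    case (Suc i)
    have "norm (v (Suc i) t) \<le> norm (v i t) + norm (v (Suc i) t - v i t)"
      using norm_triangle_ineq[of "v i t" "v (Suc i) t - v i t"] by simp
    also have "\<dots> \<le> norm (w t) + k t * r i + k t * (W * \<Gamma>) * (1/2)^i" using Suc v_step[OF t, of i] by linarith
    finally show ?case by (simp add: r_Suc algebra_simps)
  qed (simp add: v0 r_def)
  \<comment> \<open>The corrections add up to at most k t * r i, so a single integrable function
    dominates all velocities. Dominated convergence then covers both the limit velocity and the
    curves.\<close>
  have v_bound': "norm (v i t) \<le> norm (w t) + K * \<Gamma> * k t" if t: "t \<in> {a..b}" for i t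
    using v_bound[OF t, of i] mult_left_mono[OF r_le k0[OF t], of i] by (simp add: algebra_simps)
  have dom: "(\<lambda>t. norm (w t) + K * \<Gamma> * k t) integrable_on {a..t}" if "t \<le> b" for t
    using abs_int(2)[OF w that] abs_int(1)[OF k that] by (intro integrable_add integrable_on_mult_right)
  have vl_abs: "vl absolutely_integrable_on {a..b}"
  proof (rule dominated_convergence_absolutely_integrable[OF v_abs dom[OF order_refl] _ v_lim])
    fix t assume t: "t \<in> {a..b}"
    have "(\<lambda>i. norm (v i t)) \<longlonglongrightarrow> norm (vl t)" by (intro tendsto_norm v_lim t)
    then show "norm (vl t) \<le> norm (w t) + K * \<Gamma> * k t"
      by (rule LIMSEQ_le_const2) (use v_bound'[OF t] in auto)
  qed auto
  have y_lim: "(\<lambda>i. y i t) \<longlonglongrightarrow> x0 + integral {a..t} vl" if t: "t \<in> {a..b}" for t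
  proof -
    have "(\<lambda>i. integral {a..t} (v i)) \<longlonglongrightarrow> integral {a..t} vl"
    proof (rule dominated_convergence(2)[OF abs_int(1)[OF v_abs] dom])
      show "norm (v i s) \<le> norm (w s) + K * \<Gamma> * k s" if "s \<in> {a..t}" for i s
        using that t by (intro v_bound') auto
      show "(\<lambda>i. v i s) \<longlonglongrightarrow> vl s" if "s \<in> {a..t}" for s using that t by (intro v_lim) auto
    qed (use t in auto)
    then have "(\<lambda>i. y (Suc i) t) \<longlonglongrightarrow> x0 + integral {a..t} vl"
      unfolding y_Suc by (intro tendsto_intros)
    then show ?thesis by (rule LIMSEQ_imp_Suc)
  qed
  show ?thesis
  proof (rule that[OF vl_abs])
    fix t assume t: "t \<in> {a..b}"
    show "conj_le (h t (x0 + integral {a..t} vl)) (vl t) (\<eta> t + k t * (K * \<Gamma>))"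
      unfolding conj_le_def
    proof
      fix p
      have "(\<lambda>i. inner (v i t) p - h t (y i t) p) \<longlonglongrightarrow> inner (vl t) p - h t (x0 + integral {a..t} vl) p"
        by (intro tendsto_diff tendsto_inner v_lim[OF t] tendsto_const
            continuous_on_tendsto_compose[OF continuous_on_fst_section[OF h_cont[OF t]] y_lim[OF t]]) auto
      moreover have "inner (v i t) p - h t (y i t) p \<le> \<eta> t + k t * (K * \<Gamma>)" for i
        using v_cle[OF t, of i] mult_left_mono[OF r_le k0[OF t], of i]
        unfolding conj_le_def by (meson add_left_mono order_trans)
      ultimately show "inner (vl t) p - h t (x0 + integral {a..t} vl) p \<le> \<eta> t + k t * (K * \<Gamma>)"
        by (intro LIMSEQ_le_const2) auto
    qed
    have "norm (y i t - z t) \<le> r i" for i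
    proof (induction i)
      case (Suc i)
      have "norm (y (Suc i) t - y i t) \<le> \<Gamma> * (1/2)^i * \<phi> t" using y_close[OF t, of i] by (simp add: y_Suc)
      also have "\<dots> \<le> \<Gamma> * (1/2)^i * W" using \<phi>(2)[of t] t \<open>\<Gamma> \<ge> 0\<close> by (intro mult_left_mono) (auto simp: W_def)
      finally show ?case
        using Suc norm_triangle_ineq[of "y (Suc i) t - y i t" "y i t - z t"] by (simp add: r_Suc algebra_simps)
    qed (simp add: y0 r_def)
    then have "norm (y i t - z t) \<le> K * \<Gamma>" for i using r_le order_trans by blast
    moreover have "(\<lambda>i. norm (y i t - z t)) \<longlonglongrightarrow> norm (x0 + integral {a..t} vl - z t)"
      by (intro tendsto_intros y_lim t)
    ultimately show "norm (x0 + integral {a..t} vl - z t) \<le> K * \<Gamma>"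
      by (intro LIMSEQ_le_const2) auto
  qed
qed

section \<open>Growth bounds\<close>

text \<open>Let u / \<phi> attain its maximum S at \<tau>. The hypothesis at \<tau> and the
  contraction property of the weight give S * \<phi> \<tau> \<le> A + S * \<phi> \<tau> / 2, hence S
  \<le> 2 * A. Both factors 2 in the bound come from this weight.\<close>

lemma gronwall_bound:
  fixes u c :: "real \<Rightarrow> real"
  assumes "a \<le> b" and c: "c absolutely_integrable_on {a..b}" and c0: "\<And>t. t \<in> {a..b} \<Longrightarrow> 0 \<le> c t"
    and u_cont: "continuous_on {a..b} u" and u0: "\<And>t. t \<in> {a..b} \<Longrightarrow> 0 \<le> u t"
    and le: "\<And>t. t \<in> {a..b} \<Longrightarrow> u t \<le> A + integral {a..t} (\<lambda>s. c s * u s)"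
    and t: "t \<in> {a..b}"
  shows "u t \<le> 2 * A * exp (2 * integral {a..b} c)"
proof -
  obtain \<phi> where \<phi>: "continuous_on {a..b} \<phi>"
    "\<And>t. a \<le> t \<Longrightarrow> t \<le> b \<Longrightarrow> 1 \<le> \<phi> t \<and> \<phi> t \<le> exp (2 * integral {a..b} c)"
    "(\<lambda>t. c t * \<phi> t) absolutely_integrable_on {a..b}"
    "\<And>t. a \<le> t \<Longrightarrow> t \<le> b \<Longrightarrow> integral {a..t} (\<lambda>t. c t * \<phi> t) \<le> \<phi> t / 2"
    by (rule exponential_weight[OF c _ \<open>a \<le> b\<close>]) (use c0 in \<open>auto intro: that\<close>)
  have "continuous_on {a..b} (\<lambda>t. u t / \<phi> t)"
    using \<phi>(2) by (intro continuous_intros u_cont \<phi>(1)) force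
  moreover have "{a..b} \<noteq> {}" using \<open>a \<le> b\<close> by simp
  ultimately obtain \<tau> where \<tau>: "\<tau> \<in> {a..b}" "\<And>s. s \<in> {a..b} \<Longrightarrow> u s / \<phi> s \<le> u \<tau> / \<phi> \<tau>"
    using continuous_attains_sup[of "{a..b}" "\<lambda>t. u t / \<phi> t"] by auto
  define S where "S = u \<tau> / \<phi> \<tau>"
  have \<phi>_pos: "\<phi> s > 0" if "s \<in> {a..b}" for s using \<phi>(2)[of s] that by auto
  have "S \<ge> 0" unfolding S_def using u0[OF \<tau>(1)] \<phi>_pos[OF \<tau>(1)] by simp
  have uS: "u s \<le> S * \<phi> s" if "s \<in> {a..b}" for s
    using \<tau>(2)[OF that] \<phi>_pos[OF that] by (simp add: S_def[symmetric] field_simps)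
  have u\<tau>: "u \<tau> = S * \<phi> \<tau>" using \<phi>_pos[OF \<tau>(1)] by (simp add: S_def)
  have int: "(\<lambda>s. S * (c s * \<phi> s)) integrable_on {a..\<tau>}"
  proof (rule integrable_on_mult_right, rule integrable_on_subinterval)
    show "(\<lambda>t. c t * \<phi> t) integrable_on {a..b}" using \<phi>(3) by (simp add: absolutely_integrable_on_def)
  qed (use \<tau>(1) in auto)
  have cu: "c s * u s \<le> S * (c s * \<phi> s)" if "s \<in> {a..b}" for s
    using mult_left_mono[OF uS[OF that] c0[OF that]] by (simp add: algebra_simps)
  have sub: "{a..\<tau>} \<subseteq> {a..b}" using \<tau>(1) by auto
  have "(\<lambda>s. c s * u s) integrable_on {a..\<tau>}"
  proof (rule measurable_bounded_by_integrable_imp_integrable[OF _ int])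
    have [measurable]: "u \<in> borel_measurable (lebesgue_on {a..\<tau>})"
      by (rule continuous_imp_measurable_on_sets_lebesgue) (auto intro: continuous_on_subset[OF u_cont sub])
    have [measurable]: "c \<in> borel_measurable (lebesgue_on {a..\<tau>})"
      by (rule absolutely_integrable_imp_borel_measurable[OF absolutely_integrable_on_subinterval[OF c sub]]) simp
    show "(\<lambda>s. c s * u s) \<in> borel_measurable (lebesgue_on {a..\<tau>})" by measurable
    show "norm (c s * u s) \<le> S * (c s * \<phi> s)" if "s \<in> {a..\<tau>}" for s
      using cu[of s] c0[of s] u0[of s] that sub by auto
  qed simp
  then have "integral {a..\<tau>} (\<lambda>s. c s * u s) \<le> integral {a..\<tau>} (\<lambda>s. S * (c s * \<phi> s))"
    by (rule integral_le[OF _ int]) (use cu sub in blast)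
  also have "\<dots> = S * integral {a..\<tau>} (\<lambda>s. c s * \<phi> s)" by simp
  also have "\<dots> \<le> S * (\<phi> \<tau> / 2)" using \<phi>(4)[of \<tau>] \<tau>(1) \<open>S \<ge> 0\<close> by (intro mult_left_mono) auto
  finally have "S * \<phi> \<tau> \<le> 2 * A" using le[OF \<tau>(1)] u\<tau> by simp
  moreover have "S * 1 \<le> S * \<phi> \<tau>" using \<phi>(2)[of \<tau>] \<tau>(1) \<open>S \<ge> 0\<close> by (intro mult_left_mono) auto
  ultimately have "S \<le> 2 * A" by linarith
  have "u t \<le> S * \<phi> t" by (rule uS[OF t])
  also have "\<dots> \<le> 2 * A * exp (2 * integral {a..b} c)"
    using \<phi>(2)[of t] t \<open>S \<le> 2 * A\<close> \<open>S \<ge> 0\<close> by (intro mult_mono) auto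
  finally show ?thesis .
qed

text \<open>Gronwall's inequality is applied to 1 + norm x, which absorbs the affine term of the
  growth condition.\<close>

lemma linear_growth_bound:
  fixes x v :: "real \<Rightarrow> 'a::euclidean_space"
  assumes "a \<le> b" and c: "c absolutely_integrable_on {a..b}" and c0: "\<And>t. t \<in> {a..b} \<Longrightarrow> 0 \<le> c t"
    and v: "v absolutely_integrable_on {a..b}" and x: "\<And>t. t \<in> {a..b} \<Longrightarrow> x t = x0 + integral {a..t} v"
    and N: "negligible N" and le: "\<And>t. t \<in> {a..b} - N \<Longrightarrow> norm (v t) \<le> c t * (1 + norm (x t))"
    and t: "t \<in> {a..b}"
  shows "norm (x t) \<le> 2 * (1 + norm x0) * exp (2 * integral {a..b} c)"
proof -
  have vi: "v integrable_on {a..b}" using v by (simp add: absolutely_integrable_on_def)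
  have "continuous_on {a..b} (\<lambda>t. x0 + integral {a..t} v)"
    by (intro continuous_intros indefinite_integral_continuous_1 vi)
  then have x_cont: "continuous_on {a..b} x" by (rule continuous_on_eq) (simp add: x)
  have "1 + norm (x t) \<le> 2 * (1 + norm x0) * exp (2 * integral {a..b} c)"
  proof (rule gronwall_bound[OF \<open>a \<le> b\<close> c c0 _ _ _ t])
    show "continuous_on {a..b} (\<lambda>t. 1 + norm (x t))" by (intro continuous_intros x_cont)
    fix t assume t: "t \<in> {a..b}"
    have sub: "{a..t} \<subseteq> {a..b}" using t by auto
    have cx: "(\<lambda>s. c s * (1 + norm (x s))) absolutely_integrable_on {a..t}"
    proof -
      have "(\<lambda>s. (1 + norm (x s)) * c s) absolutely_integrable_on {a..t}"
      proof (rule absolutely_integrable_bounded_measurable_product_real)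
        have "continuous_on {a..t} (\<lambda>s. 1 + norm (x s))"
          by (intro continuous_intros continuous_on_subset[OF x_cont sub])
        then show "(\<lambda>s. 1 + norm (x s)) \<in> borel_measurable (lebesgue_on {a..t})"
          by (rule continuous_imp_measurable_on_sets_lebesgue) simp
        show "bounded ((\<lambda>s. 1 + norm (x s)) ` {a..t})"
          by (intro compact_imp_bounded compact_continuous_image) (use \<open>continuous_on {a..t} _\<close> in auto)
      qed (use absolutely_integrable_on_subinterval[OF c sub] in auto)
      then show ?thesis by (simp add: mult.commute)
    qed
    have "norm (integral {a..t} v) = norm (integral {a..t} (\<lambda>s. if s \<in> N then 0 else v s))"
      by (rule arg_cong[where f = norm], rule integral_spike[OF N]) auto
    also have "\<dots> \<le> integral {a..t} (\<lambda>s. c s * (1 + norm (x s)))"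
    proof (rule integral_norm_bound_integral)
      show "(\<lambda>s. if s \<in> N then 0 else v s) integrable_on {a..t}"
        by (rule integrable_spike[OF integrable_on_subinterval[OF vi sub] N]) auto
      show "norm (if s \<in> N then 0 else v s) \<le> c s * (1 + norm (x s))" if "s \<in> {a..t}" for s
        using le[of s] c0[of s] that sub by auto
    qed (use cx in \<open>simp add: absolutely_integrable_on_def\<close>)
    finally show "1 + norm (x t) \<le> (1 + norm x0) + integral {a..t} (\<lambda>s. c s * (1 + norm (x s)))"
      using x[OF t] norm_triangle_ineq[of x0 "integral {a..t} v"] by simp
  qed auto
  then show ?thesis by simp
qed

text \<open>For truncating the state: nonexpansiveness keeps Lipschitz bounds, and not increasing
  the norm keeps growth bounds.\<close>

lemma norm_closest_point_cball_0:
  fixes x :: "'a::euclidean_space"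
  assumes "0 \<le> R"
  shows "norm (closest_point (cball 0 R) x) \<le> R" "norm (closest_point (cball 0 R) x) \<le> norm x"
    "norm (closest_point (cball 0 R) x - closest_point (cball 0 R) y) \<le> norm (x - y)"
proof -
  have ne: "cball (0::'a) R \<noteq> {}" using assms by simp
  show "norm (closest_point (cball 0 R) x) \<le> R"
    using closest_point_in_set[of "cball 0 R" x] ne by simp
  have lip: "dist (closest_point (cball 0 R) x) (closest_point (cball 0 R) y) \<le> dist x y" for x y :: 'a
    by (rule closest_point_lipschitz) (use ne in auto)
  show "norm (closest_point (cball 0 R) x - closest_point (cball 0 R) y) \<le> norm (x - y)"
    using lip[of x y] by (simp add: dist_norm)
  have "closest_point (cball 0 R) (0::'a) = 0" using assms by (intro closest_point_self) simp
  then show "norm (closest_point (cball 0 R) x) \<le> norm x" using lip[of x 0] by simp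
qed

section \<open>The Bolza problem\<close>

lemma Hstar_le_iff: "Hstar H t x v \<le> ereal r \<longleftrightarrow> conj_le (H t x) v r"
  by (simp add: Hstar_def SUP_le_iff conj_le_def)

lemma Hstar_lower: "ereal (- H t x 0) \<le> Hstar H t x v"
  unfolding Hstar_def by (rule SUP_upper2[of 0]) auto

lemma Hstar_finite:
  assumes "conj_le (H t x) v r"
  obtains l where "Hstar H t x v = ereal l" "- H t x 0 \<le> l" "l \<le> r"
proof -
  have le: "Hstar H t x v \<le> ereal r" using assms by (simp add: Hstar_le_iff)
  have ge: "ereal (- H t x 0) \<le> Hstar H t x v" by (rule Hstar_lower)
  obtain l where "Hstar H t x v = ereal l" using le ge by (cases "Hstar H t x v") auto
  then show ?thesis using le ge by (intro that) auto
qed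

text \<open>A countable supremum makes the Lagrangian measurable in time along a curve.\<close>

lemma Hstar_eq_SUP_dense:
  fixes H :: "real \<Rightarrow> 'a::euclidean_space \<Rightarrow> 'a \<Rightarrow> real"
  assumes h: "continuous_on UNIV (H t x)" and d: "\<And>X. open X \<Longrightarrow> X \<noteq> {} \<Longrightarrow> \<exists>j::nat. d j \<in> X"
  shows "Hstar H t x v = (SUP j. ereal (inner v (d j) - H t x (d j)))" (is "_ = ?S")
proof (rule antisym)
  show "?S \<le> Hstar H t x v" unfolding Hstar_def by (rule SUP_least) (auto intro: SUP_upper)
  show "Hstar H t x v \<le> ?S"
  proof (cases ?S)
    case (real r)
    have "ereal (inner v (d j) - H t x (d j)) \<le> ?S" for j by (rule SUP_upper) auto
    then have le: "inner v (d j) - H t x (d j) \<le> r" for j by (simp add: real)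
    have "conj_le (H t x) v r"
    proof (rule conj_le_dense[OF h d])
      show "inner v (d j) - H t x (d j) \<le> r" for j by (rule le)
    qed
    then show ?thesis by (simp add: Hstar_le_iff real)
  next
    case MInf
    have "ereal (inner v (d 0) - H t x (d 0)) \<le> ?S" by (rule SUP_upper) auto
    then show ?thesis by (simp add: MInf)
  qed simp
qed

lemma negligible_nonzero_if_integral_nonpos:
  fixes f :: "'a::euclidean_space \<Rightarrow> real"
  assumes f: "f absolutely_integrable_on S" and S: "S \<in> sets lebesgue"
    and nonneg: "\<And>x. x \<in> S \<Longrightarrow> 0 \<le> f x" and le: "integral S f \<le> 0"
  shows "negligible {x \<in> S. f x \<noteq> 0}"
proof -
  have i: "integrable (lebesgue_on S) f" by (rule absolutely_integrable_imp_integrable[OF f S])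
  have sp: "space (lebesgue_on S) = S" by (simp add: space_restrict_space)
  have "0 \<le> integral S f"
    using f nonneg by (intro integral_nonneg) (auto simp: absolutely_integrable_on_def)
  then have "integral\<^sup>L (lebesgue_on S) f = 0"
    using le by (simp add: lebesgue_integral_eq_integral[OF i S])
  moreover have "AE x in lebesgue_on S. 0 \<le> f x" by (rule AE_I2) (simp add: sp nonneg)
  ultimately have "AE x in lebesgue_on S. f x = 0"
    using integral_nonneg_eq_0_iff_AE[OF i] by simp
  then have "AE x in lebesgue. x \<in> S \<longrightarrow> f x = 0"
    using S by (simp add: AE_restrict_space_iff)
  then obtain N where "negligible N" "{x. \<not> (x \<in> S \<longrightarrow> f x = 0)} \<subseteq> N"
    unfolding eventually_ae_filter_negligible by blast
  then show ?thesis by (auto intro: negligible_subset)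
qed

lemma absolutely_integrable_if:
  fixes f f' :: "real \<Rightarrow> 'b::euclidean_space"
  assumes "f absolutely_integrable_on {a..b}" "f' absolutely_integrable_on {a..b}"
    and G: "G \<in> sets (lebesgue_on {a..b})"
  shows "(\<lambda>t. if t \<in> G then f t else f' t) absolutely_integrable_on {a..b}"
proof (rule measurable_bounded_by_integrable_imp_absolutely_integrable)
  have [measurable]: "f \<in> borel_measurable (lebesgue_on {a..b})" "f' \<in> borel_measurable (lebesgue_on {a..b})"
    using assms(1,2) by (auto intro: absolutely_integrable_imp_borel_measurable)
  note [measurable] = G
  show "(\<lambda>t. if t \<in> G then f t else f' t) \<in> borel_measurable (lebesgue_on {a..b})" by measurable
  show "(\<lambda>t. norm (f t) + norm (f' t)) integrable_on {a..b}"
    using assms(1,2) by (intro integrable_add) (auto simp: absolutely_integrable_on_def)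
qed auto

locale bolza_problem =
  fixes H :: "real \<Rightarrow> 'a::euclidean_space \<Rightarrow> 'a \<Rightarrow> real"
    and c :: "real \<Rightarrow> real"
    and k :: "real \<Rightarrow> real \<Rightarrow> real"
    and g :: "'a \<Rightarrow> real"
    and T :: real
  assumes T_pos: "0 < T"
    and H1: "\<And>x p. (\<lambda>t. H t x p) \<in> borel_measurable (lebesgue_on {0..T})"
    and H2: "\<And>t. t \<in> {0..T} \<Longrightarrow> continuous_on UNIV (\<lambda>(x, p). H t x p)"
    and H3: "\<And>t x. t \<in> {0..T} \<Longrightarrow> convex_on UNIV (H t x)"
    and H4_c: "c absolutely_integrable_on {0..T}" "\<And>t. t \<in> {0..T} \<Longrightarrow> 0 \<le> c t"
    and H4: "\<And>t x p q. t \<in> {0..T} \<Longrightarrow>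
               \<bar>H t x p - H t x q\<bar> \<le> c t * (1 + norm x) * norm (p - q)"
    and HLC_k: "\<And>R. 0 < R \<Longrightarrow> k R absolutely_integrable_on {0..T}"
               "\<And>R t. 0 < R \<Longrightarrow> t \<in> {0..T} \<Longrightarrow> 0 \<le> k R t"
    and HLC: "\<And>R t x y p. 0 < R \<Longrightarrow> t \<in> {0..T} \<Longrightarrow> norm x \<le> R \<Longrightarrow> norm y \<le> R \<Longrightarrow>
               \<bar>H t x p - H t y p\<bar> \<le> k R t * (1 + norm p) * norm (x - y)"
    and H00: "(\<lambda>t. H t 0 0) absolutely_integrable_on {0..T}"
    and g_loclip: "\<And>z. \<exists>e>0. \<exists>L. L-lipschitz_on (ball z e) g"
begin

section \<open>Growth, integrability and measurability of the data along a curve\<close>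

lemma g_lipschitz_on_cball:
  obtains L where "0 \<le> L" "\<And>x y. norm x \<le> R \<Longrightarrow> norm y \<le> R \<Longrightarrow> \<bar>g x - g y\<bar> \<le> L * norm (x - y)"
proof -
  \<comment> \<open>Time is a dummy parameter ranging over one point. Compactness of the ball gives
    a single constant, valid for endpoints that need not be close to each other.\<close>
  have "local_lipschitz {0::real} (cball 0 R) (\<lambda>_. g)"
  proof (rule local_lipschitzI)
    fix t :: real and x :: 'a
    obtain e L where e: "e > 0" "L-lipschitz_on (ball x e) g" using g_loclip[of x] by blast
    have "L-lipschitz_on (cball x (e/2) \<inter> cball 0 R) g"
      by (rule lipschitz_on_subset[OF e(2)]) (use e(1) in auto)
    then show "\<exists>u>0. \<exists>L. \<forall>t\<in>cball t u \<inter> {0}. L-lipschitz_on (cball x u \<inter> cball 0 R) g"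
      using e(1) by (intro exI[of _ "e/2"]) auto
  qed
  then obtain L where L: "\<And>t. t \<in> {0::real} \<Longrightarrow> L-lipschitz_on (cball 0 R) g"
    by (rule local_lipschitz_compact_implies_lipschitz) (auto intro: that)
  show ?thesis
  proof (rule that[of L])
    show "0 \<le> L" using L[of 0] lipschitz_on_nonneg by auto
    fix x y :: 'a assume "norm x \<le> R" "norm y \<le> R"
    then show "\<bar>g x - g y\<bar> \<le> L * norm (x - y)"
      using lipschitz_onD[OF L[of 0], of x y] by (simp add: dist_norm)
  qed
qed

lemma abs_integrable_tail:
  "f absolutely_integrable_on {0..T} \<Longrightarrow> 0 \<le> s \<Longrightarrow> f absolutely_integrable_on {s..T}" for f :: "real \<Rightarrow> real"
  by (erule absolutely_integrable_on_subinterval) auto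

lemma H_measurable_tail: "0 \<le> s \<Longrightarrow> (\<lambda>t. H t x p) \<in> borel_measurable (lebesgue_on {s..T})"
  by (rule measurable_restrict_mono[OF H1]) auto

lemma integral_tail_le:
  fixes f :: "real \<Rightarrow> real"
  assumes "f absolutely_integrable_on {0..T}" "\<And>t. t \<in> {0..T} \<Longrightarrow> 0 \<le> f t" "0 \<le> s"
  shows "integral {s..T} f \<le> integral {0..T} f"
  using assms(3) assms(2) assms(1) abs_integrable_tail[OF assms(1,3)]
  by (intro integral_subset_le) (auto simp: absolutely_integrable_on_def)

lemma H_growth: "t \<in> {0..T} \<Longrightarrow> H t x p \<le> H t x 0 + c t * (1 + norm x) * norm p"
  and H_growth': "t \<in> {0..T} \<Longrightarrow> H t x 0 \<le> H t x p + c t * (1 + norm x) * norm p"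
  using H4[of t x p 0] by auto

lemma conj_le_norm_H:
  "t \<in> {0..T} \<Longrightarrow> conj_le (H t x) v r \<Longrightarrow> norm v \<le> c t * (1 + norm x)"
  by (rule conj_le_norm[of "H t x"]) (auto intro: H_growth intro!: mult_nonneg_nonneg H4_c(2))

text \<open>At p = 0 the factor 1 + norm p of the Lipschitz condition is 1. This explains the first
  two terms of the threshold: they dominate -H t x 0, which is at once the lower bound of the
  Lagrangian and the cost of the substitute velocity.\<close>

lemma H_section_bound:
  assumes "t \<in> {0..T}" "0 < R" "norm x \<le> R"
  shows "\<bar>H t x 0\<bar> \<le> \<bar>H t 0 0\<bar> + R * k R t"
proof -
  have "\<bar>H t x 0 - H t 0 0\<bar> \<le> k R t * (1 + norm (0::'a)) * norm (x - 0)" using assms by (intro HLC) auto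
  also have "\<dots> \<le> k R t * R" using assms HLC_k(2)[of R t] by (simp add: mult_left_mono)
  finally show ?thesis by (simp add: mult.commute)
qed

lemma H_section_integrable:
  assumes "0 \<le> s" and x: "continuous_on {s..T} x"
  shows "(\<lambda>t. H t (x t) 0) absolutely_integrable_on {s..T}"
proof -
  have "bounded (x ` {s..T})" by (intro compact_imp_bounded compact_continuous_image x) simp
  then obtain R where R: "R > 0" "\<And>t. t \<in> {s..T} \<Longrightarrow> norm (x t) \<le> R" unfolding bounded_pos by auto
  show ?thesis
  proof (rule measurable_bounded_by_integrable_imp_absolutely_integrable)
    show "(\<lambda>t. H t (x t) 0) \<in> borel_measurable (lebesgue_on {s..T})"
    proof (rule borel_measurable_caratheodory[where f = "\<lambda>t x. H t x 0"])
      show "(\<lambda>t. H t x 0) \<in> borel_measurable (lebesgue_on {s..T})" for x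
        by (rule H_measurable_tail[OF \<open>0 \<le> s\<close>])
      show "continuous_on UNIV (\<lambda>x. H t x 0)" if "t \<in> space (lebesgue_on {s..T})" for t
        by (rule continuous_on_fst_section[OF H2]) (use that \<open>0 \<le> s\<close> in \<open>auto simp: space_restrict_space\<close>)
      show "x \<in> borel_measurable (lebesgue_on {s..T})"
        by (rule continuous_imp_measurable_on_sets_lebesgue[OF x]) simp
    qed
    show "(\<lambda>t. \<bar>H t 0 0\<bar> + R * k R t) integrable_on {s..T}"
      using abs_integrable_tail[OF H00 \<open>0 \<le> s\<close>] abs_integrable_tail[OF HLC_k(1)[OF R(1)] \<open>0 \<le> s\<close>]
      by (intro integrable_add integrable_on_mult_right) (auto simp: absolutely_integrable_on_def)
    show "norm (H t (x t) 0) \<le> \<bar>H t 0 0\<bar> + R * k R t" if "t \<in> {s..T}" for t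
      using H_section_bound[of t R "x t"] R that \<open>0 \<le> s\<close> by auto
  qed simp
qed

lemma Hstar_measurable:
  assumes "0 \<le> s" and x: "continuous_on {s..T} x"
    and [measurable]: "v \<in> borel_measurable (lebesgue_on {s..T})"
  shows "(\<lambda>t. Hstar H t (x t) (v t)) \<in> borel_measurable (lebesgue_on {s..T})"
proof -
  obtain d :: "nat \<Rightarrow> 'a" where d: "\<And>X. open X \<Longrightarrow> X \<noteq> {} \<Longrightarrow> \<exists>j. d j \<in> X"
    using countable_dense_sequence by blast
  have sp: "t \<in> {0..T}" if "t \<in> space (lebesgue_on {s..T})" for t
    using that \<open>0 \<le> s\<close> by (auto simp: space_restrict_space)
  have [measurable]: "(\<lambda>t. H t (x t) p) \<in> borel_measurable (lebesgue_on {s..T})" for p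
  proof (rule borel_measurable_caratheodory[where f = "\<lambda>t x. H t x p"])
    show "(\<lambda>t. H t x p) \<in> borel_measurable (lebesgue_on {s..T})" for x
      by (rule H_measurable_tail[OF \<open>0 \<le> s\<close>])
    show "continuous_on UNIV (\<lambda>x. H t x p)" if "t \<in> space (lebesgue_on {s..T})" for t
      by (rule continuous_on_fst_section[OF H2[OF sp[OF that]]])
    show "x \<in> borel_measurable (lebesgue_on {s..T})"
      by (rule continuous_imp_measurable_on_sets_lebesgue[OF x]) simp
  qed
  have eq: "Hstar H t (x t) (v t) = (SUP j. ereal (inner (v t) (d j) - H t (x t) (d j)))"
    if "t \<in> space (lebesgue_on {s..T})" for t
  proof (rule Hstar_eq_SUP_dense[where H = H and d = d])
    show "continuous_on UNIV (H t (x t))" by (rule continuous_on_snd_section[OF H2[OF sp(1)[OF that]]])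
  qed (rule d)
  show ?thesis
    by (subst measurable_cong[OF eq]) measurable
qed

section \<open>Trajectories with prescribed velocity and cost bound\<close>

lemma Theta_le:
  assumes "0 \<le> s" "s \<le> T" and v: "v absolutely_integrable_on {s..T}"
    and y: "\<And>t. t \<in> {s..T} \<Longrightarrow> y t = y0 + integral {s..t} v"
    and \<theta>: "\<theta> absolutely_integrable_on {s..T}"
    and adm: "\<And>t. t \<in> {s..T} \<Longrightarrow> conj_le (H t (y t)) (v t) (\<theta> t)"
  shows "Theta H g T s y \<le> ereal (g (y T) + integral {s..T} \<theta>)"
proof -
  have vi: "v integrable_on {s..T}" using v by (simp add: absolutely_integrable_on_def)
  have "continuous_on {s..T} (\<lambda>t. y0 + integral {s..t} v)"
    by (intro continuous_intros indefinite_integral_continuous_1 vi)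
  then have y_cont: "continuous_on {s..T} y" by (rule continuous_on_eq) (simp add: y)
  obtain N where N: "negligible N" "\<And>t. t \<in> {s..T} - N \<Longrightarrow> (y has_vector_derivative v t) (at t)"
      "\<And>t. t \<in> {s..T} - N \<Longrightarrow> vector_derivative y (at t) = v t"
    by (rule vector_derivative_integral_ae[OF v]) (rule y, simp, rule that)
  define f where "f t = Hstar H t (y t) (vector_derivative y (at t))" for t
  \<comment> \<open>Squeezed between - H t (y t) 0 and \<theta> t, the Lagrangian is finite almost
    everywhere and, once measurable, integrable. So \<open>Theta\<close> takes its finite
    branch.\<close>
  have fin: "\<exists>l. f t = ereal l \<and> - H t (y t) 0 \<le> l \<and> l \<le> \<theta> t" if "t \<in> {s..T} - N" for t
  proof -
    have "conj_le (H t (y t)) (vector_derivative y (at t)) (\<theta> t)" using adm[of t] N(3)[OF that] that by simp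
    then obtain l where "Hstar H t (y t) (vector_derivative y (at t)) = ereal l" "- H t (y t) 0 \<le> l" "l \<le> \<theta> t"
      by (rule Hstar_finite[of H t "y t" "vector_derivative y (at t)" "\<theta> t"]) (rule that)
    then show ?thesis unfolding f_def by simp
  qed
  define l where "l t = real_of_ereal (f t)" for t
  have l: "f t = ereal (l t)" "- H t (y t) 0 \<le> l t" "l t \<le> \<theta> t" if "t \<in> {s..T} - N" for t
    using fin[OF that] by (auto simp: l_def)
  \<comment> \<open>Measurability and integrability are shown with v in place of the derivative and
    transferred afterwards across the null set N.\<close>
  have "(\<lambda>t. Hstar H t (y t) (v t)) \<in> borel_measurable (lebesgue_on {s..T})"
    by (rule Hstar_measurable[OF \<open>0 \<le> s\<close> y_cont absolutely_integrable_imp_borel_measurable[OF v]]) simp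
  then have m: "(\<lambda>t. real_of_ereal (Hstar H t (y t) (v t))) \<in> borel_measurable (lebesgue_on {s..T})" by measurable
  have "(\<lambda>t. real_of_ereal (Hstar H t (y t) (v t))) absolutely_integrable_on {s..T}"
  proof (rule measurable_bounded_by_integrable_imp_absolutely_integrable[OF m])
    show "(\<lambda>t. \<bar>\<theta> t\<bar> + \<bar>H t (y t) 0\<bar>) integrable_on {s..T}"
      using \<theta> H_section_integrable[OF \<open>0 \<le> s\<close> y_cont]
      by (intro integrable_add) (auto simp: absolutely_integrable_on_def)
    show "norm (real_of_ereal (Hstar H t (y t) (v t))) \<le> \<bar>\<theta> t\<bar> + \<bar>H t (y t) 0\<bar>" if t: "t \<in> {s..T}" for t
    proof -
      obtain r where "Hstar H t (y t) (v t) = ereal r" "- H t (y t) 0 \<le> r" "r \<le> \<theta> t"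
        using adm[OF t] by (rule Hstar_finite[of H t "y t" "v t" "\<theta> t"]) (rule that)
      then show ?thesis by auto
    qed
  qed simp
  then have l_abs: "l absolutely_integrable_on {s..T}"
    by (rule absolutely_integrable_spike[OF _ N(1)]) (simp add: l_def f_def N(3))
  have "AE t in lebesgue. t \<in> {s..T} \<longrightarrow> \<bar>f t\<bar> \<noteq> \<infinity>"
    unfolding eventually_ae_filter_negligible
    by (intro exI[of _ N] conjI N(1)) (use l(1) in force)
  then have "Theta H g T s y = ereal (g (y T) + integral {s..T} l)"
    using l_abs by (simp add: Theta_def f_def[symmetric] l_def[symmetric])
  moreover have "integral {s..T} l \<le> integral {s..T} \<theta>"
  proof -
    have "integral {s..T} l = integral {s..T} (\<lambda>t. if t \<in> N then \<theta> t else l t)"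
      by (rule integral_spike[OF N(1)]) simp
    also have "\<dots> \<le> integral {s..T} \<theta>"
    proof (rule integral_le)
      show "(\<lambda>t. if t \<in> N then \<theta> t else l t) integrable_on {s..T}"
        by (rule integrable_spike[OF _ N(1), of l]) (use l_abs in \<open>auto simp: absolutely_integrable_on_def\<close>)
    qed (use \<theta> l(3) in \<open>auto simp: absolutely_integrable_on_def\<close>)
    finally show ?thesis .
  qed
  ultimately show ?thesis by simp
qed

text \<open>These are the substitute velocities, of least possible Lagrangian at each point of the
  curve. Linear growth bounds them, which supplies the distance constraint, taken from the zero
  field, in the selection.\<close>

lemma subgradient_selection:
  assumes "0 \<le> s" and x: "continuous_on {s..T} x"
  obtains w where "w absolutely_integrable_on {s..T}"
    "\<And>t. t \<in> {s..T} \<Longrightarrow> conj_le (H t (x t)) (w t) (- H t (x t) 0)"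
proof -
  let ?M = "lebesgue_on {s..T}"
  have sp: "t \<in> {0..T}" "t \<in> {s..T}" if "t \<in> space ?M" for t
    using that \<open>0 \<le> s\<close> by (auto simp: space_restrict_space)
  have xm [measurable]: "x \<in> borel_measurable ?M" by (rule continuous_imp_measurable_on_sets_lebesgue[OF x]) simp
  have cm [measurable]: "c \<in> borel_measurable ?M"
    by (rule absolutely_integrable_imp_borel_measurable[OF abs_integrable_tail[OF H4_c(1) \<open>0 \<le> s\<close>]]) simp
  have H0m: "(\<lambda>t. - H t (x t) 0) \<in> borel_measurable ?M"
    using absolutely_integrable_imp_borel_measurable[OF H_section_integrable[OF assms]] by simp
  have em: "(\<lambda>t. c t * (1 + norm (x t))) \<in> borel_measurable ?M" by measurable
  have ex: "\<exists>v. norm (v - 0) \<le> c t * (1 + norm (x t)) \<and> conj_le (H t (x t)) v (- H t (x t) 0)"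
    if "t \<in> space ?M" for t
  proof -
    have t: "t \<in> {0..T}" by (rule sp(1)[OF that])
    obtain v where "conj_le (H t (x t)) v (- H t (x t) 0)"
      using conj_le_subgradient[OF H3[OF t] _ H_growth'[OF t]] H4_c(2)[OF t]
      by (metis add_nonneg_nonneg mult_nonneg_nonneg norm_ge_zero zero_le_one)
    then show ?thesis using conj_le_norm_H[OF t] by auto
  qed
  obtain w where w: "w \<in> borel_measurable ?M"
    "\<And>t. t \<in> space ?M \<Longrightarrow> norm (w t - 0) \<le> c t * (1 + norm (x t)) \<and> conj_le (H t (x t)) (w t) (- H t (x t) 0)"
    by (rule conj_le_selection[OF H_measurable_tail[OF \<open>0 \<le> s\<close>] _ xm _ H0m em ex])
      (rule H2[OF sp(1)], assumption, simp, assumption, rule that)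
  have "w absolutely_integrable_on {s..T}"
  proof (rule measurable_bounded_by_integrable_imp_absolutely_integrable[OF w(1)])
    have "(\<lambda>t. (1 + norm (x t)) * c t) absolutely_integrable_on {s..T}"
    proof (rule absolutely_integrable_bounded_measurable_product_real)
      have "continuous_on {s..T} (\<lambda>t. 1 + norm (x t))" by (intro continuous_intros x)
      then show "bounded ((\<lambda>t. 1 + norm (x t)) ` {s..T})"
        by (intro compact_imp_bounded compact_continuous_image) auto
    qed (use abs_integrable_tail[OF H4_c(1) \<open>0 \<le> s\<close>] in auto)
    then show "(\<lambda>t. c t * (1 + norm (x t))) integrable_on {s..T}"
      by (simp add: mult.commute absolutely_integrable_on_def)
    show "norm (w t) \<le> c t * (1 + norm (x t))" if "t \<in> {s..T}" for t
      using w(2)[of t] that by (simp add: space_restrict_space)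
  qed simp
  then show ?thesis using w(2) by (intro that) (auto simp: space_restrict_space)
qed

text \<open>The constant of \<open>linear_growth_bound\<close> for initial states in the ball of
  radius M, with c integrated over all of [0, T] so that it serves every initial time.\<close>

definition radius :: "real \<Rightarrow> real" where
  "radius M = 2 * (1 + M) * exp (2 * integral {0..T} c)"

lemma radius_ge: "0 < M \<Longrightarrow> M \<le> radius M" "0 < M \<Longrightarrow> 0 < radius M"
proof -
  have "0 \<le> integral {0..T} c" using H4_c by (intro integral_nonneg) (auto simp: absolutely_integrable_on_def)
  then have "1 \<le> exp (2 * integral {0..T} c)" by simp
  then have "2 * (1 + M) * 1 \<le> radius M" if "0 < M" unfolding radius_def using that by (intro mult_left_mono) auto
  then show "0 < M \<Longrightarrow> M \<le> radius M" "0 < M \<Longrightarrow> 0 < radius M" by force+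
qed

lemma trajectory_bound:
  fixes x v :: "real \<Rightarrow> 'a"
  assumes "0 \<le> s" "s \<le> T" and v: "v absolutely_integrable_on {s..T}"
    and x: "\<And>t. t \<in> {s..T} \<Longrightarrow> x t = x0 + integral {s..t} v" and "norm x0 \<le> M"
    and N: "negligible N" and le: "\<And>t. t \<in> {s..T} - N \<Longrightarrow> norm (v t) \<le> c t * (1 + norm (x t))"
    and t: "t \<in> {s..T}"
  shows "norm (x t) \<le> radius M"
proof -
  have c0: "0 \<le> c t" if "t \<in> {s..T}" for t using that \<open>0 \<le> s\<close> H4_c(2) by auto
  have "norm (x t) \<le> 2 * (1 + norm x0) * exp (2 * integral {s..T} c)"
    using \<open>s \<le> T\<close> abs_integrable_tail[OF H4_c(1) \<open>0 \<le> s\<close>] c0 v x N le t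
    by (rule linear_growth_bound[where x = x and v = v and c = c and a = s and b = T and N = N])
  also have "\<dots> \<le> radius M"
    unfolding radius_def
  proof (rule mult_mono)
    show "0 \<le> 2 * (1 + M)" using order_trans[OF norm_ge_zero \<open>norm x0 \<le> M\<close>] by simp
  qed (use integral_tail_le[OF H4_c \<open>0 \<le> s\<close>] \<open>norm x0 \<le> M\<close> in auto)
  finally show ?thesis .
qed

text \<open>The competitor is a trajectory of the Hamiltonian truncated at \<open>radius M\<close>, for which the
  Lipschitz constant is global; by Gronwall it never leaves the region where the truncation is vacuous.\<close>
lemma competitor:
  assumes "0 < M" "0 \<le> s" "s \<le> T" "norm x0 \<le> M"
    and \<zeta>: "\<zeta> absolutely_integrable_on {s..T}"
    and z: "\<And>t. t \<in> {s..T} \<Longrightarrow> z t = x0 + integral {s..t} \<zeta>" and z_bd: "\<And>t. t \<in> {s..T} \<Longrightarrow> norm (z t) \<le> radius M"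
    and w: "w absolutely_integrable_on {s..T}" and \<eta>: "\<eta> absolutely_integrable_on {s..T}"
    and adm: "\<And>t. t \<in> {s..T} \<Longrightarrow> conj_le (H t (z t)) (w t) (\<eta> t)"
    and K: "K = 2 * exp (2 * integral {0..T} (k (radius M)))"
    and \<Gamma>: "\<Gamma> = integral {s..T} (\<lambda>t. norm (w t - \<zeta> t))"
  obtains y where "abs_continuous_on s T y" "y s = x0" "norm (y T) \<le> radius M" "norm (y T - z T) \<le> K * \<Gamma>"
    "Theta H g T s y \<le> ereal (g (y T) + integral {s..T} \<eta> + K * \<Gamma> * integral {0..T} (k (radius M)))"
proof -
  define R where "R = radius M"
  have R: "R > 0" "M \<le> R" using radius_ge[OF \<open>0 < M\<close>] by (auto simp: R_def)
  define \<pi> :: "'a \<Rightarrow> 'a" where "\<pi> = closest_point (cball 0 R)"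
  have \<pi>: "norm (\<pi> x) \<le> R" "norm (\<pi> x) \<le> norm x" "norm (\<pi> x - \<pi> y) \<le> norm (x - y)" for x y
    using norm_closest_point_cball_0[of R x] norm_closest_point_cball_0(3)[of R x y] R(1) by (auto simp: \<pi>_def)
  have \<pi>_id: "\<pi> x = x" if "norm x \<le> R" for x using that by (simp add: \<pi>_def closest_point_self)
  have \<pi>_cont: "continuous_on UNIV \<pi>"
    unfolding \<pi>_def by (rule continuous_on_closest_point) (use R(1) in auto)
  define h where "h t x p = H t (\<pi> x) p" for t x p
  have in0: "t \<in> {0..T}" if "t \<in> {s..T}" for t using that \<open>0 \<le> s\<close> by auto
  have kR: "k R absolutely_integrable_on {s..T}" by (rule abs_integrable_tail[OF HLC_k(1)[OF R(1)] \<open>0 \<le> s\<close>])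
  have \<zeta>i: "\<zeta> integrable_on {s..T}" using \<zeta> by (simp add: absolutely_integrable_on_def)
  have z_cont: "continuous_on {s..T} z"
  proof (rule continuous_on_eq)
    show "continuous_on {s..T} (\<lambda>t. x0 + integral {s..t} \<zeta>)"
      by (intro continuous_intros indefinite_integral_continuous_1 \<zeta>i)
  qed (simp add: z)
  have "(\<lambda>t. w t - \<zeta> t) absolutely_integrable_on {s..T}" by (intro set_integral_diff(1) w \<zeta>)
  then have "\<Gamma> \<ge> 0" unfolding \<Gamma> by (intro integral_nonneg) (auto simp: absolutely_integrable_on_def)
  have K0: "K > 0" by (simp add: K)
  \<comment> \<open>Passing to the integral over [0, T] makes K and the cost bound independent of
    the initial time s.\<close>
  have kint: "integral {s..T} (k R) \<le> integral {0..T} (k R)"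
    by (rule integral_tail_le[OF HLC_k(1)[OF R(1)] HLC_k(2)[OF R(1)] \<open>0 \<le> s\<close>])
  obtain v where v: "v absolutely_integrable_on {s..T}"
    "\<And>t. t \<in> {s..T} \<Longrightarrow> conj_le (h t (x0 + integral {s..t} v)) (v t) (\<eta> t + k R t * (K * \<Gamma>))"
    "\<And>t. t \<in> {s..T} \<Longrightarrow> norm (x0 + integral {s..t} v - z t) \<le> K * \<Gamma>"
  proof (rule filippov[where h = h and k = "k R" and z = z and \<zeta> = \<zeta> and w = w and \<eta> = \<eta> and a = s and b = T and K = K and \<Gamma> = \<Gamma> and ?x0.0 = x0])
    show "s \<le> T" by fact
    show "(\<lambda>t. h t x p) \<in> borel_measurable (lebesgue_on {s..T})" for x p
      unfolding h_def by (rule H_measurable_tail[OF \<open>0 \<le> s\<close>])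
    show "continuous_on UNIV (\<lambda>(x, p). h t x p)" if "t \<in> {s..T}" for t
    proof -
      have "continuous_on UNIV ((\<lambda>(x, p). H t x p) \<circ> (\<lambda>q. (\<pi> (fst q), snd q)))"
        by (intro continuous_on_compose continuous_on_subset[OF H2[OF in0[OF that]]] continuous_intros
            continuous_on_compose2[OF \<pi>_cont]) auto
      then show ?thesis by (simp add: h_def o_def case_prod_unfold)
    qed
    show "convex_on UNIV (h t x)" if "t \<in> {s..T}" for t x
      using H3[OF in0[OF that]] by (simp add: h_def[abs_def])
    show "\<bar>h t x p - h t y p\<bar> \<le> k R t * (1 + norm p) * norm (x - y)" if "t \<in> {s..T}" for t x y p
    proof -
      have "\<bar>h t x p - h t y p\<bar> \<le> k R t * (1 + norm p) * norm (\<pi> x - \<pi> y)"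
        unfolding h_def by (intro HLC R(1) in0 that \<pi>(1))
      also have "\<dots> \<le> k R t * (1 + norm p) * norm (x - y)"
        using HLC_k(2)[OF R(1) in0[OF that]] by (intro mult_left_mono \<pi>(3)) auto
      finally show ?thesis .
    qed
    show "\<eta> \<in> borel_measurable (lebesgue_on {s..T})" by (rule absolutely_integrable_imp_borel_measurable[OF \<eta>]) simp
    show "conj_le (h t (z t)) (w t) (\<eta> t)" if "t \<in> {s..T}" for t
      using adm[OF that] z_bd[OF that] by (simp add: h_def[abs_def] \<pi>_id R_def)
    show "2 * exp (2 * integral {s..T} (k R)) \<le> K" using kint by (simp add: K R_def)
  qed (use kR HLC_k(2)[OF R(1)] in0 z_cont z \<zeta> w \<Gamma> in \<open>auto intro: that\<close>)
  define y where "y t = x0 + integral {s..t} v" for t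
  have y_bd: "norm (y t) \<le> R" if "t \<in> {s..T}" for t
    unfolding R_def
  proof (rule trajectory_bound[OF \<open>0 \<le> s\<close> \<open>s \<le> T\<close> v(1) y_def \<open>norm x0 \<le> M\<close> negligible_empty _ that])
    fix t assume "t \<in> {s..T} - {}"
    then have t: "t \<in> {s..T}" by simp
    have "norm (v t) \<le> c t * (1 + norm (\<pi> (y t)))"
      using v(2)[OF t] by (intro conj_le_norm_H[OF in0[OF t]]) (simp add: h_def[abs_def] y_def)
    also have "\<dots> \<le> c t * (1 + norm (y t))" using H4_c(2)[OF in0[OF t]] \<pi>(2)[of "y t"] by (intro mult_left_mono) auto
    finally show "norm (v t) \<le> c t * (1 + norm (y t))" .
  qed
  have cle: "conj_le (H t (y t)) (v t) (\<eta> t + K * \<Gamma> * k R t)" if "t \<in> {s..T}" for t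
    using v(2)[OF that] \<pi>_id[OF y_bd[OF that]] by (simp add: h_def[abs_def] y_def[symmetric] mult.commute)
  have K\<Gamma>k: "(\<lambda>t. K * \<Gamma> * k R t) absolutely_integrable_on {s..T}"
    using absolutely_integrable_scaleR_left[OF kR, of "K * \<Gamma>"] by simp
  have "Theta H g T s y \<le> ereal (g (y T) + integral {s..T} (\<lambda>t. \<eta> t + K * \<Gamma> * k R t))"
    by (rule Theta_le[OF \<open>0 \<le> s\<close> \<open>s \<le> T\<close> v(1) y_def set_integral_add(1)[OF \<eta> K\<Gamma>k] cle])
  also have "integral {s..T} (\<lambda>t. \<eta> t + K * \<Gamma> * k R t) = integral {s..T} \<eta> + K * \<Gamma> * integral {s..T} (k R)"
    using \<eta> K\<Gamma>k by (subst Henstock_Kurzweil_Integration.integral_add) (auto simp: absolutely_integrable_on_def)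
  also have "ereal (g (y T) + (integral {s..T} \<eta> + K * \<Gamma> * integral {s..T} (k R)))
      \<le> ereal (g (y T) + integral {s..T} \<eta> + K * \<Gamma> * integral {0..T} (k R))"
    using mult_left_mono[OF kint, of "K * \<Gamma>"] K0 \<open>\<Gamma> \<ge> 0\<close> by simp
  finally have Th: "Theta H g T s y \<le> ereal (g (y T) + integral {s..T} \<eta> + K * \<Gamma> * integral {0..T} (k R))" .
  show ?thesis
  proof (rule that[of y])
    show "abs_continuous_on s T y" unfolding y_def[abs_def] by (rule abs_continuous_on_integral[OF v(1)])
    show "y s = x0" by (simp add: y_def)
    show "norm (y T - z T) \<le> K * \<Gamma>" using v(3)[of T] \<open>s \<le> T\<close> by (simp add: y_def)
  qed (use Th y_bd[of T] \<open>s \<le> T\<close> in \<open>auto simp: R_def\<close>)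
qed

section \<open>Minimizers\<close>

lemma minimizer_Theta_finite:
  assumes "0 < M" "0 \<le> s" "s \<le> T" "norm x0 \<le> M" and min: "is_minimizer H g T s x0 x"
  shows "Theta H g T s x < \<infinity>"
proof -
  \<comment> \<open>\<open>Theta\<close> is infinite when the cost is not integrable, and a
    comparison of infinite values would say nothing. A competitor of finite cost is generated from
    the constant curve at x0 with a subgradient field along it; the constant curve itself may have
    infinite cost, as velocity 0 may be inadmissible.\<close>
  obtain w where w: "w absolutely_integrable_on {s..T}"
    "\<And>t. t \<in> {s..T} \<Longrightarrow> conj_le (H t x0) (w t) (- H t x0 0)"
    by (rule subgradient_selection[OF \<open>0 \<le> s\<close> continuous_on_const[of _ x0]]) (rule that)
  have \<eta>: "(\<lambda>t. - H t x0 0) absolutely_integrable_on {s..T}"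
    using absolutely_integrable_scaleR_left[OF H_section_integrable[OF \<open>0 \<le> s\<close> continuous_on_const[of _ x0]], of "-1"]
    by simp
  obtain y r where "abs_continuous_on s T y" "y s = x0" "Theta H g T s y \<le> ereal r"
  proof (rule competitor[OF assms(1-4) _ _ _ w(1) \<eta> w(2) refl refl])
    show "(\<lambda>t. 0) absolutely_integrable_on {s..T}" by simp
    show "norm x0 \<le> radius M" using radius_ge(1)[OF \<open>0 < M\<close>] \<open>norm x0 \<le> M\<close> by linarith
  qed (auto intro: that)
  moreover from this have "Theta H g T s x \<le> Theta H g T s y" using min by (simp add: is_minimizer_def)
  ultimately have "Theta H g T s x \<le> ereal r" by (blast intro: order_trans)
  then show ?thesis by auto
qed

text \<open>Finite cost forces a finite Lagrangian almost everywhere, hence the linear velocity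
  bound, hence confinement by Gronwall's inequality.\<close>

lemma minimizer_properties:
  assumes "0 < M" "0 \<le> s" "s \<le> T" "norm x0 \<le> M" and min: "is_minimizer H g T s x0 x"
  obtains N f where "negligible N"
    "\<And>t. t \<in> {s..T} - N \<Longrightarrow> Hstar H t (x t) (vector_derivative x (at t)) = ereal (f t)"
    "f absolutely_integrable_on {s..T}"
    "Theta H g T s x = ereal (g (x T) + integral {s..T} f)"
    "\<And>t. t \<in> {s..T} \<Longrightarrow> norm (x t) \<le> radius M"
    "(\<lambda>t. vector_derivative x (at t)) absolutely_integrable_on {s..T}"
    "\<And>t. t \<in> {s..T} \<Longrightarrow> x t = x0 + integral {s..t} (\<lambda>t. vector_derivative x (at t))"
proof -
  have ac: "abs_continuous_on s T x" and "x s = x0" using min by (auto simp: is_minimizer_def)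
  note vd = abs_continuous_on_vector_derivative[OF ac \<open>s \<le> T\<close>]
  define f where "f t = real_of_ereal (Hstar H t (x t) (vector_derivative x (at t)))" for t
  have fin: "Theta H g T s x < \<infinity>" by (rule minimizer_Theta_finite[OF assms])
  then have ae: "AE t in lebesgue. t \<in> {s..T} \<longrightarrow> \<bar>Hstar H t (x t) (vector_derivative x (at t))\<bar> \<noteq> \<infinity>"
    and f: "f absolutely_integrable_on {s..T}"
    unfolding Theta_def f_def Let_def by (auto split: if_splits)
  have Th: "Theta H g T s x = ereal (g (x T) + integral {s..T} f)"
    using ae f by (simp add: Theta_def f_def[abs_def])
  obtain N where N: "negligible N"
    "{t. \<not> (t \<in> {s..T} \<longrightarrow> \<bar>Hstar H t (x t) (vector_derivative x (at t))\<bar> \<noteq> \<infinity>)} \<subseteq> N"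
    using ae unfolding eventually_ae_filter_negligible by blast
  have Hs: "Hstar H t (x t) (vector_derivative x (at t)) = ereal (f t)" if "t \<in> {s..T} - N" for t
    using N(2) that unfolding f_def by (subst ereal_real) auto
  have x: "x t = x0 + integral {s..t} (\<lambda>t. vector_derivative x (at t))" if "t \<in> {s..T}" for t
    using vd(2)[of t] that \<open>x s = x0\<close> by simp
  have bd: "norm (x t) \<le> radius M" if "t \<in> {s..T}" for t
  proof (rule trajectory_bound[OF \<open>0 \<le> s\<close> \<open>s \<le> T\<close> vd(1) x \<open>norm x0 \<le> M\<close> N(1) _ that])
    fix t assume t: "t \<in> {s..T} - N"
    have "conj_le (H t (x t)) (vector_derivative x (at t)) (f t)" using Hs[OF t] by (simp flip: Hstar_le_iff)
    then show "norm (vector_derivative x (at t)) \<le> c t * (1 + norm (x t))"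
      using t \<open>0 \<le> s\<close> by (intro conj_le_norm_H) auto
  qed
  show ?thesis by (rule that[OF N(1) Hs f Th bd vd(1) x])
qed

text \<open>C is fixed before the initial time, the initial state and the minimizer. It is therefore
  built only from the radius, the integral of \<open>k (radius M)\<close> and a Lipschitz constant
  of g on the confining ball.\<close>

lemma minimizer_velocity_bound:
  assumes "0 < M"
  obtains C where "\<And>s x0 x. s \<in> {0..T} \<Longrightarrow> norm x0 \<le> M \<Longrightarrow> is_minimizer H g T s x0 x \<Longrightarrow>
    velocity_bound H T s x (\<lambda>t. \<bar>H t 0 0\<bar> + radius M * k (radius M) t + C * c t)"
proof -
  define R where "R = radius M"
  have R: "R > 0" using radius_ge[OF \<open>0 < M\<close>] by (simp add: R_def)
  obtain L where L: "0 \<le> L" "\<And>x y. norm x \<le> R \<Longrightarrow> norm y \<le> R \<Longrightarrow> \<bar>g x - g y\<bar> \<le> L * norm (x - y)"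
    by (rule g_lipschitz_on_cball[of R]) (rule that)
  define K where "K = 2 * exp (2 * integral {0..T} (k (radius M)))"
  \<comment> \<open>A field at integral distance \<Gamma> from the velocity of x yields a competitor
    with endpoint displaced by at most K * \<Gamma>. The terminal cost then rises by at most L * K *
    \<Gamma> and the running cost by at most K * \<Gamma> times the integral of k R; B adds the two
    rates.\<close>
  define B where "B = K * (L + integral {0..T} (k R))"
  have kint: "0 \<le> integral {0..T} (k R)"
    using HLC_k[OF R] by (intro integral_nonneg) (auto simp: absolutely_integrable_on_def)
  have "K > 0" by (simp add: K_def)
  have "B \<ge> 0" using L(1) kint \<open>K > 0\<close> by (simp add: B_def)
  \<comment> \<open>The first two terms dominate the cost of the substitute velocity, and the last
    is B times the largest possible change of velocity. Above this threshold the replacement saves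
    strictly more than its correction can cost.\<close>
  define \<mu> where "\<mu> t = \<bar>H t 0 0\<bar> + R * k R t + 2 * B * (1 + R) * c t" for t
  have main: "velocity_bound H T s x (\<lambda>t. \<bar>H t 0 0\<bar> + R * k R t + (1 + R) * (1 + 2 * B) * c t)"
    if "s \<in> {0..T}" and "norm x0 \<le> M" and min: "is_minimizer H g T s x0 x" for s x0 x
  proof -
    have s: "0 \<le> s" "s \<le> T" using \<open>s \<in> {0..T}\<close> by auto
    have in0: "t \<in> {0..T}" if "t \<in> {s..T}" for t using that s by auto
    let ?x' = "\<lambda>t. vector_derivative x (at t)"
    obtain N f where N: "negligible N"
      and Hs: "\<And>t. t \<in> {s..T} - N \<Longrightarrow> Hstar H t (x t) (?x' t) = ereal (f t)"
      and f: "f absolutely_integrable_on {s..T}"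
      and Th: "Theta H g T s x = ereal (g (x T) + integral {s..T} f)"
      and bd: "\<And>t. t \<in> {s..T} \<Longrightarrow> norm (x t) \<le> radius M"
      and x': "?x' absolutely_integrable_on {s..T}"
      and x: "\<And>t. t \<in> {s..T} \<Longrightarrow> x t = x0 + integral {s..t} ?x'"
      by (rule minimizer_properties[OF \<open>0 < M\<close> s \<open>norm x0 \<le> M\<close> min]) (rule that)
    have x_cont: "continuous_on {s..T} x"
      using min by (intro abs_continuous_on_imp_continuous_on) (simp add: is_minimizer_def)
    have cle: "conj_le (H t (x t)) (?x' t) (f t)" if "t \<in> {s..T} - N" for t
      using Hs[OF that] by (simp flip: Hstar_le_iff)
    have f_low: "- H t (x t) 0 \<le> f t" if "t \<in> {s..T} - N" for t by (rule conj_le_lower[OF cle[OF that]])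
    have H0: "\<bar>H t (x t) 0\<bar> \<le> \<bar>H t 0 0\<bar> + R * k R t" if "t \<in> {s..T}" for t
      using H_section_bound[OF in0[OF that] R] bd[OF that] by (simp add: R_def)
    have speed: "norm v \<le> (1 + R) * c t" if t: "t \<in> {s..T}" and "conj_le (H t (x t)) v r" for t v r
    proof -
      have "norm v \<le> c t * (1 + norm (x t))" by (rule conj_le_norm_H[OF in0[OF t] \<open>conj_le _ v r\<close>])
      also have "\<dots> \<le> c t * (1 + R)" using bd[OF t] H4_c(2)[OF in0[OF t]] by (intro mult_left_mono) (auto simp: R_def)
      finally show ?thesis by (simp add: mult.commute)
    qed
    obtain w0 where w0: "w0 absolutely_integrable_on {s..T}"
      "\<And>t. t \<in> {s..T} \<Longrightarrow> conj_le (H t (x t)) (w0 t) (- H t (x t) 0)"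
      by (rule subgradient_selection[OF s(1) x_cont]) (rule that)
    have H0_abs: "(\<lambda>t. H t (x t) 0) absolutely_integrable_on {s..T}" by (rule H_section_integrable[OF s(1) x_cont])
    then have mH0: "(\<lambda>t. - H t (x t) 0) absolutely_integrable_on {s..T}"
      using absolutely_integrable_scaleR_left[OF H0_abs, of "-1"] by simp
    have c_abs: "(\<lambda>t. a * c t) absolutely_integrable_on {s..T}" for a
      using absolutely_integrable_scaleR_left[OF abs_integrable_tail[OF H4_c(1) s(1)], of a] by simp
    \<comment> \<open>N is removed so that on G the Lagrangian is f and the velocity of x is
      admissible with that cost.\<close>
    define G where "G = {t \<in> {s..T}. f t \<le> \<mu> t} - N"
    have G: "G \<in> sets (lebesgue_on {s..T})"
    proof -
      have [measurable]: "f \<in> borel_measurable (lebesgue_on {s..T})"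
        by (rule absolutely_integrable_imp_borel_measurable[OF f]) simp
      have [measurable]: "c \<in> borel_measurable (lebesgue_on {s..T})"
        by (rule absolutely_integrable_imp_borel_measurable[OF abs_integrable_tail[OF H4_c(1) s(1)]]) simp
      have [measurable]: "k R \<in> borel_measurable (lebesgue_on {s..T})"
        by (rule absolutely_integrable_imp_borel_measurable[OF abs_integrable_tail[OF HLC_k(1)[OF R] s(1)]]) simp
      have [measurable]: "(\<lambda>t. H t 0 0) \<in> borel_measurable (lebesgue_on {s..T})"
        by (rule H_measurable_tail[OF s(1)])
      have "{t \<in> space (lebesgue_on {s..T}). f t \<le> \<mu> t} \<in> sets (lebesgue_on {s..T})"
        unfolding \<mu>_def by measurable
      moreover have "N \<inter> {s..T} \<in> sets (lebesgue_on {s..T})"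
        using N by (auto simp: sets_restrict_space negligible_imp_sets)
      ultimately have "{t \<in> space (lebesgue_on {s..T}). f t \<le> \<mu> t} - N \<inter> {s..T} \<in> sets (lebesgue_on {s..T})"
        by (rule sets.Diff)
      also have "{t \<in> space (lebesgue_on {s..T}). f t \<le> \<mu> t} - N \<inter> {s..T} = G"
        by (auto simp: G_def space_restrict_space)
      finally show ?thesis .
    qed
    define w where "w t = (if t \<in> G then ?x' t else w0 t)" for t
    define \<eta> where "\<eta> t = (if t \<in> G then f t else - H t (x t) 0)" for t
    define q where "q t = (if t \<in> G then 0 else 2 * (1 + R) * c t)" for t
    have w: "w absolutely_integrable_on {s..T}" unfolding w_def[abs_def] by (rule absolutely_integrable_if[OF x' w0(1) G])
    have \<eta>: "\<eta> absolutely_integrable_on {s..T}" unfolding \<eta>_def[abs_def] by (rule absolutely_integrable_if[OF f mH0 G])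
    have q: "q absolutely_integrable_on {s..T}"
      unfolding q_def[abs_def] using c_abs by (intro absolutely_integrable_if[OF _ _ G]) simp_all
    have adm: "conj_le (H t (x t)) (w t) (\<eta> t)" if "t \<in> {s..T}" for t
      using that cle[of t] w0(2)[of t] by (auto simp: w_def \<eta>_def G_def)
    define \<Gamma> where "\<Gamma> = integral {s..T} (\<lambda>t. norm (w t - ?x' t))"
    have \<Gamma>_le: "\<Gamma> \<le> integral {s..T} q"
    proof -
      have i: "(\<lambda>t. norm (w t - ?x' t)) integrable_on {s..T}"
        using set_integral_diff(1)[OF w x'] by (simp add: absolutely_integrable_on_def)
      \<comment> \<open>On N the derivative of x is uncontrolled, so the integrand is replaced there
        before the pointwise comparison. Elsewhere outside G both velocities obey
        \<open>speed\<close>.\<close>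
      have "\<Gamma> = integral {s..T} (\<lambda>t. if t \<in> N then q t else norm (w t - ?x' t))"
        unfolding \<Gamma>_def by (rule integral_spike[OF N]) simp
      also have "\<dots> \<le> integral {s..T} q"
      proof (rule integral_le)
        show "(\<lambda>t. if t \<in> N then q t else norm (w t - ?x' t)) integrable_on {s..T}"
          by (rule integrable_spike[OF i N]) simp
        show "q integrable_on {s..T}" using q by (simp add: absolutely_integrable_on_def)
        fix t assume t: "t \<in> {s..T}"
        show "(if t \<in> N then q t else norm (w t - ?x' t)) \<le> q t"
        proof (cases "t \<in> N \<or> t \<in> G")
          case False
          then have "norm (w0 t) \<le> (1 + R) * c t" "norm (?x' t) \<le> (1 + R) * c t"
            using speed[OF t w0(2)[OF t]] speed[OF t cle[of t]] t by auto
          then show ?thesis using False norm_triangle_ineq4[of "w0 t" "?x' t"] by (simp add: w_def q_def algebra_simps)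
        qed (auto simp: w_def q_def)
      qed
      finally show ?thesis .
    qed
    obtain y where y: "abs_continuous_on s T y" "y s = x0" "norm (y T) \<le> radius M" "norm (y T - x T) \<le> K * \<Gamma>"
      "Theta H g T s y \<le> ereal (g (y T) + integral {s..T} \<eta> + K * \<Gamma> * integral {0..T} (k (radius M)))"
      by (rule competitor[OF \<open>0 < M\<close> s \<open>norm x0 \<le> M\<close> x' x bd w \<eta> adm K_def \<Gamma>_def]) (assumption | rule that)+
    have "Theta H g T s x \<le> Theta H g T s y" using min y(1,2) by (simp add: is_minimizer_def)
    then have "ereal (g (x T) + integral {s..T} f) \<le> ereal (g (y T) + integral {s..T} \<eta> + K * \<Gamma> * integral {0..T} (k R))"
      using y(5) Th unfolding R_def by (metis order_trans)
    then have "g (x T) + integral {s..T} f \<le> g (y T) + integral {s..T} \<eta> + K * \<Gamma> * integral {0..T} (k R)" by simp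
    moreover have "g (y T) - g (x T) \<le> L * (K * \<Gamma>)"
    proof -
      have "\<bar>g (y T) - g (x T)\<bar> \<le> L * norm (y T - x T)"
        using y(3) bd[of T] s by (intro L(2)) (auto simp: R_def)
      also have "\<dots> \<le> L * (K * \<Gamma>)" using y(4) L(1) by (rule mult_left_mono)
      finally show ?thesis by linarith
    qed
    ultimately have "integral {s..T} f - integral {s..T} \<eta> \<le> B * \<Gamma>"
      by (simp add: B_def algebra_simps)
    also have "\<dots> \<le> B * integral {s..T} q" using \<Gamma>_le \<open>B \<ge> 0\<close> by (rule mult_left_mono)
    finally have le: "integral {s..T} f - integral {s..T} \<eta> - B * integral {s..T} q \<le> 0" by simp
    \<comment> \<open>The saving minus the largest cost of correction. By optimality its integral is
      at most 0, whereas D vanishes on G and is positive outside G and N; so the complement of G is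
      negligible.\<close>
    define D where "D t = f t - \<eta> t - B * q t" for t
    have Bq: "(\<lambda>t. B * q t) absolutely_integrable_on {s..T}"
      using absolutely_integrable_scaleR_left[OF q, of B] by simp
    have D: "D absolutely_integrable_on {s..T}"
      unfolding D_def[abs_def] by (intro set_integral_diff(1) f \<eta> Bq)
    have D_int: "integral {s..T} D = integral {s..T} f - integral {s..T} \<eta> - B * integral {s..T} q"
    proof -
      have i: "f integrable_on {s..T}" "\<eta> integrable_on {s..T}" "(\<lambda>t. B * q t) integrable_on {s..T}"
        using f \<eta> Bq by (auto simp: absolutely_integrable_on_def)
      have "integral {s..T} D = integral {s..T} (\<lambda>t. f t - \<eta> t) - integral {s..T} (\<lambda>t. B * q t)"
        unfolding D_def[abs_def] by (intro Henstock_Kurzweil_Integration.integral_diff integrable_diff i)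
      also have "integral {s..T} (\<lambda>t. f t - \<eta> t) = integral {s..T} f - integral {s..T} \<eta>"
        by (intro Henstock_Kurzweil_Integration.integral_diff i)
      finally show ?thesis by simp
    qed
    have D_pos: "0 < D t" if t: "t \<in> {s..T} - N - G" for t
    proof -
      have "\<mu> t < f t" using t by (auto simp: G_def)
      moreover have "- H t (x t) 0 \<le> \<bar>H t 0 0\<bar> + R * k R t" using H0[of t] t by auto
      ultimately show ?thesis using t by (simp add: D_def \<eta>_def q_def \<mu>_def algebra_simps)
    qed
    \<comment> \<open>Setting D to zero on N makes it nonnegative at every point of the
      interval.\<close>
    define D' where "D' t = (if t \<in> N then 0 else D t)" for t
    have D': "D' absolutely_integrable_on {s..T}"
      by (rule absolutely_integrable_spike[OF D N]) (simp add: D'_def)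
    have D'_int: "integral {s..T} D' = integral {s..T} D"
      by (rule integral_spike[OF N]) (simp add: D'_def)
    have null: "negligible {t \<in> {s..T}. D' t \<noteq> 0}"
    proof (rule negligible_nonzero_if_integral_nonpos[OF D'])
      show "0 \<le> D' t" if "t \<in> {s..T}" for t
      proof (cases "t \<in> N \<or> t \<in> G")
        case True
        then show ?thesis by (auto simp: D'_def D_def \<eta>_def q_def)
      next
        case False
        then show ?thesis using D_pos[of t] that by (simp add: D'_def)
      qed
    qed (use le D_int D'_int in auto)
    show ?thesis
      unfolding velocity_bound_def eventually_ae_filter_negligible
    proof (intro exI conjI)
      show "negligible (N \<union> {t \<in> {s..T}. D' t \<noteq> 0})" using N null by simp
      have "\<exists>h. Hstar H t (x t) (?x' t) = ereal h \<and>
          norm (?x' t, h) \<le> \<bar>H t 0 0\<bar> + R * k R t + (1 + R) * (1 + 2 * B) * c t"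
        if t: "t \<in> {s..T}" "t \<notin> N" "D' t = 0" for t
      proof (intro exI conjI)
        have "t \<in> G" using D_pos[of t] t by (auto simp: D'_def)
        then have up: "f t \<le> \<mu> t" by (simp add: G_def)
        \<comment> \<open>Membership in G bounds f only from above; the bound from below comes from
          testing the conjugate at p = 0.\<close>
        have "- f t \<le> \<bar>H t 0 0\<bar> + R * k R t" using f_low[of t] H0[of t] t by auto
        moreover have "0 \<le> 2 * B * (1 + R) * c t" using \<open>B \<ge> 0\<close> R H4_c(2)[OF in0[OF t(1)]] by simp
        ultimately have "- f t \<le> \<mu> t" unfolding \<mu>_def by linarith
        with up have "\<bar>f t\<bar> \<le> \<mu> t" by (simp add: abs_le_iff)
        moreover have "norm (?x' t) \<le> (1 + R) * c t" using speed[OF t(1) cle[of t]] t by simp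
        moreover have "norm (?x' t, f t) \<le> norm (?x' t) + \<bar>f t\<bar>" using norm_Pair_le[of "?x' t" "f t"] by simp
        ultimately show "norm (?x' t, f t) \<le> \<bar>H t 0 0\<bar> + R * k R t + (1 + R) * (1 + 2 * B) * c t"
          by (simp add: \<mu>_def algebra_simps)
        show "Hstar H t (x t) (?x' t) = ereal (f t)" by (rule Hs) (use t in simp)
      qed
      then show "{t. \<not> (t \<in> {s..T} \<longrightarrow> (\<exists>h. Hstar H t (x t) (?x' t) = ereal h \<and>
          norm (?x' t, h) \<le> \<bar>H t 0 0\<bar> + R * k R t + (1 + R) * (1 + 2 * B) * c t))}
          \<subseteq> N \<union> {t \<in> {s..T}. D' t \<noteq> 0}" by blast
    qed
  qed
  \<comment> \<open>The norm of a pair is at most the sum of the norms of its entries, so the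
    velocity bound (1 + R) * c t is added to the term 2 * B * (1 + R) * c t of the
    threshold.\<close>
  show ?thesis by (rule that[of "(1 + R) * (1 + 2 * B)"]) (use main in \<open>simp add: R_def\<close>)
qed

end

theorem theorem7p4:
  fixes H :: "real \<Rightarrow> 'a::euclidean_space \<Rightarrow> 'a \<Rightarrow> real"
    and c :: "real \<Rightarrow> real"
    and k :: "real \<Rightarrow> real \<Rightarrow> real"
    and g :: "'a \<Rightarrow> real"
    and T :: real
  assumes T_pos: "0 < T"
    and H1: "\<And>x p. (\<lambda>t. H t x p) \<in> borel_measurable (lebesgue_on {0..T})"
    and H2: "\<And>t. t \<in> {0..T} \<Longrightarrow> continuous_on UNIV (\<lambda>(x, p). H t x p)"
    and H3: "\<And>t x. t \<in> {0..T} \<Longrightarrow> convex_on UNIV (H t x)"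
    and H4_c: "c absolutely_integrable_on {0..T}" "\<And>t. t \<in> {0..T} \<Longrightarrow> 0 \<le> c t"
    and H4: "\<And>t x p q. t \<in> {0..T} \<Longrightarrow>
               \<bar>H t x p - H t x q\<bar> \<le> c t * (1 + norm x) * norm (p - q)"
    and HLC_k: "\<And>R. 0 < R \<Longrightarrow> k R absolutely_integrable_on {0..T}"
               "\<And>R t. 0 < R \<Longrightarrow> t \<in> {0..T} \<Longrightarrow> 0 \<le> k R t"
    and HLC: "\<And>R t x y p. 0 < R \<Longrightarrow> t \<in> {0..T} \<Longrightarrow> norm x \<le> R \<Longrightarrow> norm y \<le> R \<Longrightarrow>
               \<bar>H t x p - H t y p\<bar> \<le> k R t * (1 + norm p) * norm (x - y)"
    and H00: "(\<lambda>t. H t 0 0) absolutely_integrable_on {0..T}"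
    and g_loclip: "\<And>z. \<exists>e>0. \<exists>L. L-lipschitz_on (ball z e) g"
  shows "(\<forall>M>0. \<exists>lam. lam absolutely_integrable_on {0..T} \<and>
            (\<forall>t0 x0 xb. t0 \<in> {0..T} \<and> x0 \<in> cball 0 M \<and> is_minimizer H g T t0 x0 xb
                \<longrightarrow> velocity_bound H T t0 xb lam))
       \<and> ((continuous_on ({0..T} \<times> UNIV \<times> UNIV) (\<lambda>(t, x, p). H t x p)
            \<and> (\<forall>R>0. continuous_on {0..T} (k R)) \<and> continuous_on {0..T} c) \<longrightarrow>
          (\<forall>M>0. \<exists>lam. continuous_on {0..T} lam \<and>
            (\<forall>t0 x0 xb. t0 \<in> {0..T} \<and> x0 \<in> cball 0 M \<and> is_minimizer H g T t0 x0 xb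
                \<longrightarrow> velocity_bound H T t0 xb lam)))"
proof -
  interpret bolza_problem H c k g T
    by unfold_locales (fact T_pos H1 H2 H3 H4_c H4 HLC_k HLC H00 g_loclip)+
  \<comment> \<open>The same formula serves both claims, being integrable with the data and
    continuous with them. M enters through the radius and through C.\<close>
  define lam where "lam M C t = \<bar>H t 0 0\<bar> + radius M * k (radius M) t + C * c t" for M C t
  have bound: "\<exists>C. \<forall>t0 x0 xb. t0 \<in> {0..T} \<and> x0 \<in> cball 0 M \<and> is_minimizer H g T t0 x0 xb
      \<longrightarrow> velocity_bound H T t0 xb (lam M C)" if M: "0 < M" for M
  proof -
    obtain C where C: "\<And>s x0 x. s \<in> {0..T} \<Longrightarrow> norm x0 \<le> M \<Longrightarrow> is_minimizer H g T s x0 x \<Longrightarrow>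
        velocity_bound H T s x (\<lambda>t. \<bar>H t 0 0\<bar> + radius M * k (radius M) t + C * c t)"
      by (rule minimizer_velocity_bound[OF M]) (rule that)
    show ?thesis
      by (intro exI[of _ C] allI impI) (unfold lam_def[abs_def], rule C, auto)
  qed
  show ?thesis
  proof (intro conjI impI allI)
    fix M :: real assume M: "0 < M"
    obtain C where C: "\<forall>t0 x0 xb. t0 \<in> {0..T} \<and> x0 \<in> cball 0 M \<and> is_minimizer H g T t0 x0 xb
      \<longrightarrow> velocity_bound H T t0 xb (lam M C)" using bound[OF M] ..
    have "(\<lambda>t. \<bar>H t 0 0\<bar>) absolutely_integrable_on {0..T}"
      using absolutely_integrable_norm[OF H00] by (simp add: o_def)
    moreover have "(\<lambda>t. radius M * k (radius M) t) absolutely_integrable_on {0..T}"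
      using absolutely_integrable_scaleR_left[OF HLC_k(1)[OF radius_ge(2)[OF M]], of "radius M"] by simp
    moreover have "(\<lambda>t. C * c t) absolutely_integrable_on {0..T}"
      using absolutely_integrable_scaleR_left[OF H4_c(1), of C] by simp
    ultimately have "lam M C absolutely_integrable_on {0..T}"
      unfolding lam_def[abs_def] by (intro set_integral_add(1))
    with C show "\<exists>lam. lam absolutely_integrable_on {0..T} \<and>
            (\<forall>t0 x0 xb. t0 \<in> {0..T} \<and> x0 \<in> cball 0 M \<and> is_minimizer H g T t0 x0 xb
                \<longrightarrow> velocity_bound H T t0 xb lam)" by blast
  next
    fix M :: real
    assume cont: "continuous_on ({0..T} \<times> UNIV \<times> UNIV) (\<lambda>(t, x, p). H t x p)
            \<and> (\<forall>R>0. continuous_on {0..T} (k R)) \<and> continuous_on {0..T} c" and M: "0 < M"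
    obtain C where C: "\<forall>t0 x0 xb. t0 \<in> {0..T} \<and> x0 \<in> cball 0 M \<and> is_minimizer H g T t0 x0 xb
      \<longrightarrow> velocity_bound H T t0 xb (lam M C)" using bound[OF M] ..
    have "continuous_on {0..T} ((\<lambda>(t, x, p). H t x p) \<circ> (\<lambda>t. (t, 0, 0)))"
      by (intro continuous_on_compose continuous_intros continuous_on_subset[OF conjunct1[OF cont]]) auto
    then have "continuous_on {0..T} (\<lambda>t. H t 0 0)" by (simp add: o_def)
    then have "continuous_on {0..T} (lam M C)"
      unfolding lam_def[abs_def] using cont radius_ge(2)[OF M] by (intro continuous_intros) auto
    with C show "\<exists>lam. continuous_on {0..T} lam \<and>
            (\<forall>t0 x0 xb. t0 \<in> {0..T} \<and> x0 \<in> cball 0 M \<and> is_minimizer H g T t0 x0 xb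
                \<longrightarrow> velocity_bound H T t0 xb lam)" by blast
  qed
qed

end
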